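(* Let $N\ge1$, let $a$ be an $N\times N$ matrix function in $K_1^1$ and suppose $\det a$ has no zeros on $\mathbf T$. Let $w$ be the winding number of $\det a$ about the origin. Then for all $n\in\mathbf Z$ and $s\in\mathbf C$, $$\det\bigl(I+sP-sL(a)Q_nL(a^{-1})\bigr)=(1+s)^{nN+w}\det\bigl(I-s^2Q_nL(a^{-1})QL(a)Q_n\bigr)\quad\text{if } s\ne-1,$$ and $$\det\bigl(I+sP-sL(a)Q_nL(a^{-1})\bigr)=(1-s)^{-nN-w}\det\bigl(I-s^2(I-Q_n)L(a^{-1})PL(a)(I-Q_n)\bigr)\quad\text{if } s\ne1.$$ All operators act on $\ell^2(\mathbf Z,\mathbf C^N)$.
   Context: $\mathbf T$ is the complex unit circle and $L^\infty=L^\infty_{N\times N}$ is the algebra of all $N\times N$ matrix functions with entries in $L^\infty(\mathbf T)$. For $a\in L^\infty$, $a_k=\frac1{2\pi}\int_0^{2\pi}a(e^{i\theta})e^{-ik\theta}\,d\theta$ ($k\in\mathbf Z$) are the Fourier coefficients. With any fixed matrix norm $\|\cdot\|$ on $\mathbf C^{N\times N}$, put $K_1^1=\{a\in L^\infty:\sum_{n\in\mathbf Z}(|n|+1)\|a_n\|<\infty\}$. Functions in $K_1^1$ are continuous, and if $a\in K_1^1$ is invertible in $L^\infty$ then $a^{-1}\in K_1^1$. $L(a)=(a_{j-k})_{j,k=-\infty}^\infty$ is the block Laurent operator on $\ell^2(\mathbf Z,\mathbf C^N)$. Projections on $\ell^2(\mathbf Z,\mathbf C^N)$: $(Px)_k=x_k$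 for $k\ge0$ and $0$ for $k<0$; $Q=I-P$; for $n\in\mathbf Z$, $(Q_nx)_k=x_k$ for $k\ge n$ and $0$ for $k<n$. Determinants are Fredholm determinants of identity plus trace class operators. *)

theory Defs
  imports
    "HOL-Complex_Analysis.Complex_Analysis"
    "HOL-Combinatorics.Permutations"
    "HOL-Library.Function_Algebras"
begin

text \<open>
  Matrix functions on the unit circle are represented by functions of a complex variable of which
  only the values on \<^term>\<open>sphere 0 1 :: complex set\<close> matter. The size of the matrices is
  \<open>CARD('n)\<close>.
\<close>

definition fourier_coeff :: "(complex \<Rightarrow> complex^'n^'n) \<Rightarrow> int \<Rightarrow> complex^'n^'n" where
  "fourier_coeff a k = (\<chi> i j. 1 / (2 * pi) *
     (LINT \<theta>:{0..2*pi}|lebesgue. a (cis \<theta>) $ i $ j * exp (- \<i> * of_int k * of_real \<theta>)))"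

definition L_infinity :: "(complex \<Rightarrow> complex^'n^'n) set" where
  "L_infinity = {a. (\<lambda>\<theta>. a (cis \<theta>)) \<in> borel_measurable lebesgue \<and>
     (\<exists>C. AE \<theta> in lebesgue. norm (a (cis \<theta>)) \<le> C)}"

text \<open>
  The norm on matrices is the Frobenius norm; since all norms on the matrices are equivalent, the
  class does not depend on this choice.
\<close>

definition K11 :: "(complex \<Rightarrow> complex^'n^'n) set" where
  "K11 = {a \<in> L_infinity.
     (\<lambda>n::int. (real_of_int \<bar>n\<bar> + 1) * norm (fourier_coeff a n)) summable_on UNIV}"


text \<open>
  Operators on $\ell^2(\mathbf Z,\mathbf C^N)$ are represented by functions on all two-sided
  sequences of which only the values on \<open>ell2\<close> matter. Sums and differences of operators are
  pointwise; products of operators are compositions.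
\<close>

type_synonym 'n seq = "int \<Rightarrow> complex^'n"
type_synonym 'n operator = "'n seq \<Rightarrow> 'n seq"

definition ell2 :: "'n::finite seq set" where
  "ell2 = {x. (\<lambda>k. (norm (x k))\<^sup>2) summable_on UNIV}"

definition ell2_norm :: "'n::finite seq \<Rightarrow> real" where
  "ell2_norm x = sqrt (\<Sum>\<^sub>\<infinity>k. (norm (x k))\<^sup>2)"

definition scale_seq :: "complex \<Rightarrow> 'n::finite seq \<Rightarrow> 'n seq" where
  "scale_seq s x = (\<lambda>k. s *s x k)"

definition scale_op :: "complex \<Rightarrow> 'n::finite operator \<Rightarrow> 'n operator" (infixr \<open>*\<^sub>o\<close> 75) where
  "s *\<^sub>o A = (\<lambda>x. scale_seq s (A x))"

definition laurent :: "(complex \<Rightarrow> complex^'n^'n) \<Rightarrow> 'n::finite operator" where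
  "laurent a x = (\<lambda>j. \<Sum>\<^sub>\<infinity>k. fourier_coeff a (j - k) *v x k)"

definition proj_P :: "'n::finite operator" where
  "proj_P x = (\<lambda>k. if k \<ge> 0 then x k else 0)"

definition proj_Q :: "'n::finite operator" where
  "proj_Q = id - proj_P"

definition proj_Qn :: "int \<Rightarrow> 'n::finite operator" where
  "proj_Qn n x = (\<lambda>k. if k \<ge> n then x k else 0)"


definition bounded_operator :: "'n::finite operator \<Rightarrow> bool" where
  "bounded_operator A \<longleftrightarrow>
     (\<forall>x\<in>ell2. A x \<in> ell2) \<and>
     (\<forall>x\<in>ell2. \<forall>y\<in>ell2. A (x + y) = A x + A y) \<and>
     (\<forall>s. \<forall>x\<in>ell2. A (scale_seq s x) = scale_seq s (A x)) \<and>
     (\<exists>C. \<forall>x\<in>ell2. ell2_norm (A x) \<le> C * ell2_norm x)"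

definition operator_norm :: "'n::finite operator \<Rightarrow> real" where
  "operator_norm A = (SUP x\<in>{x\<in>ell2. ell2_norm x \<le> 1}. ell2_norm (A x))"

definition rank_le :: "'n::finite operator \<Rightarrow> nat \<Rightarrow> bool" where
  "rank_le A m \<longleftrightarrow> (\<exists>u :: nat \<Rightarrow> 'n seq. (\<forall>i<m. u i \<in> ell2) \<and>
     (\<forall>x\<in>ell2. \<exists>c. A x = (\<Sum>i<m. scale_seq (c i) (u i))))"

text \<open>
  The singular values, in non-increasing order and numbered from 0, as the distances to the
  operators of rank at most \<open>m\<close>.
\<close>

definition singular_value :: "'n::finite operator \<Rightarrow> nat \<Rightarrow> real" where
  "singular_value A m = (INF F\<in>{F. bounded_operator F \<and> rank_le F m}. operator_norm (A - F))"

definition trace_class :: "'n::finite operator \<Rightarrow> bool" where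
  "trace_class A \<longleftrightarrow> bounded_operator A \<and> summable (singular_value A)"


definition basis_seq :: "int \<times> 'n::finite \<Rightarrow> 'n seq" where
  "basis_seq q = (\<lambda>k. if k = fst q then axis (snd q) 1 else 0)"

definition matrix_entry :: "'n::finite operator \<Rightarrow> int \<times> 'n \<Rightarrow> int \<times> 'n \<Rightarrow> complex" where
  "matrix_entry A p q = A (basis_seq q) (fst p) $ snd p"

definition principal_minor :: "'n::finite operator \<Rightarrow> (int \<times> 'n) set \<Rightarrow> complex" where
  "principal_minor A S =
     (\<Sum>\<pi> | \<pi> permutes S. of_int (sign \<pi>) * (\<Prod>p\<in>S. matrix_entry A p (\<pi> p)))"

text \<open>
  The trace of the \<open>m\<close>-th exterior power of \<open>A\<close>, taken in the orthonormal basis of wedge products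
  of \<open>m\<close> distinct vectors \<open>basis_seq q\<close>; its diagonal matrix entries are the principal minors.
\<close>

definition exterior_trace :: "'n::finite operator \<Rightarrow> nat \<Rightarrow> complex" where
  "exterior_trace A m = (\<Sum>\<^sub>\<infinity>S\<in>{S. finite S \<and> card S = m}. principal_minor A S)"

text \<open>
  The Fredholm determinant of $T = I + A$ with $A$ of trace class, as the Fredholm series
  $\sum_m \mathrm{tr}\,\Lambda^m(A)$. It is meaningful only if \<open>determinant_class T\<close> holds.
\<close>

definition determinant_class :: "'n::finite operator \<Rightarrow> bool" where
  "determinant_class T \<longleftrightarrow> trace_class (T - id)"

definition fredholm_det :: "'n::finite operator \<Rightarrow> complex" where
  "fredholm_det T = (\<Sum>m. exterior_trace (T - id) m)"

end

theory Submission
  imports Defs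
begin

text \<open>
  Write \<open>b = a\<inverse>\<close>, \<open>p = P\<close> and \<open>q = L(a) Q\<^sub>n L(b)\<close>. The Laurent operators of \<open>a\<close> and \<open>b\<close> are
  inverse to each other, so \<open>p\<close> and \<open>q\<close> are idempotents, and \<open>T = I + s(p - q)\<close>. The theorem is a
  statement about two idempotents with nuclear difference, and its core is the factorization
  \<open>I + s(p - q) = (I + sp) (I - s\<^sup>2(I - p)q) (I + sq)\<inverse>\<close>. With
  \<open>U\<^sub>p(u) = (I - p) + u p\<close> and \<open>\<phi>(u) = det (U\<^sub>p(u) U\<^sub>q(u)\<inverse>)\<close>, multiplicativity and conjugation invariance of
  the determinant turn it into \<open>det (I + s(p - q)) = \<phi>(1 + s) det (I - s\<^sup>2(I - p)q)\<close>. Since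
  \<open>U\<^sub>p(uv) = U\<^sub>p(u) U\<^sub>p(v)\<close>, conjugation invariance also makes \<open>\<phi>\<close> a homomorphism of the group of nonzero complex
  numbers. Its derivative at 1 is the trace of \<open>p - q\<close>, hence \<open>\<phi>(u) = u\<^sup>k\<close> if that trace is the integer
  \<open>k\<close> (lemma \<open>schur_det_difference\<close>). The rule \<open>det (I + XY) = det (I + YX)\<close> then replaces
  \<open>(I - p)q\<close> by the operator in the first formula. Exchanging \<open>p\<close> with \<open>q\<close> and \<open>s\<close> with \<open>-s\<close> gives the second.

  The trace of \<open>p - q\<close> is \<open>nN + \<Sum>\<^sub>m m tr (a\<^sub>m b\<^sub>-\<^sub>m)\<close> by summation by parts along the diagonal. The sum over \<open>m\<close>
  is the mean over the circle of \<open>tr (a' b) / \<i> = (det a)' / (\<i> det a)\<close>, the winding number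
  (lemma \<open>trace_difference\<close>).

  Determinants are computed with matrices with respect to the standard basis. The weight in the definition
  of \<open>K11\<close> is exactly what makes the Hankel corners of \<open>L(a)\<close> have absolutely summable entries: the
  coefficient \<open>a\<^sub>j\<close> occurs about \<open>|j|\<close> times in a corner. For a matrix with absolutely summable entries the
  Fredholm series is a sum of principal minors over all finite index sets, dominated by products of row sums,
  so identities for finite determinants survive the limit of growing truncations
  (lemmas \<open>perturbation_det_mult\<close> and \<open>perturbation_det_swap\<close>). The remaining factors have only bounded row and
  column sums. They form a ring, in which the matrices with summable entries are an ideal.

  The same weight gives the trace class property: cutting a corner off after \<open>m\<close> block rows leaves an error of
  norm at most a constant times the sum of \<open>\<parallel>a\<^sub>j\<parallel>\<close> over \<open>|j| > m\<close>, and these errors are summable over \<open>m\<close>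
  (lemmas \<open>rank_approximable_corner\<close> and \<open>trace_class_rank_approximable\<close>). Only corners of \<open>L(a)\<close> enter; from
  \<open>b\<close> one uses the summability of \<open>\<parallel>b\<^sub>k\<parallel>\<close>, which holds because \<open>b\<close> is continuously differentiable along with \<open>a\<close>.
\<close>

section \<open>Fourier coefficients and absolutely convergent Fourier series\<close>

lemma has_sum_finite_sum:
  fixes f :: "'a \<Rightarrow> 'b \<Rightarrow> 'c :: {comm_monoid_add, topological_comm_monoid_add}"
  assumes "finite F" "\<And>q. q \<in> F \<Longrightarrow> (f q has_sum s q) A"
  shows "((\<lambda>r. \<Sum>q\<in>F. f q r) has_sum (\<Sum>q\<in>F. s q)) A"
  using assms by (induction F rule: finite_induct) (auto intro!: has_sum_add)

definition fourier :: "(real \<Rightarrow> complex) \<Rightarrow> int \<Rightarrow> complex" where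
  "fourier h k = 1 / (2 * pi) * integral {0..2*pi} (\<lambda>\<theta>. h \<theta> * cis (- (of_int k * \<theta>)))"

lemma fourier_integrable:
  assumes "continuous_on UNIV h"
  shows "(\<lambda>\<theta>. h \<theta> * cis (- (of_int k * \<theta>))) integrable_on {a..b}"
  by (intro integrable_continuous_interval continuous_intros continuous_on_subset[OF assms]) auto

lemma fourier_add:
  assumes "continuous_on UNIV f" "continuous_on UNIV g"
  shows "fourier (\<lambda>\<theta>. f \<theta> + g \<theta>) k = fourier f k + fourier g k"
  unfolding fourier_def distrib_right
  by (subst Henstock_Kurzweil_Integration.integral_add) (intro fourier_integrable assms, intro fourier_integrable assms, simp add: algebra_simps)

lemma fourier_cmult: "fourier (\<lambda>\<theta>. c * f \<theta>) k = c * fourier f k"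
proof -
  have "integral {0..2*pi} (\<lambda>\<theta>. c * f \<theta> * cis (- (of_int k * \<theta>))) =
     c * integral {0..2*pi} (\<lambda>\<theta>. f \<theta> * cis (- (of_int k * \<theta>)))"
    unfolding mult.assoc by (rule integral_mult_right)
  then show ?thesis by (simp add: fourier_def)
qed

lemma fourier_diff:
  assumes "continuous_on UNIV f" "continuous_on UNIV g"
  shows "fourier (\<lambda>\<theta>. f \<theta> - g \<theta>) k = fourier f k - fourier g k"
  using fourier_add[of f "\<lambda>\<theta>. (- 1) * g \<theta>" k] fourier_cmult[of "- 1" g k] assms
  by (auto intro!: continuous_intros)

lemma fourier_sum:
  assumes "finite I" "\<And>i. i \<in> I \<Longrightarrow> continuous_on UNIV (f i)"
  shows "fourier (\<lambda>\<theta>. \<Sum>i\<in>I. f i \<theta>) k = (\<Sum>i\<in>I. fourier (f i) k)"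
  using assms
proof (induction I rule: finite_induct)
  case empty
  then show ?case by (simp add: fourier_def)
next
  case (insert i I)
  then show ?case by (simp add: fourier_add continuous_on_sum)
qed

lemma fourier_shift: "fourier (\<lambda>\<theta>. cis (of_int m * \<theta>) * f \<theta>) k = fourier f (k - m)"
proof -
  have "cis (of_int m * \<theta>) * f \<theta> * cis (- (of_int k * \<theta>)) = f \<theta> * cis (- (of_int (k - m) * \<theta>))" for \<theta>
  proof -
    have "cis (of_int m * \<theta>) * cis (- (of_int k * \<theta>)) = cis (- (of_int (k - m) * \<theta>))"
      by (simp add: cis_mult algebra_simps)
    then show ?thesis by (metis mult.assoc mult.commute)
  qed
  then show ?thesis unfolding fourier_def by (simp only:)
qed

lemma cis_has_vector_derivative:
  "((\<lambda>\<theta>. cis (c * \<theta>)) has_vector_derivative \<i> * c * cis (c * \<theta>)) (at \<theta> within S)"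
proof -
  have "((\<lambda>\<theta>. c * \<theta>) has_real_derivative c) (at \<theta> within S)"
    by (auto intro!: derivative_eq_intros)
  then have "((\<lambda>\<theta>. exp (\<i> * of_real (c * \<theta>))) has_vector_derivative \<i> * c * exp (\<i> * of_real (c * \<theta>))) (at \<theta> within S)"
    by (auto intro!: derivative_eq_intros has_vector_derivative_real_field simp: has_real_derivative_iff_has_vector_derivative)
  then show ?thesis by (simp add: cis_conv_exp)
qed

lemma fourier_one: "fourier (\<lambda>_. 1) k = (if k = 0 then 1 else 0)"
proof (cases "k = 0")
  case False
  let ?F = "\<lambda>\<theta>. cis (- of_int k * \<theta>) / (\<i> * (- of_int k))"
  have "((\<lambda>\<theta>. cis (- of_int k * \<theta>)) has_integral ?F (2*pi) - ?F 0) {0..2*pi}"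
  proof (rule fundamental_theorem_of_calculus)
    show "(?F has_vector_derivative cis (- of_int k * \<theta>)) (at \<theta> within {0..2*pi})" for \<theta>
      using has_vector_derivative_divide[OF cis_has_vector_derivative[of "- of_int k" \<theta> "{0..2*pi}"], of "\<i> * (- of_int k)"] False
      by simp
  qed auto
  moreover have "cis (- of_int k * (2 * pi)) = 1"
    using cis_multiple_2pi[of "of_int (- k)"] by (simp add: mult.commute mult.left_commute)
  ultimately show ?thesis using False by (simp add: fourier_def integral_unique)
qed (simp add: fourier_def scaleR_conv_of_real)

lemma fourier_cis: "fourier (\<lambda>\<theta>. cis (of_int m * \<theta>)) k = (if k = m then 1 else 0)"
  using fourier_shift[of m "\<lambda>_. 1" k] by (simp add: fourier_one)

lemma
  fixes c :: "int \<Rightarrow> complex"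
  assumes "(\<lambda>m. norm (c m)) summable_on UNIV"
  shows fourier_series_uniform_limit:
      "uniform_limit UNIV (\<lambda>M \<theta>. \<Sum>m\<in>M. c m * cis (of_int m * \<theta>)) (\<lambda>\<theta>. \<Sum>\<^sub>\<infinity>m. c m * cis (of_int m * \<theta>)) (finite_subsets_at_top UNIV)"
    and continuous_on_fourier_series: "continuous_on UNIV (\<lambda>\<theta>. \<Sum>\<^sub>\<infinity>m. c m * cis (of_int m * \<theta>))"
proof -
  show *: "uniform_limit UNIV (\<lambda>M \<theta>. \<Sum>m\<in>M. c m * cis (of_int m * \<theta>)) (\<lambda>\<theta>. \<Sum>\<^sub>\<infinity>m. c m * cis (of_int m * \<theta>)) (finite_subsets_at_top UNIV)"
    by (rule Weierstrass_m_test_general[OF _ assms]) (simp add: norm_mult)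
  show "continuous_on UNIV (\<lambda>\<theta>. \<Sum>\<^sub>\<infinity>m. c m * cis (of_int m * \<theta>))"
    by (rule uniform_limit_theorem[OF _ *]) (auto intro!: always_eventually continuous_intros)
qed

text \<open>The M-test gives uniform convergence, which permits integration term by term. The factor \<open>g\<close> makes the
  lemma serve both for convolutions and for recovering a function from the series of its derivative.\<close>

lemma fourier_series_integral:
  fixes c :: "int \<Rightarrow> complex"
  assumes c: "(\<lambda>m. norm (c m)) summable_on UNIV" and g: "continuous_on UNIV g"
  shows "((\<lambda>m. c m * integral {a..b} (\<lambda>\<theta>. cis (of_int m * \<theta>) * g \<theta>)) has_sum
      integral {a..b} (\<lambda>\<theta>. (\<Sum>\<^sub>\<infinity>m. c m * cis (of_int m * \<theta>)) * g \<theta>)) UNIV"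
proof -
  let ?S = "\<lambda>\<theta>. \<Sum>\<^sub>\<infinity>m. c m * cis (of_int m * \<theta>)"
  have g': "continuous_on {a..b} g" by (rule continuous_on_subset[OF g]) simp
  have "bounded (g ` {a..b})"
    by (intro compact_imp_bounded compact_continuous_image g') simp
  moreover have "bounded (?S ` {a..b})"
    by (intro compact_imp_bounded compact_continuous_image continuous_on_subset[OF continuous_on_fourier_series[OF c]]) auto
  moreover have "uniform_limit {a..b} (\<lambda>M \<theta>. \<Sum>m\<in>M. c m * cis (of_int m * \<theta>)) ?S (finite_subsets_at_top UNIV)"
    by (rule uniform_limit_on_subset[OF fourier_series_uniform_limit[OF c]]) simp
  ultimately have "uniform_limit {a..b} (\<lambda>M \<theta>. (\<Sum>m\<in>M. c m * cis (of_int m * \<theta>)) * g \<theta>) (\<lambda>\<theta>. ?S \<theta> * g \<theta>) (finite_subsets_at_top UNIV)"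
    by (intro uniform_lim_mult uniform_limit_const)
  then obtain I J where IJ: "\<And>M. ((\<lambda>\<theta>. (\<Sum>m\<in>M. c m * cis (of_int m * \<theta>)) * g \<theta>) has_integral I M) {a..b}"
    "((\<lambda>\<theta>. ?S \<theta> * g \<theta>) has_integral J) {a..b}" "(I \<longlongrightarrow> J) (finite_subsets_at_top UNIV)"
    by (rule uniform_limit_integral) (auto intro!: continuous_intros g')
  have "I M = (\<Sum>m\<in>M. c m * integral {a..b} (\<lambda>\<theta>. cis (of_int m * \<theta>) * g \<theta>))" if "finite M" for M
  proof -
    have "((\<lambda>\<theta>. \<Sum>m\<in>M. c m * (cis (of_int m * \<theta>) * g \<theta>)) has_integral (\<Sum>m\<in>M. c m * integral {a..b} (\<lambda>\<theta>. cis (of_int m * \<theta>) * g \<theta>))) {a..b}"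
      by (intro has_integral_sum that has_integral_mult_right integrable_integral integrable_continuous_interval continuous_intros g')
    then show ?thesis
      using IJ(1)[of M] by (simp add: sum_distrib_right mult.assoc has_integral_unique)
  qed
  then have "\<forall>\<^sub>F M in finite_subsets_at_top UNIV. I M = (\<Sum>m\<in>M. c m * integral {a..b} (\<lambda>\<theta>. cis (of_int m * \<theta>) * g \<theta>))"
    by (intro eventually_finite_subsets_at_top_weakI) auto
  from Lim_transform_eventually[OF IJ(3) this] IJ(2) show ?thesis
    by (simp add: has_sum_def integral_unique)
qed

text \<open>A factor \<open>cis (m \<theta>)\<close> shifts the coefficients of \<open>g\<close> by \<open>m\<close>, so a product has the convolution of the
  coefficient families as its coefficients. In \<open>a b\<close>, \<open>b a\<close> and \<open>a' b\<close> the
  series is that of \<open>a\<close> or of its derivative, and \<open>g\<close> is the continuous function \<open>b\<close>.\<close>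

lemma fourier_series_mult:
  fixes c :: "int \<Rightarrow> complex"
  assumes c: "(\<lambda>m. norm (c m)) summable_on UNIV" and g: "continuous_on UNIV g"
  shows "((\<lambda>m. c m * fourier g (k - m)) has_sum fourier (\<lambda>\<theta>. (\<Sum>\<^sub>\<infinity>m. c m * cis (of_int m * \<theta>)) * g \<theta>) k) UNIV"
proof -
  have "((\<lambda>m. c m * integral {0..2*pi} (\<lambda>\<theta>. cis (of_int m * \<theta>) * (g \<theta> * cis (- (of_int k * \<theta>))))) has_sum
      integral {0..2*pi} (\<lambda>\<theta>. (\<Sum>\<^sub>\<infinity>m. c m * cis (of_int m * \<theta>)) * (g \<theta> * cis (- (of_int k * \<theta>))))) UNIV"
    by (intro fourier_series_integral c continuous_intros g)
  from has_sum_cmult_right[OF this, of "1 / (2 * pi)"]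
  have "((\<lambda>m. c m * fourier (\<lambda>\<theta>. cis (of_int m * \<theta>) * g \<theta>) k) has_sum fourier (\<lambda>\<theta>. (\<Sum>\<^sub>\<infinity>m. c m * cis (of_int m * \<theta>)) * g \<theta>) k) UNIV"
    by (simp add: fourier_def mult_ac)
  then show ?thesis by (simp add: fourier_shift)
qed

lemma fourier_series_coeff:
  assumes "(\<lambda>m. norm (c m)) summable_on UNIV"
  shows "fourier (\<lambda>\<theta>. \<Sum>\<^sub>\<infinity>m. c m * cis (of_int m * \<theta>)) k = c k"
proof -
  have "((\<lambda>m. c m * fourier (\<lambda>_. 1) (k - m)) has_sum fourier (\<lambda>\<theta>. (\<Sum>\<^sub>\<infinity>m. c m * cis (of_int m * \<theta>)) * 1) k) UNIV"
    by (rule fourier_series_mult[OF assms]) simp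
  moreover have "((\<lambda>m. c m * fourier (\<lambda>_. 1) (k - m)) has_sum c k) UNIV"
    by (rule has_sum_finite_neutralI[of "{k}"]) (auto simp: fourier_one)
  ultimately show ?thesis using has_sum_unique by fastforce
qed

lemma continuous_on_cis_comp:
  assumes "continuous_on (sphere 0 1) f"
  shows "continuous_on UNIV (\<lambda>\<theta>. f (cis \<theta>))"
  by (rule continuous_on_compose2[OF assms]) (auto intro!: continuous_intros)

lemma sphere_cis:
  assumes "z \<in> sphere (0 :: complex) 1"
  obtains \<theta> where "\<theta> \<in> {0..2*pi}" "z = cis \<theta>"
proof -
  have "z = cis (Arg2pi z)"
    using assms Arg2pi_eq[of z] by (simp add: cis_conv_exp)
  moreover have "Arg2pi z \<in> {0..2*pi}"
    using Arg2pi_ge_0[of z] Arg2pi_lt_2pi[of z] by simp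
  ultimately show ?thesis using that by blast
qed

text \<open>On the circle a real linear form is a combination of \<open>z\<close> and its conjugate, which shift the Fourier
  coefficients by one. For a product of polynomials the induction hypothesis is applied to the continuous
  function \<open>f p\<close> instead of \<open>f\<close>, hence \<open>f\<close> is arbitrary in the induction.\<close>

lemma polynomial_orthogonal:
  assumes p: "real_polynomial_function p" and f: "continuous_on (sphere 0 1) f"
    and zero: "\<And>k. fourier (\<lambda>\<theta>. f (cis \<theta>)) k = 0"
  shows "fourier (\<lambda>\<theta>. f (cis \<theta>) * of_real (p (cis \<theta>))) k = 0"
  using p f zero
proof (induction p arbitrary: f k rule: real_polynomial_function.induct)
  case (linear L)
  interpret bounded_linear L by fact
  note cf = continuous_on_cis_comp[OF linear.prems(1)]
  define \<alpha> \<beta> where "\<alpha> = (of_real (L 1) - \<i> * of_real (L \<i>)) / 2" and "\<beta> = (of_real (L 1) + \<i> * of_real (L \<i>)) / 2"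
  have L: "of_real (L (cis \<theta>)) = \<alpha> * cis (of_int 1 * \<theta>) + \<beta> * cis (of_int (- 1) * \<theta>)" for \<theta>
  proof -
    have "cis \<theta> = cos \<theta> *\<^sub>R 1 + sin \<theta> *\<^sub>R \<i>" by (simp add: complex_eq_iff)
    then have "L (cis \<theta>) = cos \<theta> * L 1 + sin \<theta> * L \<i>" by (simp only: add scale real_scaleR_def)
    then show ?thesis
      by (auto simp: \<alpha>_def \<beta>_def complex_eq_iff field_simps)
  qed
  have "(\<lambda>\<theta>. f (cis \<theta>) * of_real (L (cis \<theta>))) =
     (\<lambda>\<theta>. \<alpha> * (cis (of_int 1 * \<theta>) * f (cis \<theta>)) + \<beta> * (cis (of_int (- 1) * \<theta>) * f (cis \<theta>)))"
    unfolding L by (simp add: fun_eq_iff algebra_simps)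
  moreover have "fourier (\<lambda>\<theta>. \<alpha> * (cis (of_int 1 * \<theta>) * f (cis \<theta>)) + \<beta> * (cis (of_int (- 1) * \<theta>) * f (cis \<theta>))) k = 0"
    by (subst fourier_add) (auto intro!: continuous_intros cf simp only: fourier_cmult fourier_shift linear.prems(2) mult_zero_right add_0_left)
  ultimately show ?case by simp
next
  case (const c)
  then show ?case using fourier_cmult[of "of_real c" "\<lambda>\<theta>. f (cis \<theta>)" k] by (simp add: mult.commute)
next
  case (add p q)
  have c: "continuous_on UNIV (\<lambda>\<theta>. f (cis \<theta>) * of_real (p (cis \<theta>)))" if "real_polynomial_function p" for p
    using that add.prems(1)
    by (intro continuous_intros continuous_on_cis_comp) (auto intro!: continuous_at_imp_continuous_on continuous_real_polymonial_function)
  have "fourier (\<lambda>\<theta>. f (cis \<theta>) * of_real (p (cis \<theta>)) + f (cis \<theta>) * of_real (q (cis \<theta>))) k = 0"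
    using add.IH(1)[OF add.prems] add.IH(2)[OF add.prems] c add.hyps by (subst fourier_add) auto
  then show ?case by (simp add: distrib_left)
next
  case (mult p q)
  have c: "continuous_on (sphere 0 1) (\<lambda>z. f z * of_real (p z))"
    using mult.prems(1) mult.hyps
    by (intro continuous_intros) (auto intro!: continuous_at_imp_continuous_on continuous_real_polymonial_function)
  show ?case
    using mult.IH(2)[OF c mult.IH(1)[OF mult.prems]] by (simp add: mult.assoc)
qed

text \<open>The function \<open>f\<close> is orthogonal to all polynomials in the real coordinates. Approximating the conjugate of
  \<open>f\<close> uniformly by such a polynomial shows that the integral of \<open>|f|\<^sup>2\<close> is arbitrarily small.\<close>

lemma fourier_zero_imp_zero:
  assumes f: "continuous_on (sphere 0 1) f" and zero: "\<And>k. fourier (\<lambda>\<theta>. f (cis \<theta>)) k = 0"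
    and z: "z \<in> sphere 0 1"
  shows "f z = 0"
proof -
  have cf: "continuous_on {0..2*pi} (\<lambda>\<theta>. f (cis \<theta>))"
    by (rule continuous_on_subset[OF continuous_on_cis_comp[OF f]]) simp
  have int: "(\<lambda>\<theta>. norm (f (cis \<theta>))) integrable_on {0..2*pi}" 
    by (intro integrable_continuous_interval continuous_intros cf)
  define N where "N = integral {0..2*pi} (\<lambda>\<theta>. norm (f (cis \<theta>)))"
  have N: "N \<ge> 0" unfolding N_def by (intro integral_nonneg int) auto
  have le: "integral {0..2*pi} (\<lambda>\<theta>. (norm (f (cis \<theta>)))\<^sup>2) \<le> e * N" if "e > 0" for e
  proof -
    obtain g where g: "polynomial_function g" "\<And>x. x \<in> sphere 0 1 \<Longrightarrow> norm (cnj (f x) - g x) < e"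
      using Stone_Weierstrass_polynomial_function[of "sphere 0 1" "\<lambda>z. cnj (f z)" e] f \<open>e > 0\<close>
      by (auto intro!: continuous_intros)
    have reim: "real_polynomial_function (\<lambda>z. Re (g z))" "real_polynomial_function (\<lambda>z. Im (g z))"
      using g(1) bounded_linear_Re bounded_linear_Im unfolding polynomial_function_def by (auto simp: o_def)
    have cg: "continuous_on S g" for S
      by (rule continuous_on_polymonial_function[OF g(1)])
    have cgc: "continuous_on {0..2*pi} (\<lambda>\<theta>. g (cis \<theta>))"
      by (intro continuous_on_compose2[OF cg[of UNIV]] continuous_intros) auto
    have "f (cis \<theta>) * g (cis \<theta>) = f (cis \<theta>) * of_real (Re (g (cis \<theta>))) + \<i> * (f (cis \<theta>) * of_real (Im (g (cis \<theta>))))" for \<theta>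
      by (subst complex_eq[of "g (cis \<theta>)"]) (simp add: algebra_simps)
    then have "fourier (\<lambda>\<theta>. f (cis \<theta>) * g (cis \<theta>)) 0 = fourier (\<lambda>\<theta>. f (cis \<theta>) * of_real (Re (g (cis \<theta>)))) 0 + \<i> * fourier (\<lambda>\<theta>. f (cis \<theta>) * of_real (Im (g (cis \<theta>)))) 0"
      by (simp only:) (subst fourier_add, auto simp only: fourier_cmult intro!: continuous_intros continuous_on_cis_comp[OF f] continuous_on_cis_comp[OF cg])
    also have "\<dots> = 0" using polynomial_orthogonal[OF reim(1) f zero] polynomial_orthogonal[OF reim(2) f zero] by simp
    finally have "integral {0..2*pi} (\<lambda>\<theta>. f (cis \<theta>) * g (cis \<theta>)) = 0" by (simp add: fourier_def)
    moreover have "integral {0..2*pi} (\<lambda>\<theta>. f (cis \<theta>) * (cnj (f (cis \<theta>)) - g (cis \<theta>))) =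
        integral {0..2*pi} (\<lambda>\<theta>. f (cis \<theta>) * cnj (f (cis \<theta>))) - integral {0..2*pi} (\<lambda>\<theta>. f (cis \<theta>) * g (cis \<theta>))"
      unfolding right_diff_distrib
      by (intro Henstock_Kurzweil_Integration.integral_diff integrable_continuous_interval continuous_intros cf cgc)
    moreover have "integral {0..2*pi} (\<lambda>\<theta>. f (cis \<theta>) * cnj (f (cis \<theta>))) = of_real (integral {0..2*pi} (\<lambda>\<theta>. (norm (f (cis \<theta>)))\<^sup>2))"
      unfolding complex_norm_square[symmetric]
      by (intro integral_unique has_integral_of_real integrable_integral integrable_continuous_interval continuous_intros cf)
    ultimately have "integral {0..2*pi} (\<lambda>\<theta>. f (cis \<theta>) * (cnj (f (cis \<theta>)) - g (cis \<theta>))) =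
        of_real (integral {0..2*pi} (\<lambda>\<theta>. (norm (f (cis \<theta>)))\<^sup>2))" by simp
    then have "norm (integral {0..2*pi} (\<lambda>\<theta>. (norm (f (cis \<theta>)))\<^sup>2)) =
        norm (integral {0..2*pi} (\<lambda>\<theta>. f (cis \<theta>) * (cnj (f (cis \<theta>)) - g (cis \<theta>))))"
      by (simp only: norm_of_real real_norm_def)
    also have "\<dots> \<le> integral {0..2*pi} (\<lambda>\<theta>. e * norm (f (cis \<theta>)))"
    proof (rule integral_norm_bound_integral)
      show "(\<lambda>\<theta>. f (cis \<theta>) * (cnj (f (cis \<theta>)) - g (cis \<theta>))) integrable_on {0..2*pi}"
        by (intro integrable_continuous_interval continuous_intros cf cgc)
      show "(\<lambda>\<theta>. e * norm (f (cis \<theta>))) integrable_on {0..2*pi}"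
        by (intro integrable_continuous_interval continuous_intros cf)
      show "norm (f (cis \<theta>) * (cnj (f (cis \<theta>)) - g (cis \<theta>))) \<le> e * norm (f (cis \<theta>))" for \<theta>
        using mult_left_mono[of "norm (cnj (f (cis \<theta>)) - g (cis \<theta>))" e "norm (f (cis \<theta>))"] g(2)[of "cis \<theta>"]
        by (simp add: norm_mult mult.commute[of e])
    qed
    also have "\<dots> = e * N" unfolding N_def by simp
    finally show ?thesis by simp
  qed
  have "integral {0..2*pi} (\<lambda>\<theta>. (norm (f (cis \<theta>)))\<^sup>2) \<le> 0 + \<epsilon>" if "\<epsilon> > 0" for \<epsilon>
  proof -
    have "\<epsilon> / (N + 1) * N \<le> \<epsilon>" using N that by (simp add: field_simps)
    then show ?thesis using le[of "\<epsilon> / (N + 1)"] N that by simp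
  qed
  then have "integral {0..2*pi} (\<lambda>\<theta>. (norm (f (cis \<theta>)))\<^sup>2) \<le> 0" by (rule field_le_epsilon)
  moreover have "integral {0..2*pi} (\<lambda>\<theta>. (norm (f (cis \<theta>)))\<^sup>2) \<ge> 0"
    by (intro integral_nonneg integrable_continuous_interval continuous_intros cf) auto
  ultimately have "integral {0..2*pi} (\<lambda>\<theta>. (norm (f (cis \<theta>)))\<^sup>2) = 0" by simp
  moreover have "continuous_on {0..2*pi} (\<lambda>\<theta>. (norm (f (cis \<theta>)))\<^sup>2)"
    by (intro continuous_intros cf)
  ultimately have "\<forall>\<theta>\<in>{0..2*pi}. (norm (f (cis \<theta>)))\<^sup>2 = 0"
    using integral_eq_0_iff[of 0 "2*pi" "\<lambda>\<theta>. (norm (f (cis \<theta>)))\<^sup>2"] pi_gt_zero by simp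
  moreover obtain \<theta> where "\<theta> \<in> {0..2*pi}" "z = cis \<theta>" using z by (rule sphere_cis)
  ultimately show ?thesis by simp
qed

text \<open>The sum of the series is continuous and has the same coefficients as \<open>f\<close>, so uniqueness applies to the
  difference.\<close>

lemma fourier_inversion:
  assumes f: "continuous_on (sphere 0 1) f"
    and s: "(\<lambda>k. norm (fourier (\<lambda>\<theta>. f (cis \<theta>)) k)) summable_on UNIV"
  shows "f (cis \<theta>) = (\<Sum>\<^sub>\<infinity>k. fourier (\<lambda>\<theta>. f (cis \<theta>)) k * cis (of_int k * \<theta>))"
proof -
  define c where "c = fourier (\<lambda>\<theta>. f (cis \<theta>))"
  define g where "g z = (\<Sum>\<^sub>\<infinity>k. c k * z powi k)" for z
  have g: "g (cis \<theta>) = (\<Sum>\<^sub>\<infinity>k. c k * cis (of_int k * \<theta>))" for \<theta>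
    unfolding g_def by (simp add: cis_power_int)
  have ul: "uniform_limit (sphere 0 1) (\<lambda>M z. \<Sum>k\<in>M. c k * z powi k) g (finite_subsets_at_top UNIV)"
    unfolding g_def using s
    by (intro Weierstrass_m_test_general[of _ _ _ "\<lambda>k. norm (c k)"]) (auto simp: c_def norm_mult norm_power_int)
  have cg: "continuous_on (sphere 0 1) g"
    by (rule uniform_limit_theorem[OF _ ul]) (auto intro!: always_eventually continuous_intros)
  have "f (cis \<theta>) - g (cis \<theta>) = 0"
  proof (rule fourier_zero_imp_zero[of "\<lambda>z. f z - g z"])
    show "fourier (\<lambda>\<theta>. f (cis \<theta>) - g (cis \<theta>)) k = 0" for k
    proof -
      have "fourier (\<lambda>\<theta>. g (cis \<theta>)) k = fourier (\<lambda>\<theta>. f (cis \<theta>)) k"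
        unfolding g using s by (subst fourier_series_coeff) (auto simp: c_def)
      then show ?thesis
        by (subst fourier_diff) (auto intro!: continuous_on_cis_comp f cg)
    qed
  qed (auto intro!: continuous_intros f cg)
  then show ?thesis by (simp add: g c_def)
qed

section \<open>Continuously differentiable functions and Bessel's inequality\<close>

definition has_C1_derivative :: "(real \<Rightarrow> complex) \<Rightarrow> (real \<Rightarrow> complex) \<Rightarrow> bool" where
  "has_C1_derivative h h' \<longleftrightarrow> continuous_on UNIV h' \<and> (\<forall>\<theta>. (h has_vector_derivative h' \<theta>) (at \<theta>))"

lemma C1_continuous: "has_C1_derivative h h' \<Longrightarrow> continuous_on UNIV h"
  unfolding has_C1_derivative_def
  by (metis continuous_at_imp_continuous_on has_vector_derivative_continuous)

lemma C1_add:
  "has_C1_derivative f f' \<Longrightarrow> has_C1_derivative g g' \<Longrightarrow> has_C1_derivative (\<lambda>\<theta>. f \<theta> + g \<theta>) (\<lambda>\<theta>. f' \<theta> + g' \<theta>)"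
  unfolding has_C1_derivative_def by (auto intro!: continuous_intros derivative_intros)

lemma C1_mult:
  assumes "has_C1_derivative f f'" "has_C1_derivative g g'"
  shows "has_C1_derivative (\<lambda>\<theta>. f \<theta> * g \<theta>) (\<lambda>\<theta>. f \<theta> * g' \<theta> + f' \<theta> * g \<theta>)"
  using assms C1_continuous[OF assms(1)] C1_continuous[OF assms(2)]
  unfolding has_C1_derivative_def by (auto intro!: continuous_intros has_vector_derivative_mult)

lemma C1_const: "has_C1_derivative (\<lambda>_. c) (\<lambda>_. 0)"
  unfolding has_C1_derivative_def by auto

lemma C1_inverse:
  assumes "has_C1_derivative f f'" "\<And>\<theta>. f \<theta> \<noteq> 0"
  shows "has_C1_derivative (\<lambda>\<theta>. inverse (f \<theta>)) (\<lambda>\<theta>. - (f' \<theta> * inverse (f \<theta>) ^ 2))"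
proof -
  have "((\<lambda>\<theta>. inverse (f \<theta>)) has_vector_derivative - (f' \<theta> * inverse (f \<theta>) ^ 2)) (at \<theta>)" for \<theta>
  proof -
    have "(f has_vector_derivative f' \<theta>) (at \<theta>)" using assms by (auto simp: has_C1_derivative_def)
    moreover have "(inverse has_field_derivative - (inverse (f \<theta>) ^ 2)) (at (f \<theta>))"
      using DERIV_inverse[OF assms(2)[of \<theta>]] by (simp add: numeral_2_eq_2)
    ultimately have "(inverse \<circ> f has_vector_derivative f' \<theta> * - (inverse (f \<theta>) ^ 2)) (at \<theta>)"
      by (rule field_vector_diff_chain_at)
    then show ?thesis by (simp add: o_def)
  qed
  then show ?thesis
    using assms C1_continuous[OF assms(1)] unfolding has_C1_derivative_def
    by (auto intro!: continuous_intros)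
qed

lemma C1_sum:
  assumes "finite I" "\<And>i. i \<in> I \<Longrightarrow> \<exists>f'. has_C1_derivative (f i) f'"
  shows "\<exists>f'. has_C1_derivative (\<lambda>\<theta>. \<Sum>i\<in>I. f i \<theta>) f'"
  using assms
proof (induction I rule: finite_induct)
  case empty
  then show ?case using C1_const[of 0] by auto
next
  case (insert i I)
  then show ?case using C1_add by fastforce
qed

lemma C1_prod:
  assumes "finite I" "\<And>i. i \<in> I \<Longrightarrow> \<exists>f'. has_C1_derivative (f i) f'"
  shows "\<exists>f'. has_C1_derivative (\<lambda>\<theta>. \<Prod>i\<in>I. f i \<theta>) f'"
  using assms
proof (induction I rule: finite_induct)
  case empty
  then show ?case using C1_const[of 1] by auto
next
  case (insert i I)
  then show ?case using C1_mult by fastforce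
qed

lemma C1_det:
  fixes A :: "real \<Rightarrow> complex^'n^'n"
  assumes "\<And>i j. \<exists>f'. has_C1_derivative (\<lambda>\<theta>. A \<theta> $ i $ j) f'"
  shows "\<exists>f'. has_C1_derivative (\<lambda>\<theta>. det (A \<theta>)) f'"
  unfolding det_def
proof (rule C1_sum)
  fix \<pi> assume "\<pi> \<in> {\<pi>. \<pi> permutes (UNIV :: 'n set)}"
  obtain f' where f': "has_C1_derivative (\<lambda>\<theta>. \<Prod>i\<in>UNIV. A \<theta> $ i $ \<pi> i) f'"
    using C1_prod[of UNIV "\<lambda>i \<theta>. A \<theta> $ i $ \<pi> i"] assms by auto
  from C1_mult[OF C1_const f'] show "\<exists>f'. has_C1_derivative (\<lambda>\<theta>. of_int (sign \<pi>) * (\<Prod>i\<in>UNIV. A \<theta> $ i $ \<pi> i)) f'"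
    by blast
qed (simp add: finite_permutations)

lemma matrix_inv_det:
  fixes A :: "complex^'n^'n"
  assumes "det A \<noteq> 0"
  shows "A ** matrix_inv A = mat 1" "matrix_inv A ** A = mat 1"
proof -
  have "\<exists>B. A ** B = mat 1 \<and> B ** A = mat 1"
    using assms by (simp add: invertible_det_nz[symmetric] invertible_def)
  then have "A ** matrix_inv A = mat 1 \<and> matrix_inv A ** A = mat 1"
    unfolding matrix_inv_def by (rule someI_ex)
  then show "A ** matrix_inv A = mat 1" "matrix_inv A ** A = mat 1" by auto
qed

text \<open>By Cramer's rule each entry of the inverse is a quotient of two determinants, and determinants are
  polynomials in the entries.\<close>

lemma C1_matrix_inv:
  fixes A :: "real \<Rightarrow> complex^'n^'n"
  assumes A: "\<And>i j. \<exists>f'. has_C1_derivative (\<lambda>\<theta>. A \<theta> $ i $ j) f'" and nz: "\<And>\<theta>. det (A \<theta>) \<noteq> 0"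
  shows "\<exists>f'. has_C1_derivative (\<lambda>\<theta>. matrix_inv (A \<theta>) $ i $ j) f'"
proof -
  let ?C = "\<lambda>\<theta>. (\<chi> i' j'. if j' = i then axis j 1 $ i' else A \<theta> $ i' $ j') :: complex^'n^'n"
  have "matrix_inv (A \<theta>) $ i $ j = det (?C \<theta>) * inverse (det (A \<theta>))" for \<theta>
  proof -
    have "A \<theta> ** matrix_inv (A \<theta>) = mat 1"
      by (rule matrix_inv_det(1)[OF nz])
    then have "A \<theta> *v (matrix_inv (A \<theta>) *v axis j 1) = axis j 1"
      by (simp add: matrix_vector_mul_assoc)
    then have "matrix_inv (A \<theta>) *v axis j 1 = (\<chi> k. det (\<chi> i' j'. if j' = k then axis j 1 $ i' else A \<theta> $ i' $ j') / det (A \<theta>))"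
      using cramer[OF nz[of \<theta>]] by blast
    from arg_cong[OF this, of "\<lambda>v. v $ i"]
    have quot: "(matrix_inv (A \<theta>) *v axis j 1) $ i = det (?C \<theta>) / det (A \<theta>)" by simp
    then show ?thesis
    proof -
      have "(matrix_inv (A \<theta>) *v axis j 1) $ i = (\<Sum>k\<in>UNIV. if k = j then matrix_inv (A \<theta>) $ i $ k else 0)"
        unfolding matrix_vector_mult_def vec_lambda_beta by (intro sum.cong) (auto simp: axis_def)
      then show ?thesis using quot by (simp add: field_class.field_divide_inverse)
    qed
  qed
  moreover obtain f' where f': "has_C1_derivative (\<lambda>\<theta>. det (?C \<theta>)) f'"
  proof -
    have "\<exists>f'. has_C1_derivative (\<lambda>\<theta>. ?C \<theta> $ i' $ j') f'" for i' j'
      using A C1_const by (cases "j' = i") auto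
    from C1_det[of ?C, OF this] that show ?thesis by blast
  qed
  moreover obtain g' where g': "has_C1_derivative (\<lambda>\<theta>. det (A \<theta>)) g'"
    using C1_det[OF A] by blast
  ultimately show ?thesis using C1_mult[OF f' C1_inverse[OF g' nz]] by auto
qed

text \<open>Integration by parts; periodicity removes the boundary terms.\<close>

lemma fourier_derivative:
  assumes h: "has_C1_derivative h h'" and per: "h (2 * pi) = h 0"
  shows "fourier h' k = \<i> * of_int k * fourier h k"
proof -
  let ?e = "\<lambda>\<theta>. cis (- of_int k * \<theta>)"
  note ch = C1_continuous[OF h]
  have ch': "continuous_on UNIV h'" using h by (simp add: has_C1_derivative_def)
  have e: "?e (2 * pi) = 1" 
    using cis_multiple_2pi[of "of_int (- k)"] by (simp add: mult.commute mult.left_commute)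
  have "((\<lambda>\<theta>. h \<theta> * (\<i> * (- of_int k) * ?e \<theta>) + h' \<theta> * ?e \<theta>) has_integral h (2*pi) * ?e (2*pi) - h 0 * ?e 0) {0..2*pi}"
  proof (rule fundamental_theorem_of_calculus)
    fix \<theta>
    have "(h has_vector_derivative h' \<theta>) (at \<theta> within {0..2*pi})"
      using h by (auto simp: has_C1_derivative_def intro: has_vector_derivative_at_within)
    from has_vector_derivative_mult[OF this cis_has_vector_derivative[of "- of_int k"]]
    show "((\<lambda>\<theta>. h \<theta> * ?e \<theta>) has_vector_derivative h \<theta> * (\<i> * (- of_int k) * ?e \<theta>) + h' \<theta> * ?e \<theta>) (at \<theta> within {0..2*pi})"
      by simp
  qed simp
  then have "integral {0..2*pi} (\<lambda>\<theta>. (- (\<i> * of_int k)) * (h \<theta> * ?e \<theta>) + h' \<theta> * ?e \<theta>) = 0"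
    using per e by (simp add: integral_unique mult.left_commute mult.assoc)
  moreover have "integral {0..2*pi} (\<lambda>\<theta>. (- (\<i> * of_int k)) * (h \<theta> * ?e \<theta>) + h' \<theta> * ?e \<theta>) =
     (- (\<i> * of_int k)) * integral {0..2*pi} (\<lambda>\<theta>. h \<theta> * ?e \<theta>) + integral {0..2*pi} (\<lambda>\<theta>. h' \<theta> * ?e \<theta>)"
    by (subst Henstock_Kurzweil_Integration.integral_add)
      (intro integrable_continuous_interval continuous_intros continuous_on_subset[OF ch] continuous_on_subset[OF ch'] subset_UNIV,
       intro integrable_continuous_interval continuous_intros continuous_on_subset[OF ch] continuous_on_subset[OF ch'] subset_UNIV,
       simp add: mult.assoc)
  ultimately show ?thesis by (simp add: fourier_def)
qed

text \<open>With \<open>S\<close> the part of the Fourier series over \<open>F\<close>, the difference \<open>h - S\<close> is orthogonal to \<open>S\<close>, so the mean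
  of \<open>|h|\<^sup>2\<close> is the sum of the means of \<open>|h - S|\<^sup>2\<close> and \<open>|S|\<^sup>2\<close>.\<close>

lemma bessel_inequality:
  assumes h: "continuous_on UNIV h" and F: "finite F"
  shows "(\<Sum>k\<in>F. (norm (fourier h k))\<^sup>2) \<le> integral {0..2*pi} (\<lambda>\<theta>. (norm (h \<theta>))\<^sup>2) / (2 * pi)"
proof -
  define S where "S \<theta> = (\<Sum>k\<in>F. fourier h k * cis (of_int k * \<theta>))" for \<theta>
  have cS: "continuous_on UNIV S" unfolding S_def by (intro continuous_intros)
  have fS: "fourier S k = (if k \<in> F then fourier h k else 0)" for k
    unfolding S_def using F by (subst fourier_sum) (auto intro!: continuous_intros simp: fourier_cmult fourier_cis if_distrib cong: if_cong)
  have mS: "fourier (\<lambda>\<theta>. g \<theta> * cnj (S \<theta>)) 0 = (\<Sum>k\<in>F. cnj (fourier h k) * fourier g k)" if "continuous_on UNIV g" for g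
  proof -
    have "(\<lambda>\<theta>. g \<theta> * cnj (S \<theta>)) = (\<lambda>\<theta>. \<Sum>k\<in>F. cnj (fourier h k) * (cis (of_int (- k) * \<theta>) * g \<theta>))"
      by (simp add: fun_eq_iff S_def sum_distrib_left cis_cnj mult_ac)
    then show ?thesis
      using F that by (simp only:) (subst fourier_sum, auto intro!: continuous_intros simp only: fourier_cmult fourier_shift, simp)
  qed
  have "fourier (\<lambda>\<theta>. (h \<theta> - S \<theta>) * cnj (S \<theta>)) 0 = 0"
    using fS F by (subst mS) (auto intro!: continuous_intros h cS simp: fourier_diff h cS)
  moreover have "fourier (\<lambda>\<theta>. (norm (h \<theta>))\<^sup>2) 0 = fourier (\<lambda>\<theta>. ((norm (h \<theta> - S \<theta>))\<^sup>2)) 0 + fourier (\<lambda>\<theta>. (h \<theta> - S \<theta>) * cnj (S \<theta>)) 0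
     + cnj (fourier (\<lambda>\<theta>. (h \<theta> - S \<theta>) * cnj (S \<theta>)) 0) + fourier (\<lambda>\<theta>. S \<theta> * cnj (S \<theta>)) 0"
  proof -
    have cnj: "cnj (fourier f 0) = fourier (\<lambda>\<theta>. cnj (f \<theta>)) 0" for f
      by (simp add: fourier_def integral_cnj)
    show ?thesis
      unfolding cnj
      apply (subst fourier_add[symmetric])
      apply (auto intro!: continuous_intros h cS)[2]
      apply (subst fourier_add[symmetric])
      apply (auto intro!: continuous_intros h cS)[2]
      apply (subst fourier_add[symmetric])
      apply (auto intro!: continuous_intros h cS)[2]
      apply (rule arg_cong[of _ _ "\<lambda>f. fourier f 0"])
      apply (simp add: fun_eq_iff complex_norm_square[unfolded of_real_power] algebra_simps)
      done
  qed
  moreover have "fourier (\<lambda>\<theta>. S \<theta> * cnj (S \<theta>)) 0 = of_real (\<Sum>k\<in>F. (norm (fourier h k))\<^sup>2)"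
    by (subst mS[OF cS]) (auto simp: fS complex_norm_square[unfolded of_real_power] mult.commute)
  moreover have real: "fourier (\<lambda>\<theta>. of_real (g \<theta>)) 0 = of_real (integral {0..2*pi} g / (2 * pi))" if "continuous_on UNIV g" for g
  proof -
    have "((\<lambda>\<theta>. of_real (g \<theta>)) has_integral (of_real (integral {0..2*pi} g) :: complex)) {0..2*pi}"
      by (intro has_integral_of_real integrable_integral integrable_continuous_interval continuous_on_subset[OF that]) auto
    then show ?thesis by (simp add: fourier_def integral_unique)
  qed
  ultimately have "complex_of_real (integral {0..2*pi} (\<lambda>\<theta>. (norm (h \<theta>))\<^sup>2) / (2 * pi)) =
     of_real (integral {0..2*pi} (\<lambda>\<theta>. (norm (h \<theta> - S \<theta>))\<^sup>2) / (2 * pi) + (\<Sum>k\<in>F. (norm (fourier h k))\<^sup>2))"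
    using real[of "\<lambda>\<theta>. (norm (h \<theta>))\<^sup>2"] real[of "\<lambda>\<theta>. (norm (h \<theta> - S \<theta>))\<^sup>2"]
    by (simp add: continuous_intros h cS)
  then have "integral {0..2*pi} (\<lambda>\<theta>. (norm (h \<theta>))\<^sup>2) / (2 * pi) =
     integral {0..2*pi} (\<lambda>\<theta>. (norm (h \<theta> - S \<theta>))\<^sup>2) / (2 * pi) + (\<Sum>k\<in>F. (norm (fourier h k))\<^sup>2)"
    using of_real_eq_iff by blast
  moreover have "integral {0..2*pi} (\<lambda>\<theta>. (norm (h \<theta> - S \<theta>))\<^sup>2) \<ge> 0"
    by (intro integral_nonneg integrable_continuous_interval continuous_intros continuous_on_subset[OF h] continuous_on_subset[OF cS]) auto
  ultimately show ?thesis by simp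
qed

lemma summable_inverse_squares_int: "(\<lambda>k::int. 1 / (of_int k)\<^sup>2 :: real) summable_on UNIV"
proof -
  let ?f = "\<lambda>k::int. 1 / (of_int k)\<^sup>2 :: real"
  have s: "(\<lambda>n::nat. 1 / (of_nat n)\<^sup>2 :: real) summable_on UNIV"
    by (intro summable_nonneg_imp_summable_on) (use inverse_power_summable[of 2, where 'a=real] in \<open>auto simp: field_simps\<close>)
  have "?f summable_on range int" "?f summable_on range (\<lambda>n. - int n)"
    by (subst summable_on_reindex; use s in \<open>auto simp: inj_on_def o_def\<close>)+
  then have "?f summable_on (range int \<union> range (\<lambda>n. - int n))" by (rule summable_on_union)
  moreover have "range int \<union> range (\<lambda>n. - int n) = UNIV"
    by (auto intro: int_cases2)
  ultimately show ?thesis by simp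
qed

text \<open>For \<open>k \<noteq> 0\<close> the coefficient is \<open>|h'\<^sub>k| / |k|\<close> in absolute value, hence at most \<open>|h'\<^sub>k|\<^sup>2 + 1 / k\<^sup>2\<close>, and
  Bessel's inequality for \<open>h'\<close> makes the right-hand side summable.\<close>

lemma C1_fourier_summable:
  assumes h: "has_C1_derivative h h'" and per: "h (2 * pi) = h 0"
  shows "(\<lambda>k. norm (fourier h k)) summable_on UNIV"
proof -
  have ch': "continuous_on UNIV h'" using h by (simp add: has_C1_derivative_def)
  have 1: "(\<lambda>k. (norm (fourier h' k))\<^sup>2) summable_on UNIV"
    using bessel_inequality[OF ch'] by (intro nonneg_bdd_above_summable_on) (auto intro!: bdd_aboveI2)
  have "(\<lambda>k. (norm (fourier h' k))\<^sup>2 + 1 / (of_int k)\<^sup>2) summable_on UNIV"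
    by (rule summable_on_add[OF 1 summable_inverse_squares_int])
  then have "(\<lambda>k. (norm (fourier h' k))\<^sup>2 + 1 / (of_int k)\<^sup>2) summable_on UNIV - {0}"
    by (rule summable_on_subset_banach) auto
  then have "(\<lambda>k. norm (fourier h k)) summable_on UNIV - {0}"
  proof (rule summable_on_comparison_test)
    fix k :: int assume "k \<in> UNIV - {0}"
    then have k: "real_of_int \<bar>k\<bar> > 0" by simp
    have "norm (fourier h' k) = of_int \<bar>k\<bar> * norm (fourier h k)"
      by (simp add: fourier_derivative[OF h per] norm_mult)
    then have "norm (fourier h k) = norm (fourier h' k) * (1 / of_int \<bar>k\<bar>)" using k by (simp add: field_simps)
    also have "\<dots> \<le> (norm (fourier h' k))\<^sup>2 + (1 / of_int \<bar>k\<bar>)\<^sup>2"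
    proof -
      have "x * y \<le> x\<^sup>2 + y\<^sup>2" if "x \<ge> 0" "y \<ge> 0" for x y :: real
        using sum_squares_bound[of x y] mult_nonneg_nonneg[OF that] by linarith
      from this[of "norm (fourier h' k)" "1 / of_int \<bar>k\<bar>"] show ?thesis using k by simp
    qed
    finally show "norm (fourier h k) \<le> (norm (fourier h' k))\<^sup>2 + 1 / (of_int k)\<^sup>2"
      by (simp add: power_divide)
  qed auto
  then have "(\<lambda>k. norm (fourier h k)) summable_on insert 0 (UNIV - {0})"
    by (subst summable_on_insert_iff)
  then show ?thesis by simp
qed

text \<open>The series of the derivatives is integrated term by term; the fundamental theorem of calculus then
  differentiates the result.\<close>

lemma fourier_series_C1:
  fixes c :: "int \<Rightarrow> complex"
  assumes c: "(\<lambda>m. norm (c m)) summable_on UNIV" and c': "(\<lambda>m. norm (of_int m * c m)) summable_on UNIV"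
  shows "has_C1_derivative (\<lambda>\<theta>. \<Sum>\<^sub>\<infinity>m. c m * cis (of_int m * \<theta>)) (\<lambda>\<theta>. \<Sum>\<^sub>\<infinity>m. \<i> * of_int m * c m * cis (of_int m * \<theta>))"
proof -
  let ?h = "\<lambda>\<theta>. \<Sum>\<^sub>\<infinity>m. c m * cis (of_int m * \<theta>)" and ?g = "\<lambda>\<theta>. \<Sum>\<^sub>\<infinity>m. \<i> * of_int m * c m * cis (of_int m * \<theta>)"
  have g: "(\<lambda>m. norm (\<i> * of_int m * c m)) summable_on UNIV" using c' by (simp add: norm_mult)
  have cg: "continuous_on UNIV ?g" by (rule continuous_on_fourier_series[OF g])
  have int: "integral {a..b} ?g = ?h b - ?h a" if "a \<le> b" for a b
  proof -
    have "((\<lambda>m. \<i> * of_int m * c m * integral {a..b} (\<lambda>\<theta>. cis (of_int m * \<theta>) * 1)) has_sum integral {a..b} (\<lambda>\<theta>. ?g \<theta> * 1)) UNIV"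
      by (rule fourier_series_integral[OF g]) simp
    moreover have "\<i> * of_int m * c m * integral {a..b} (\<lambda>\<theta>. cis (of_int m * \<theta>) * 1) = c m * cis (of_int m * b) - c m * cis (of_int m * a)" for m
    proof -
      have "((\<lambda>\<theta>. \<i> * of_int m * cis (of_int m * \<theta>)) has_integral (cis (of_int m * b) - cis (of_int m * a))) {a..b}"
        using that cis_has_vector_derivative[of "of_int m"] by (intro fundamental_theorem_of_calculus) auto
      then have "\<i> * of_int m * integral {a..b} (\<lambda>\<theta>. cis (of_int m * \<theta>)) = cis (of_int m * b) - cis (of_int m * a)"
        by (simp add: integral_unique flip: integral_mult_right)
      then show ?thesis by (simp add: right_diff_distrib[symmetric] mult_ac)
    qed
    moreover have s: "(\<lambda>m. c m * cis (of_int m * x)) summable_on UNIV" for x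
      by (rule abs_summable_summable) (use c in \<open>simp add: norm_mult\<close>)
    have "((\<lambda>m. c m * cis (of_int m * b) + - (c m * cis (of_int m * a))) has_sum ?h b + - ?h a) UNIV"
      by (intro has_sum_add has_sum_uminusI has_sum_infsum s)
    ultimately show ?thesis by (auto intro: has_sum_unique)
  qed
  (* The base point of the integral has to lie strictly to the left of the point of differentiation. *)
  have "(?h has_vector_derivative ?g \<theta>) (at \<theta>)" for \<theta>
  proof -
    have "((\<lambda>u. integral {\<theta> - 1..u} ?g) has_vector_derivative ?g \<theta>) (at \<theta> within {\<theta> - 1..\<theta> + 1})"
      by (rule integral_has_vector_derivative) (auto intro: continuous_on_subset[OF cg])
    then have "((\<lambda>u. ?h (\<theta> - 1) + integral {\<theta> - 1..u} ?g) has_vector_derivative ?g \<theta>) (at \<theta> within {\<theta> - 1..\<theta> + 1})"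
      by (auto intro!: derivative_eq_intros)
    then have "(?h has_vector_derivative ?g \<theta>) (at \<theta> within {\<theta> - 1..\<theta> + 1})"
      by (rule has_vector_derivative_transform[rotated 2]) (auto simp: int)
    moreover have "at \<theta> within {\<theta> - 1..\<theta> + 1} = at \<theta>"
      by (rule at_within_interior) auto
    ultimately show ?thesis by simp
  qed
  then show ?thesis unfolding has_C1_derivative_def using cg by blast
qed

section \<open>Winding numbers of determinants\<close>

text \<open>In the derivative of a term of the Leibniz formula one factor is differentiated. A permutation other than
  the identity moves at least two points, so another off-diagonal entry, which vanishes at \<open>\<theta>\<^sub>0\<close>, remains as a
  factor. The identity permutation contributes the trace.\<close>

lemma det_derivative_at_identity:
  fixes M :: "real \<Rightarrow> complex^'n^'n"
  assumes d: "\<And>i j. ((\<lambda>\<theta>. M \<theta> $ i $ j) has_vector_derivative M' i j) (at \<theta>\<^sub>0)"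
    and one: "M \<theta>\<^sub>0 = mat 1"
  shows "((\<lambda>\<theta>. det (M \<theta>)) has_vector_derivative (\<Sum>i\<in>UNIV. M' i i)) (at \<theta>\<^sub>0)"
proof -
  have prod: "((\<lambda>\<theta>. \<Prod>i\<in>UNIV. M \<theta> $ i $ \<pi> i) has_vector_derivative
      (\<Sum>i\<in>UNIV. M' i (\<pi> i) * (\<Prod>k\<in>UNIV - {i}. M \<theta>\<^sub>0 $ k $ \<pi> k))) (at \<theta>\<^sub>0)" for \<pi> :: "'n \<Rightarrow> 'n"
  proof -
    have "((\<lambda>\<theta>. \<Prod>i\<in>UNIV. M \<theta> $ i $ \<pi> i) has_derivative
      (\<lambda>y. \<Sum>i\<in>UNIV. y *\<^sub>R M' i (\<pi> i) * (\<Prod>k\<in>UNIV - {i}. M \<theta>\<^sub>0 $ k $ \<pi> k))) (at \<theta>\<^sub>0)"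
      by (rule has_derivative_prod) (use d in \<open>simp add: has_vector_derivative_def\<close>)
    then show ?thesis by (simp add: has_vector_derivative_def scaleR_sum_right)
  qed
  have summand: "of_int (sign \<pi>) * (\<Sum>i\<in>UNIV. M' i (\<pi> i) * (\<Prod>k\<in>UNIV - {i}. M \<theta>\<^sub>0 $ k $ \<pi> k)) =
      (if \<pi> = id then \<Sum>i\<in>UNIV. M' i i else 0)" if \<pi>: "\<pi> permutes (UNIV :: 'n set)" for \<pi>
  proof (cases "\<pi> = id")
    case False
    have "(\<Prod>k\<in>UNIV - {i}. M \<theta>\<^sub>0 $ k $ \<pi> k) = 0" for i
    proof -
      obtain k where k: "\<pi> k \<noteq> k" using False by (auto simp: fun_eq_iff)
      have "\<exists>l. l \<noteq> i \<and> \<pi> l \<noteq> l"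
      proof (cases "k = i")
        case True
        have "\<pi> (\<pi> i) \<noteq> \<pi> i" using k True permutes_inj[OF \<pi>] by (auto dest: injD)
        then show ?thesis using k True by blast
      qed (use k in blast)
      then obtain l where "l \<noteq> i" "\<pi> l \<noteq> l" by blast
      then show ?thesis by (intro prod_zero) (auto intro!: bexI[of _ l] simp: one mat_def)
    qed
    then show ?thesis by (simp only: False mult_zero_right sum.neutral_const if_False)
  qed (simp add: one mat_def)
  have "((\<lambda>\<theta>. det (M \<theta>)) has_vector_derivative
      (\<Sum>\<pi> | \<pi> permutes (UNIV :: 'n set). of_int (sign \<pi>) * (\<Sum>i\<in>UNIV. M' i (\<pi> i) * (\<Prod>k\<in>UNIV - {i}. M \<theta>\<^sub>0 $ k $ \<pi> k)))) (at \<theta>\<^sub>0)"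
    unfolding det_def by (intro has_vector_derivative_sum has_vector_derivative_mult_right prod)
  also have "(\<Sum>\<pi> | \<pi> permutes (UNIV :: 'n set). of_int (sign \<pi>) * (\<Sum>i\<in>UNIV. M' i (\<pi> i) * (\<Prod>k\<in>UNIV - {i}. M \<theta>\<^sub>0 $ k $ \<pi> k))) =
      (\<Sum>\<pi> | \<pi> permutes (UNIV :: 'n set). if \<pi> = id then \<Sum>i\<in>UNIV. M' i i else 0)"
    by (intro sum.cong) (auto simp: summand)
  also have "\<dots> = (\<Sum>i\<in>UNIV. M' i i)"
    by (simp add: finite_permutations permutes_id)
  finally show ?thesis .
qed

text \<open>Multiplication by the inverse of \<open>A \<theta>\<^sub>0\<close> reduces the claim to a matrix function that passes through the
  identity.\<close>

lemma jacobi_formula: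
  fixes A :: "real \<Rightarrow> complex^'n^'n"
  assumes d: "\<And>i j. ((\<lambda>\<theta>. A \<theta> $ i $ j) has_vector_derivative A' i j) (at \<theta>\<^sub>0)"
    and nz: "det (A \<theta>\<^sub>0) \<noteq> 0"
  shows "((\<lambda>\<theta>. det (A \<theta>)) has_vector_derivative
      det (A \<theta>\<^sub>0) * (\<Sum>i\<in>UNIV. \<Sum>j\<in>UNIV. A' i j * matrix_inv (A \<theta>\<^sub>0) $ j $ i)) (at \<theta>\<^sub>0)"
proof -
  let ?B = "matrix_inv (A \<theta>\<^sub>0)"
  have "((\<lambda>\<theta>. det (?B ** A \<theta>)) has_vector_derivative (\<Sum>i\<in>UNIV. \<Sum>j\<in>UNIV. ?B $ i $ j * A' j i)) (at \<theta>\<^sub>0)"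
  proof (rule det_derivative_at_identity[where M'="\<lambda>i j. \<Sum>k\<in>UNIV. ?B $ i $ k * A' k j"])
    show "((\<lambda>\<theta>. (?B ** A \<theta>) $ i $ j) has_vector_derivative (\<Sum>k\<in>UNIV. ?B $ i $ k * A' k j)) (at \<theta>\<^sub>0)" for i j
      unfolding matrix_matrix_mult_def vec_lambda_beta
      by (intro has_vector_derivative_sum has_vector_derivative_mult_right d)
    show "?B ** A \<theta>\<^sub>0 = mat 1" by (rule matrix_inv_det(2)[OF nz])
  qed
  then have "((\<lambda>\<theta>. det (A \<theta>\<^sub>0) * det (?B ** A \<theta>)) has_vector_derivative
      det (A \<theta>\<^sub>0) * (\<Sum>i\<in>UNIV. \<Sum>j\<in>UNIV. ?B $ i $ j * A' j i)) (at \<theta>\<^sub>0)"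
    by (rule has_vector_derivative_mult_right)
  moreover have "det (A \<theta>\<^sub>0) * det (?B ** A \<theta>) = det (A \<theta>)" for \<theta>
  proof -
    have "det (A \<theta>\<^sub>0) * det ?B = 1"
      using matrix_inv_det(1)[OF nz] by (metis det_I det_mul)
    then show ?thesis by (simp add: det_mul mult.assoc[symmetric])
  qed
  moreover have "(\<Sum>i\<in>UNIV. \<Sum>j\<in>UNIV. ?B $ i $ j * A' j i) = (\<Sum>i\<in>UNIV. \<Sum>j\<in>UNIV. A' i j * ?B $ j $ i)"
    by (subst sum.swap) (simp add: mult.commute)
  ultimately show ?thesis by simp
qed

text \<open>The integrand of the contour integral for the winding number is the logarithmic derivative \<open>l\<close>.\<close>

lemma winding_number_log_derivative:
  assumes D: "has_C1_derivative (\<lambda>\<theta>. f (cis \<theta>)) (\<lambda>\<theta>. f (cis \<theta>) * l \<theta>)"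
    and l: "continuous_on UNIV l"
    and nz: "\<And>\<theta>. f (cis \<theta>) \<noteq> 0"
  shows "winding_number (f \<circ> circlepath 0 1) 0 = 1 / \<i> * fourier l 0"
proof -
  let ?\<gamma> = "f \<circ> circlepath 0 1"
  have \<gamma>: "?\<gamma> = (\<lambda>t. f (cis (2 * pi * t)))"
    by (simp add: fun_eq_iff circlepath cis_conv_exp mult_ac)
  have \<gamma>_apply: "f (circlepath 0 1 t) = f (cis (2 * pi * t))" for t
    using fun_cong[OF \<gamma>, of t] by simp
  have d: "(?\<gamma> has_vector_derivative 2 * pi * (f (cis (2 * pi * t)) * l (2 * pi * t))) (at t within S)" for t S
  proof -
    have "((\<lambda>t. 2 * pi * t) has_vector_derivative 2 * pi) (at t within S)"
      by (auto intro!: derivative_eq_intros)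
    moreover have "((\<lambda>\<theta>. f (cis \<theta>)) has_vector_derivative f (cis (2 * pi * t)) * l (2 * pi * t)) (at (2 * pi * t) within (\<lambda>t. 2 * pi * t) ` S)"
      using D by (auto simp: has_C1_derivative_def intro: has_vector_derivative_at_within)
    ultimately have "((\<lambda>\<theta>. f (cis \<theta>)) \<circ> (\<lambda>t. 2 * pi * t) has_vector_derivative (2 * pi) *\<^sub>R (f (cis (2 * pi * t)) * l (2 * pi * t))) (at t within S)"
      by (rule vector_diff_chain_within)
    then show ?thesis unfolding \<gamma> by (simp add: o_def scaleR_conv_of_real)
  qed
  have cont: "continuous_on UNIV (\<lambda>t. 2 * pi * (f (cis (2 * pi * t)) * l (2 * pi * t)))"
    by (intro continuous_intros continuous_on_compose2[OF C1_continuous[OF D]] continuous_on_compose2[OF l]) auto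
  have vp: "valid_path ?\<gamma>"
    unfolding valid_path_def
  proof (rule C1_differentiable_imp_piecewise)
    show "?\<gamma> C1_differentiable_on {0..1}"
      unfolding C1_differentiable_on_def
      by (rule exI[of _ "\<lambda>t. 2 * pi * (f (cis (2 * pi * t)) * l (2 * pi * t))"])
        (intro conjI ballI d continuous_on_subset[OF cont] subset_UNIV)
  qed
  have "0 \<notin> path_image ?\<gamma>" using nz by (auto simp: path_image_def \<gamma>_apply)
  then have "winding_number ?\<gamma> 0 = 1 / (2 * pi * \<i>) * contour_integral ?\<gamma> (\<lambda>w. 1 / (w - 0))"
    by (rule winding_number_valid_path[OF vp])
  also have "contour_integral ?\<gamma> (\<lambda>w. 1 / (w - 0)) = integral {0..1} (\<lambda>t. 1 / (?\<gamma> t - 0) * vector_derivative ?\<gamma> (at t))"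
    by (rule contour_integral_integral)
  also have "\<dots> = integral {0..1} (\<lambda>t. 2 * pi * l (2 * pi * t))"
  proof (rule Henstock_Kurzweil_Integration.integral_cong)
    show "1 / (?\<gamma> t - 0) * vector_derivative ?\<gamma> (at t) = 2 * pi * l (2 * pi * t)" for t
      using nz[of "2 * pi * t"] vector_derivative_at[OF d[of t UNIV]] by (simp add: \<gamma>_apply)
  qed
  also have "\<dots> = integral {0..2 * pi} l"
  proof -
    have "((\<lambda>t. (2 * pi) *\<^sub>R l (2 * pi * t)) has_integral integral {2 * pi * 0..2 * pi * 1} l) {0..1}"
    proof (rule has_integral_substitution[where c="2 * pi * 0" and d="2 * pi * 1"])
      show "continuous_on {2 * pi * 0..2 * pi * 1} l" by (rule continuous_on_subset[OF l]) simp
    qed (auto intro!: derivative_eq_intros)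
    then have "((\<lambda>t. 2 * pi * l (2 * pi * t)) has_integral integral {0..2 * pi} l) {0..1}"
      by (simp add: scaleR_conv_of_real)
    then show ?thesis by (rule integral_unique)
  qed
  finally have "winding_number ?\<gamma> 0 = 1 / (2 * pi * \<i>) * integral {0..2 * pi} l" .
  moreover have "1 / (2 * pi * \<i>) * x = 1 / \<i> * (1 / (2 * pi) * x)" for x :: complex
    by (simp add: field_simps)
  ultimately show ?thesis by (simp only: fourier_def) simp
qed

lemma fourier_coeff_entry:
  fixes a :: "complex \<Rightarrow> complex^'n^'n"
  assumes "continuous_on UNIV (\<lambda>\<theta>. a (cis \<theta>) $ i $ j)"
  shows "fourier_coeff a k $ i $ j = fourier (\<lambda>\<theta>. a (cis \<theta>) $ i $ j) k"
proof -
  have "(LINT \<theta>:{0..2*pi}|lebesgue. a (cis \<theta>) $ i $ j * cis (- (of_int k * \<theta>))) =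
     integral {0..2*pi} (\<lambda>\<theta>. a (cis \<theta>) $ i $ j * cis (- (of_int k * \<theta>)))"
  proof (rule set_lebesgue_integral_eq_integral)
    have "continuous_on {0..2*pi} (\<lambda>\<theta>. a (cis \<theta>) $ i $ j * cis (- (of_int k * \<theta>)))"
      by (intro continuous_intros continuous_on_subset[OF assms]) auto
    then have "set_integrable lborel {0..2*pi} (\<lambda>\<theta>. a (cis \<theta>) $ i $ j * cis (- (of_int k * \<theta>)))"
      unfolding set_integrable_def by (intro borel_integrable_compact) auto
    then show "set_integrable lebesgue {0..2*pi} (\<lambda>\<theta>. a (cis \<theta>) $ i $ j * cis (- (of_int k * \<theta>)))"
      unfolding set_integrable_def by (subst integrable_completion) (auto dest: borel_measurable_integrable)
  qed
  moreover have "exp (- \<i> * of_int k * of_real \<theta>) = cis (- (of_int k * \<theta>))" for \<theta>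
    by (simp add: cis_conv_exp mult.assoc)
  ultimately show ?thesis by (simp add: fourier_coeff_def fourier_def)
qed

section \<open>Fourier coefficients of an invertible symbol and of its inverse\<close>

text \<open>The hypotheses of the theorem. Below, \<open>a_coeff k i j\<close> and \<open>b_coeff k i j\<close> are the entries of the matrix
  coefficients of the symbol \<open>a\<close> and of its inverse \<open>b\<close>.\<close>

locale invertible_symbol =
  fixes a :: "complex \<Rightarrow> complex^'n^'n" and w :: int
  assumes K11: "a \<in> K11"
    and continuous: "continuous_on (sphere 0 1) a"
    and det_nonzero: "\<forall>t\<in>sphere 0 1. det (a t) \<noteq> 0"
    and winding: "winding_number ((\<lambda>t. det (a t)) \<circ> circlepath 0 1) 0 = of_int w"
begin

definition b :: "complex \<Rightarrow> complex^'n^'n" where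
  "b t = matrix_inv (a t)"

definition a_entry :: "'n \<Rightarrow> 'n \<Rightarrow> real \<Rightarrow> complex" where
  "a_entry i j \<theta> = a (cis \<theta>) $ i $ j"

definition b_entry :: "'n \<Rightarrow> 'n \<Rightarrow> real \<Rightarrow> complex" where
  "b_entry i j \<theta> = b (cis \<theta>) $ i $ j"

definition a_coeff :: "int \<Rightarrow> 'n \<Rightarrow> 'n \<Rightarrow> complex" where
  "a_coeff k i j = fourier_coeff a k $ i $ j"

definition b_coeff :: "int \<Rightarrow> 'n \<Rightarrow> 'n \<Rightarrow> complex" where
  "b_coeff k i j = fourier_coeff b k $ i $ j"

lemma continuous_entry: "continuous_on (sphere 0 1) (\<lambda>t. a t $ i $ j)"
  by (intro continuous_on_component continuous)

lemma continuous_a_entry: "continuous_on UNIV (a_entry i j)"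
  using continuous_on_cis_comp[OF continuous_entry] unfolding a_entry_def[abs_def] .

lemma det_cis: "det (a (cis \<theta>)) \<noteq> 0"
  using det_nonzero by simp

lemma a_coeff: "a_coeff k i j = fourier (a_entry i j) k"
  unfolding a_coeff_def a_entry_def[abs_def]
  by (rule fourier_coeff_entry[OF continuous_on_cis_comp[OF continuous_entry]])

lemma summable_weighted_a_coeff:
  "(\<lambda>k. (real_of_int \<bar>k\<bar> + 1) * norm (a_coeff k i j)) summable_on UNIV"
proof -
  have "(\<lambda>k. (real_of_int \<bar>k\<bar> + 1) * norm (fourier_coeff a k)) summable_on UNIV"
    using K11 by (simp add: K11_def)
  then show ?thesis
  proof (rule summable_on_comparison_test)
    fix k :: int
    have "norm (a_coeff k i j) \<le> norm (fourier_coeff a k)"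
      unfolding a_coeff_def
      by (rule order_trans[OF Finite_Cartesian_Product.norm_nth_le Finite_Cartesian_Product.norm_nth_le])
    then show "(real_of_int \<bar>k\<bar> + 1) * norm (a_coeff k i j) \<le> (real_of_int \<bar>k\<bar> + 1) * norm (fourier_coeff a k)"
      by (intro mult_left_mono) auto
  qed auto
qed

lemma summable_a_coeff: "(\<lambda>k. norm (a_coeff k i j)) summable_on UNIV"
  by (rule summable_on_comparison_test[OF summable_weighted_a_coeff[of i j]]) (auto simp: distrib_right)

lemma summable_derivative_a_coeff: "(\<lambda>k. norm (of_int k * a_coeff k i j)) summable_on UNIV"
  by (rule summable_on_comparison_test[OF summable_weighted_a_coeff[of i j]]) (auto simp: norm_mult distrib_right)

lemma a_series: "a_entry i j \<theta> = (\<Sum>\<^sub>\<infinity>k. a_coeff k i j * cis (of_int k * \<theta>))"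
  using fourier_inversion[OF continuous_entry, of i j \<theta>] summable_a_coeff[of i j]
  unfolding a_coeff by (simp add: a_entry_def[abs_def])

definition a_deriv :: "'n \<Rightarrow> 'n \<Rightarrow> real \<Rightarrow> complex" where
  "a_deriv i j \<theta> = (\<Sum>\<^sub>\<infinity>k. \<i> * of_int k * a_coeff k i j * cis (of_int k * \<theta>))"

lemma C1_a: "has_C1_derivative (a_entry i j) (a_deriv i j)"
proof -
  have "a_entry i j = (\<lambda>\<theta>. \<Sum>\<^sub>\<infinity>k. a_coeff k i j * cis (of_int k * \<theta>))"
    by (intro ext a_series)
  then show ?thesis
    unfolding a_deriv_def[abs_def]
    using fourier_series_C1[OF summable_a_coeff[of i j] summable_derivative_a_coeff[of i j]] by simp
qed

lemma C1_b: "\<exists>f'. has_C1_derivative (b_entry i j) f'"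
  unfolding b_def b_entry_def[abs_def]
proof (rule C1_matrix_inv)
  show "\<exists>f'. has_C1_derivative (\<lambda>\<theta>. a (cis \<theta>) $ i $ j) f'" for i j
    using C1_a[of i j] unfolding a_entry_def[abs_def] by blast
qed (rule det_cis)

lemma continuous_b_entry: "continuous_on UNIV (b_entry i j)"
  using C1_b C1_continuous by blast

lemma b_coeff: "b_coeff k i j = fourier (b_entry i j) k"
  unfolding b_coeff_def b_entry_def[abs_def]
  by (rule fourier_coeff_entry[OF continuous_b_entry[unfolded b_entry_def[abs_def]]])

text \<open>The weight in \<open>K11\<close> makes \<open>a\<close> continuously differentiable on the circle; so is \<open>b\<close>, and continuously
  differentiable functions have absolutely convergent Fourier series.\<close>

lemma summable_b_coeff: "(\<lambda>k. norm (b_coeff k i j)) summable_on UNIV"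
proof -
  obtain f' where "has_C1_derivative (b_entry i j) f'" using C1_b by blast
  from C1_fourier_summable[OF this] show ?thesis by (simp add: b_coeff b_entry_def)
qed

lemma convolution:
  "((\<lambda>m. a_coeff m i l * b_coeff (k - m) i' l') has_sum fourier (\<lambda>\<theta>. a_entry i l \<theta> * b_entry i' l' \<theta>) k) UNIV"
  unfolding a_series b_coeff by (rule fourier_series_mult[OF summable_a_coeff continuous_b_entry])

lemma fourier_kron: "fourier (\<lambda>_. if i = j then 1 else 0) k = (if k = 0 \<and> i = j then 1 else 0)"
  using fourier_cmult[of "if i = j then 1 else 0" "\<lambda>_. 1" k] by (simp add: fourier_one)

lemma ab_coeff:
  "((\<lambda>m. \<Sum>l\<in>UNIV. a_coeff m i l * b_coeff (k - m) l j) has_sum (if k = 0 \<and> i = j then 1 else 0)) UNIV"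
proof -
  have "((\<lambda>m. \<Sum>l\<in>UNIV. a_coeff m i l * b_coeff (k - m) l j) has_sum
     (\<Sum>l\<in>UNIV. fourier (\<lambda>\<theta>. a_entry i l \<theta> * b_entry l j \<theta>) k)) UNIV"
    by (intro has_sum_finite_sum convolution) simp
  also have "(\<Sum>l\<in>UNIV. fourier (\<lambda>\<theta>. a_entry i l \<theta> * b_entry l j \<theta>) k) =
     fourier (\<lambda>\<theta>. \<Sum>l\<in>UNIV. a_entry i l \<theta> * b_entry l j \<theta>) k"
    by (rule fourier_sum[symmetric]) (auto intro!: continuous_on_mult continuous_a_entry continuous_b_entry)
  also have "(\<lambda>\<theta>. \<Sum>l\<in>UNIV. a_entry i l \<theta> * b_entry l j \<theta>) = (\<lambda>_. if i = j then 1 else 0)"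
  proof
    fix \<theta>
    have "(\<Sum>l\<in>UNIV. a_entry i l \<theta> * b_entry l j \<theta>) = (a (cis \<theta>) ** b (cis \<theta>)) $ i $ j"
      by (simp add: matrix_matrix_mult_def a_entry_def b_entry_def)
    then show "(\<Sum>l\<in>UNIV. a_entry i l \<theta> * b_entry l j \<theta>) = (if i = j then 1 else 0)"
      using matrix_inv_det(1)[OF det_cis[of \<theta>]] by (simp add: b_def mat_def)
  qed
  finally show ?thesis unfolding fourier_kron .
qed

text \<open>The series of \<open>a\<close> is again the one that is multiplied by a continuous function; the substitution
  \<open>m \<mapsto> k - m\<close> then exchanges the roles of the two coefficient families.\<close>

lemma ba_coeff:
  "((\<lambda>m. \<Sum>l\<in>UNIV. b_coeff m i l * a_coeff (k - m) l j) has_sum (if k = 0 \<and> i = j then 1 else 0)) UNIV"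
proof -
  have "((\<lambda>m. \<Sum>l\<in>UNIV. a_coeff m l j * b_coeff (k - m) i l) has_sum
     (\<Sum>l\<in>UNIV. fourier (\<lambda>\<theta>. a_entry l j \<theta> * b_entry i l \<theta>) k)) UNIV"
    by (intro has_sum_finite_sum convolution) simp
  also have "(\<Sum>l\<in>UNIV. fourier (\<lambda>\<theta>. a_entry l j \<theta> * b_entry i l \<theta>) k) =
     fourier (\<lambda>\<theta>. \<Sum>l\<in>UNIV. a_entry l j \<theta> * b_entry i l \<theta>) k"
    by (rule fourier_sum[symmetric]) (auto intro!: continuous_on_mult continuous_a_entry continuous_b_entry)
  also have "(\<lambda>\<theta>. \<Sum>l\<in>UNIV. a_entry l j \<theta> * b_entry i l \<theta>) = (\<lambda>_. if i = j then 1 else 0)"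
  proof
    fix \<theta>
    have "(\<Sum>l\<in>UNIV. a_entry l j \<theta> * b_entry i l \<theta>) = (b (cis \<theta>) ** a (cis \<theta>)) $ i $ j"
      by (simp add: matrix_matrix_mult_def a_entry_def b_entry_def mult.commute)
    then show "(\<Sum>l\<in>UNIV. a_entry l j \<theta> * b_entry i l \<theta>) = (if i = j then 1 else 0)"
      using matrix_inv_det(2)[OF det_cis[of \<theta>]] by (simp add: b_def mat_def)
  qed
  finally have *: "((\<lambda>m. \<Sum>l\<in>UNIV. a_coeff m l j * b_coeff (k - m) i l) has_sum
     (if k = 0 \<and> i = j then 1 else 0)) UNIV" unfolding fourier_kron .
  have bij: "bij_betw (\<lambda>m. k - m) UNIV UNIV" by (rule bij_betwI[where g="\<lambda>m. k - m"]) auto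
  show ?thesis
    using has_sum_reindex_bij_betw[OF bij, of "\<lambda>m. \<Sum>l\<in>UNIV. a_coeff m l j * b_coeff (k - m) i l"] *
    by (simp add: mult.commute)
qed

text \<open>By Jacobi's formula the logarithmic derivative of \<open>det a\<close> is the trace of \<open>a' b\<close>, and its mean is found by
  expanding \<open>a'\<close> in its Fourier series.\<close>

lemma winding_coeff:
  "((\<lambda>m. of_int m * (\<Sum>i\<in>UNIV. \<Sum>l\<in>UNIV. a_coeff m i l * b_coeff (- m) l i)) has_sum of_int w) UNIV"
proof -
  let ?l = "\<lambda>\<theta>. \<Sum>i\<in>UNIV. \<Sum>l\<in>UNIV. a_deriv i l \<theta> * b_entry l i \<theta>"
  have ca': "continuous_on UNIV (a_deriv i l)" for i l
    using C1_a by (auto simp: has_C1_derivative_def)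
  have cab: "continuous_on UNIV (\<lambda>\<theta>. a_deriv i l \<theta> * b_entry l i \<theta>)" for i l
    by (intro continuous_on_mult ca' continuous_b_entry)
  have cl: "continuous_on UNIV ?l"
    by (intro continuous_on_sum cab)
  have "has_C1_derivative (\<lambda>\<theta>. det (a (cis \<theta>))) (\<lambda>\<theta>. det (a (cis \<theta>)) * ?l \<theta>)"
    unfolding has_C1_derivative_def
  proof (intro conjI allI)
    have "\<exists>f'. has_C1_derivative (\<lambda>\<theta>. a (cis \<theta>) $ i $ j) f'" for i j
      using C1_a[of i j] unfolding a_entry_def[abs_def] by blast
    from C1_det[of "\<lambda>\<theta>. a (cis \<theta>)", OF this] obtain f' where "has_C1_derivative (\<lambda>\<theta>. det (a (cis \<theta>))) f'"
      by blast
    then show "continuous_on UNIV (\<lambda>\<theta>. det (a (cis \<theta>)) * ?l \<theta>)"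
      by (intro continuous_on_mult cl C1_continuous)
    fix \<theta>
    have "((\<lambda>\<theta>. a (cis \<theta>) $ i $ j) has_vector_derivative a_deriv i j \<theta>) (at \<theta>)" for i j
      using C1_a[of i j] unfolding has_C1_derivative_def a_entry_def[abs_def] by blast
    from jacobi_formula[OF this det_cis]
    show "((\<lambda>\<theta>. det (a (cis \<theta>))) has_vector_derivative det (a (cis \<theta>)) * ?l \<theta>) (at \<theta>)"
      unfolding b_entry_def b_def .
  qed
  from winding_number_log_derivative[OF this cl det_cis]
  have w: "of_int w = 1 / \<i> * fourier ?l 0" using winding by simp
  have "((\<lambda>m. (\<i> * of_int m * a_coeff m i l) * fourier (b_entry l i) (0 - m)) has_sum
      fourier (\<lambda>\<theta>. a_deriv i l \<theta> * b_entry l i \<theta>) 0) UNIV" for i l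
    unfolding a_deriv_def
    by (rule fourier_series_mult) (use summable_derivative_a_coeff[of i l] in \<open>simp_all add: norm_mult continuous_b_entry\<close>)
  then have "((\<lambda>m. \<Sum>i\<in>UNIV. \<Sum>l\<in>UNIV. (\<i> * of_int m * a_coeff m i l) * fourier (b_entry l i) (0 - m)) has_sum
     (\<Sum>i\<in>UNIV. \<Sum>l\<in>UNIV. fourier (\<lambda>\<theta>. a_deriv i l \<theta> * b_entry l i \<theta>) 0)) UNIV"
    by (intro has_sum_finite_sum) simp_all
  also have "(\<Sum>i\<in>UNIV. \<Sum>l\<in>UNIV. fourier (\<lambda>\<theta>. a_deriv i l \<theta> * b_entry l i \<theta>) 0) = fourier ?l 0"
    by (simp add: fourier_sum cab continuous_on_sum)
  finally have "((\<lambda>m. 1 / \<i> * (\<Sum>i\<in>UNIV. \<Sum>l\<in>UNIV. (\<i> * of_int m * a_coeff m i l) * b_coeff (- m) l i)) has_sum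
     1 / \<i> * fourier ?l 0) UNIV"
    by (intro has_sum_cmult_right) (simp add: b_coeff)
  moreover have "1 / \<i> * (\<Sum>i\<in>UNIV. \<Sum>l\<in>UNIV. (\<i> * of_int m * a_coeff m i l) * b_coeff (- m) l i) =
     of_int m * (\<Sum>i\<in>UNIV. \<Sum>l\<in>UNIV. a_coeff m i l * b_coeff (- m) l i)" for m
    by (simp add: sum_distrib_left mult.assoc)
  ultimately show ?thesis unfolding w by (simp only:)
qed

end

section \<open>Determinants over finite index sets\<close>

definition minor :: "('i \<Rightarrow> 'i \<Rightarrow> complex) \<Rightarrow> 'i set \<Rightarrow> complex" where
  "minor M S = (\<Sum>\<pi> | \<pi> permutes S. of_int (sign \<pi>) * (\<Prod>p\<in>S. M p (\<pi> p)))"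

abbreviation kron :: "'i \<Rightarrow> 'i \<Rightarrow> complex" where
  "kron p q \<equiv> (if p = q then 1 else 0)"

lemma minor_cong:
  assumes "\<And>p q. p \<in> S \<Longrightarrow> q \<in> S \<Longrightarrow> M p q = N p q"
  shows "minor M S = minor N S"
  unfolding minor_def
  by (intro sum.cong refl arg_cong2[where f="(*)"] prod.cong assms) (auto dest: permutes_in_image)

lemma minor_empty [simp]: "minor M {} = 1"
  by (simp add: minor_def)

lemma minor_singleton [simp]: "minor M {p} = M p p"
  by (simp add: minor_def)

lemma minor_compose_right:
  assumes "finite S" "\<sigma> permutes S"
  shows "minor (\<lambda>p. M (\<sigma> p)) S = of_int (sign \<sigma>) * minor M S"
proof -
  have perm: "permutation \<pi>" if "\<pi> permutes S" for \<pi>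
    using assms(1) that permutation_permutes by blast
  have "minor (\<lambda>p. M (\<sigma> p)) S = (\<Sum>\<pi> | \<pi> permutes S. of_int (sign (\<pi> \<circ> \<sigma>)) * (\<Prod>p\<in>S. M (\<sigma> p) ((\<pi> \<circ> \<sigma>) p)))"
    unfolding minor_def by (rule sum_permutations_compose_right[OF assms(2)])
  also have "\<dots> = (\<Sum>\<pi> | \<pi> permutes S. of_int (sign \<sigma>) * (of_int (sign \<pi>) * (\<Prod>p\<in>S. M p (\<pi> p))))"
  proof (rule sum.cong[OF refl])
    fix \<pi> assume "\<pi> \<in> {\<pi>. \<pi> permutes S}"
    then have \<pi>: "\<pi> permutes S" by simp
    have "(\<Prod>p\<in>S. M (\<sigma> p) ((\<pi> \<circ> \<sigma>) p)) = (\<Prod>p\<in>S. M p (\<pi> p))"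
      using prod.permute[OF assms(2), of "\<lambda>p. M p (\<pi> p)"] by (simp add: o_def)
    then show "of_int (sign (\<pi> \<circ> \<sigma>)) * (\<Prod>p\<in>S. M (\<sigma> p) ((\<pi> \<circ> \<sigma>) p)) =
        of_int (sign \<sigma>) * (of_int (sign \<pi>) * (\<Prod>p\<in>S. M p (\<pi> p)))"
      using sign_compose[OF perm[OF \<pi>] perm[OF assms(2)]] by simp
  qed
  also have "\<dots> = of_int (sign \<sigma>) * minor M S"
    by (simp add: minor_def sum_distrib_left)
  finally show ?thesis .
qed

text \<open>Exchanging the two equal rows changes the sign of the determinant but not the matrix.\<close>

lemma minor_repeated_row:
  assumes "finite S" "f ` S \<subseteq> S" "\<not> inj_on f S"
  shows "minor (\<lambda>p. M (f p)) S = 0"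
proof -
  obtain i j where ij: "i \<in> S" "j \<in> S" "i \<noteq> j" "f i = f j"
    using assms(3) by (auto simp: inj_on_def)
  let ?\<tau> = "Transposition.transpose i j"
  have \<tau>: "?\<tau> permutes S" using ij by (simp add: permutes_swap_id)
  have "f (?\<tau> p) = f p" for p
    using ij by (cases "p = i"; cases "p = j") (auto simp: Transposition.transpose_def)
  then have "minor (\<lambda>p. M (f p)) S = of_int (sign ?\<tau>) * minor (\<lambda>p. M (f p)) S"
    using minor_compose_right[OF assms(1) \<tau>, of "\<lambda>p. M (f p)"] by simp
  then show ?thesis using ij by (simp add: sign_swap_id)
qed

text \<open>Multiplying out the rows of the product gives a sum over all maps \<open>f\<close> from \<open>S\<close> to itself. If \<open>f\<close> is not
  injective, the inner determinant has two equal rows; the injective ones are the permutations of \<open>S\<close>.\<close>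

lemma minor_mult:
  assumes "finite S"
  shows "minor (\<lambda>p q. \<Sum>r\<in>S. A p r * B r q) S = minor A S * minor B S"
proof -
  let ?E = "PiE S (\<lambda>_. S)"
  let ?g = "\<lambda>f. (\<Prod>p\<in>S. A p (f p)) * minor (\<lambda>p. B (f p)) S"
  have "minor (\<lambda>p q. \<Sum>r\<in>S. A p r * B r q) S =
     (\<Sum>\<pi> | \<pi> permutes S. of_int (sign \<pi>) * (\<Sum>f\<in>?E. \<Prod>p\<in>S. A p (f p) * B (f p) (\<pi> p)))"
    unfolding minor_def using assms by (simp add: prod_sum_PiE)
  also have "\<dots> = (\<Sum>\<pi> | \<pi> permutes S. \<Sum>f\<in>?E. (\<Prod>p\<in>S. A p (f p)) * (of_int (sign \<pi>) * (\<Prod>p\<in>S. B (f p) (\<pi> p))))"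
    by (simp add: sum_distrib_left prod.distrib mult_ac)
  also have "\<dots> = (\<Sum>f\<in>?E. ?g f)"
    by (subst sum.swap) (simp add: minor_def sum_distrib_left)
  also have "\<dots> = (\<Sum>f\<in>{f\<in>?E. inj_on f S}. ?g f)"
  proof (rule sum.mono_neutral_right)
    show "finite ?E" using assms by (simp add: finite_PiE)
    show "\<forall>f\<in>?E - {f \<in> ?E. inj_on f S}. ?g f = 0"
    proof
      fix f assume "f \<in> ?E - {f \<in> ?E. inj_on f S}"
      then have "f ` S \<subseteq> S" "\<not> inj_on f S" by auto
      then show "?g f = 0" using minor_repeated_row[OF assms] by simp
    qed
  qed auto
  also have "\<dots> = (\<Sum>\<sigma> | \<sigma> permutes S. ?g \<sigma>)"
  proof (rule sum.reindex_bij_witness[where i="\<lambda>\<sigma>. restrict \<sigma> S" and j="\<lambda>f x. if x \<in> S then f x else x"])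
    fix f assume f: "f \<in> {f\<in>?E. inj_on f S}"
    then show "restrict (\<lambda>x. if x \<in> S then f x else x) S = f"
      by (auto simp: PiE_def extensional_def restrict_def)
    have "bij_betw f S S"
      using f endo_inj_surj[OF assms, of f] by (auto simp: bij_betw_def PiE_def Pi_def image_subset_iff)
    then have "bij_betw (\<lambda>x. if x \<in> S then f x else x) S S"
      by (subst bij_betw_cong[where g=f]) auto
    then show "(\<lambda>x. if x \<in> S then f x else x) \<in> {\<sigma>. \<sigma> permutes S}"
      by (auto intro: bij_imp_permutes)
    show "?g (\<lambda>x. if x \<in> S then f x else x) = ?g f"
      by (intro arg_cong2[where f="(*)"] prod.cong refl minor_cong) auto
  next
    fix \<sigma> assume "\<sigma> \<in> {\<sigma>. \<sigma> permutes S}"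
    then have \<sigma>: "\<sigma> permutes S" by simp
    show "(\<lambda>x. if x \<in> S then restrict \<sigma> S x else x) = \<sigma>"
      using \<sigma> by (auto simp: permutes_def)
    show "restrict \<sigma> S \<in> {f\<in>?E. inj_on f S}"
      using \<sigma> by (auto simp: permutes_in_image inj_on_def dest: permutes_inj[THEN injD])
  qed
  also have "\<dots> = (\<Sum>\<sigma> | \<sigma> permutes S. (of_int (sign \<sigma>) * (\<Prod>p\<in>S. A p (\<sigma> p))) * minor B S)"
    by (intro sum.cong refl) (simp add: minor_compose_right[OF assms])
  also have "\<dots> = minor A S * minor B S"
    by (simp add: minor_def sum_distrib_right)
  finally show ?thesis .
qed

text \<open>In each row one chooses either the diagonal term or the entry of \<open>M\<close>. A permutation contributes only if it
  fixes all rows outside the set \<open>S\<close> of rows in which \<open>M\<close> is chosen. For \<open>c = 1\<close> this is the Fredholm series of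
  a finite matrix, for general \<open>c\<close> the characteristic polynomial.\<close>

lemma minor_add_kron:
  assumes "finite F"
  shows "minor (\<lambda>p q. c * kron p q + M p q) F = (\<Sum>S\<in>Pow F. c ^ card (F - S) * minor M S)"
proof -
  have fp: "finite {\<pi>. \<pi> permutes F}" using assms by (simp add: finite_permutations)
  have "minor (\<lambda>p q. c * kron p q + M p q) F =
     (\<Sum>\<pi> | \<pi> permutes F. of_int (sign \<pi>) * (\<Sum>S\<in>Pow F. (\<Prod>p\<in>S. M p (\<pi> p)) * (\<Prod>p\<in>F-S. c * kron p (\<pi> p))))"
    unfolding minor_def by (subst add.commute) (simp only: prod_add[OF assms])
  also have "\<dots> = (\<Sum>S\<in>Pow F. \<Sum>\<pi> | \<pi> permutes F. of_int (sign \<pi>) * ((\<Prod>p\<in>S. M p (\<pi> p)) * (\<Prod>p\<in>F-S. c * kron p (\<pi> p))))"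
    by (subst sum.swap) (simp add: sum_distrib_left)
  also have "\<dots> = (\<Sum>S\<in>Pow F. c ^ card (F - S) * minor M S)"
  proof (rule sum.cong[OF refl])
    fix S assume "S \<in> Pow F"
    then have S: "S \<subseteq> F" by simp
    have "(\<Sum>\<pi> | \<pi> permutes F. of_int (sign \<pi>) * ((\<Prod>p\<in>S. M p (\<pi> p)) * (\<Prod>p\<in>F-S. c * kron p (\<pi> p))))
        = (\<Sum>\<pi> | \<pi> permutes S. of_int (sign \<pi>) * ((\<Prod>p\<in>S. M p (\<pi> p)) * c ^ card (F - S)))"
    proof (rule sum.mono_neutral_cong_right[OF fp])
      show "{\<pi>. \<pi> permutes S} \<subseteq> {\<pi>. \<pi> permutes F}" using S permutes_subset by blast
      show "\<forall>\<pi>\<in>{\<pi>. \<pi> permutes F} - {\<pi>. \<pi> permutes S}. of_int (sign \<pi>) * ((\<Prod>p\<in>S. M p (\<pi> p)) * (\<Prod>p\<in>F-S. c * kron p (\<pi> p))) = 0"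
      proof
        fix \<pi> assume "\<pi> \<in> {\<pi>. \<pi> permutes F} - {\<pi>. \<pi> permutes S}"
        then obtain p where "p \<in> F - S" "\<pi> p \<noteq> p"
          using permutes_superset[of \<pi> F S] by auto
        then have "(\<Prod>p\<in>F-S. c * kron p (\<pi> p)) = 0"
          using assms by (intro prod_zero) (auto intro!: bexI[of _ p])
        then show "of_int (sign \<pi>) * ((\<Prod>p\<in>S. M p (\<pi> p)) * (\<Prod>p\<in>F-S. c * kron p (\<pi> p))) = 0" by simp
      qed
      fix \<pi> assume "\<pi> \<in> {\<pi>. \<pi> permutes S}"
      then have "(\<Prod>p\<in>F-S. c * kron p (\<pi> p)) = (\<Prod>p\<in>F-S. c)"
        by (intro prod.cong) (auto simp: permutes_def)
      then show "of_int (sign \<pi>) * ((\<Prod>p\<in>S. M p (\<pi> p)) * (\<Prod>p\<in>F-S. c * kron p (\<pi> p))) =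
          of_int (sign \<pi>) * ((\<Prod>p\<in>S. M p (\<pi> p)) * c ^ card (F - S))" by simp
    qed
    also have "\<dots> = c ^ card (F - S) * minor M S"
      by (simp add: minor_def sum_distrib_left mult_ac)
    finally show "(\<Sum>\<pi> | \<pi> permutes F. of_int (sign \<pi>) * ((\<Prod>p\<in>S. M p (\<pi> p)) * (\<Prod>p\<in>F-S. c * kron p (\<pi> p)))) = c ^ card (F - S) * minor M S" .
  qed
  finally show ?thesis .
qed

text \<open>Extending the sum from permutations to all maps of \<open>S\<close> to itself makes it factor over the rows.\<close>

lemma minor_norm_le:
  assumes "finite S"
  shows "norm (minor M S) \<le> (\<Prod>p\<in>S. \<Sum>q\<in>S. norm (M p q))"
proof -
  have fp: "finite {\<pi>. \<pi> permutes S}" using assms by (simp add: finite_permutations)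
  have "norm (minor M S) \<le> (\<Sum>\<pi> | \<pi> permutes S. \<Prod>p\<in>S. norm (M p (\<pi> p)))"
    unfolding minor_def
    by (rule order_trans[OF norm_sum]) (auto intro!: sum_mono simp: norm_mult prod_norm[symmetric] sign_def)
  also have "\<dots> = (\<Sum>f\<in>(\<lambda>\<pi>. restrict \<pi> S) ` {\<pi>. \<pi> permutes S}. \<Prod>p\<in>S. norm (M p (f p)))"
  proof (subst sum.reindex)
    show "inj_on (\<lambda>\<pi>. restrict \<pi> S) {\<pi>. \<pi> permutes S}"
    proof (rule inj_onI, rule ext)
      fix \<pi> \<sigma> x assume a: "\<pi> \<in> {\<pi>. \<pi> permutes S}" "\<sigma> \<in> {\<pi>. \<pi> permutes S}" "restrict \<pi> S = restrict \<sigma> S"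
      show "\<pi> x = \<sigma> x"
        using a(1,2) fun_cong[OF a(3), of x] by (cases "x \<in> S") (auto simp: permutes_def)
    qed
  qed (simp add: o_def)
  also have "\<dots> \<le> (\<Sum>f\<in>PiE S (\<lambda>_. S). \<Prod>p\<in>S. norm (M p (f p)))"
    using assms by (intro sum_mono2) (auto simp: permutes_in_image finite_PiE intro!: prod_nonneg)
  also have "\<dots> = (\<Prod>p\<in>S. \<Sum>q\<in>S. norm (M p q))"
    using assms by (simp add: prod_sum_PiE)
  finally show ?thesis .
qed

text \<open>The determinant is a monic polynomial in \<open>w\<close> and has finitely many zeros.\<close>

lemma eventually_minor_shift_nonzero:
  assumes "finite F"
  shows "\<forall>\<^sub>F w in at 0. minor (\<lambda>p q. w * kron p q + M p q) F \<noteq> 0"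
proof -
  define P where "P = (\<Sum>S\<in>Pow F. monom (minor M S) (card (F - S)))"
  have poly: "minor (\<lambda>p q. w * kron p q + M p q) F = poly P w" for w
    unfolding P_def minor_add_kron[OF assms] by (simp add: poly_sum poly_monom mult.commute)
  have "coeff P (card F) = (\<Sum>S\<in>Pow F. if S = {} then 1 else 0)"
    unfolding P_def coeff_sum
  proof (rule sum.cong[OF refl])
    fix S assume S: "S \<in> Pow F"
    then have lt: "card (F - S) < card F" if "S \<noteq> {}"
      using that assms by (intro psubset_card_mono) auto
    then show "coeff (monom (minor M S) (card (F - S))) (card F) = (if S = {} then 1 else 0)"
      using lt by (cases "S = {}") auto
  qed
  also have "\<dots> = 1" using assms by (simp add: sum.delta)
  finally have "P \<noteq> 0" by auto
  then have "finite {w. poly P w = 0}" by (rule poly_roots_finite)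
  then have "open (- ({w. poly P w = 0} - {0}))"
    by (intro open_Compl finite_imp_closed) auto
  then have "\<forall>\<^sub>F w in at 0. w \<in> - ({w. poly P w = 0} - {0})"
    by (rule eventually_at_in_open') simp
  then show ?thesis
    unfolding poly eventually_at_filter by (rule eventually_mono) auto
qed

lemma minor_tendsto:
  assumes "\<And>p q. p \<in> S \<Longrightarrow> q \<in> S \<Longrightarrow> ((\<lambda>t. M t p q) \<longlongrightarrow> N p q) G"
  shows "((\<lambda>t. minor (M t) S) \<longlongrightarrow> minor N S) G"
  unfolding minor_def
  by (intro tendsto_sum tendsto_mult tendsto_const tendsto_prod assms) (auto dest: permutes_in_image)

text \<open>If \<open>X\<close> is invertible, the two matrices are conjugate by \<open>X\<close>. In general \<open>w + X\<close> is invertible for all small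
  \<open>w \<noteq> 0\<close>, and both sides depend continuously on \<open>w\<close>.\<close>

lemma minor_sylvester:
  fixes X Y :: "'i \<Rightarrow> 'i \<Rightarrow> complex"
  assumes "finite F"
  shows "minor (\<lambda>p q. kron p q + (\<Sum>r\<in>F. X p r * Y r q)) F = minor (\<lambda>p q. kron p q + (\<Sum>r\<in>F. Y p r * X r q)) F"
proof -
  define Z where "Z w p q = w * kron p q + X p q" for w :: complex and p q
  define L where "L w p q = kron p q + (\<Sum>r\<in>F. Z w p r * Y r q)" for w p q
  define R where "R w p q = kron p q + (\<Sum>r\<in>F. Y p r * Z w r q)" for w p q
  have ev: "\<forall>\<^sub>F w in at 0. minor (R w) F = minor (L w) F"
    using eventually_minor_shift_nonzero[OF assms, of X]
  proof (rule eventually_mono)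
    fix w assume nz: "minor (\<lambda>p q. w * kron p q + X p q) F \<noteq> 0"
    have "minor (L w) F * minor (Z w) F = minor (\<lambda>p q. \<Sum>r\<in>F. L w p r * Z w r q) F"
      by (simp add: minor_mult[OF assms])
    also have "\<dots> = minor (\<lambda>p q. \<Sum>r\<in>F. Z w p r * R w r q) F"
    proof (rule minor_cong)
      fix p q assume pq: "p \<in> F" "q \<in> F"
      have "(\<Sum>r\<in>F. L w p r * Z w r q) = Z w p q + (\<Sum>r\<in>F. \<Sum>t\<in>F. Z w p t * Y t r * Z w r q)"
      proof -
        have "(\<Sum>r\<in>F. kron p r * Z w r q) = (\<Sum>r\<in>F. if r = p then Z w r q else 0)"
          by (intro sum.cong) auto
        then have "(\<Sum>r\<in>F. kron p r * Z w r q) = Z w p q"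
          using assms pq by simp
        then show ?thesis
          by (simp add: L_def distrib_right sum.distrib sum_distrib_right)
      qed
      also have "\<dots> = Z w p q + (\<Sum>t\<in>F. \<Sum>r\<in>F. Z w p t * Y t r * Z w r q)"
        by (subst sum.swap) simp
      also have "\<dots> = (\<Sum>r\<in>F. Z w p r * R w r q)"
      proof -
        have "(\<Sum>r\<in>F. Z w p r * kron r q) = (\<Sum>r\<in>F. if r = q then Z w p r else 0)"
          by (intro sum.cong) auto
        then have "(\<Sum>r\<in>F. Z w p r * kron r q) = Z w p q"
          using assms pq by simp
        then show ?thesis
          by (simp add: R_def distrib_left sum.distrib sum_distrib_left mult.assoc)
      qed
      finally show "(\<Sum>r\<in>F. L w p r * Z w r q) = (\<Sum>r\<in>F. Z w p r * R w r q)" .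
    qed
    also have "\<dots> = minor (Z w) F * minor (R w) F"
      by (simp add: minor_mult[OF assms])
    finally have "minor (L w) F * minor (Z w) F = minor (Z w) F * minor (R w) F" .
    moreover have "Z w = (\<lambda>p q. w * kron p q + X p q)"
      by (intro ext) (simp add: Z_def)
    ultimately show "minor (R w) F = minor (L w) F"
      using nz by simp
  qed
  have Z: "((\<lambda>w. Z w p q) \<longlongrightarrow> X p q) (at 0)" for p q
    unfolding Z_def by (auto intro!: tendsto_eq_intros)
  have limL: "((\<lambda>w. minor (L w) F) \<longlongrightarrow> minor (\<lambda>p q. kron p q + (\<Sum>r\<in>F. X p r * Y r q)) F) (at 0)"
    unfolding L_def by (intro minor_tendsto tendsto_intros Z)
  have limR: "((\<lambda>w. minor (R w) F) \<longlongrightarrow> minor (\<lambda>p q. kron p q + (\<Sum>r\<in>F. Y p r * X r q)) F) (at 0)"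
    unfolding R_def by (intro minor_tendsto tendsto_intros Z)
  show ?thesis
    by (rule tendsto_unique[OF at_neq_bot limL Lim_transform_eventually[OF limR ev]])
qed

section \<open>Determinants of perturbations with summable entries\<close>

text \<open>Tannery's theorem for an arbitrary filter: domination gives uniform convergence of the finite partial sums,
  which permits the interchange of limits.\<close>

lemma tendsto_infsum_dominated:
  fixes f :: "'a \<Rightarrow> 't \<Rightarrow> complex"
  assumes "M summable_on X"
    and ev: "\<forall>\<^sub>F t in G. \<forall>x\<in>X. norm (f x t) \<le> M x"
    and lim: "\<And>x. x \<in> X \<Longrightarrow> (f x \<longlongrightarrow> g x) G"
  shows "((\<lambda>t. \<Sum>\<^sub>\<infinity>x\<in>X. f x t) \<longlongrightarrow> (\<Sum>\<^sub>\<infinity>x\<in>X. g x)) G"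
proof (cases "G = bot")
  case False
  have "norm (g x) \<le> M x" if "x \<in> X" for x
    by (rule tendsto_upperbound[OF tendsto_norm[OF lim[OF that]] _ False])
       (use ev that in \<open>auto elim: eventually_mono\<close>)
  then have "(\<lambda>x. norm (g x)) summable_on X"
    by (intro Infinite_Sum.abs_summable_on_comparison_test'[OF assms(1)]) 
  then have g: "g summable_on X" by (rule abs_summable_summable)
  show ?thesis
  proof (rule swap_uniform_limit'[where F="finite_subsets_at_top X" and f="\<lambda>A t. \<Sum>x\<in>A. f x t"
        and S="{t. \<forall>x\<in>X. norm (f x t) \<le> M x}"])
    show "\<forall>\<^sub>F A in finite_subsets_at_top X. ((\<lambda>t. \<Sum>x\<in>A. f x t) \<longlongrightarrow> (\<Sum>x\<in>A. g x)) G"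
      by (rule eventually_finite_subsets_at_top_weakI) (auto intro!: tendsto_sum lim)
    show "((\<lambda>A. \<Sum>x\<in>A. g x) \<longlongrightarrow> (\<Sum>\<^sub>\<infinity>x\<in>X. g x)) (finite_subsets_at_top X)"
      using g by (rule infsum_tendsto)
    show "uniform_limit {t. \<forall>x\<in>X. norm (f x t) \<le> M x} (\<lambda>A t. \<Sum>x\<in>A. f x t) (\<lambda>t. \<Sum>\<^sub>\<infinity>x\<in>X. f x t) (finite_subsets_at_top X)"
      by (rule Weierstrass_m_test_general[OF _ assms(1)]) auto
  qed (use ev in auto)
qed simp

text \<open>The sum over the subsets of a finite set \<open>U\<close> is the product of the factors \<open>1 + r p\<close>, hence at most the
  exponential of the sum of \<open>r\<close>.\<close>

lemma summable_on_prod_finite_sets: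
  fixes r :: "'i \<Rightarrow> real"
  assumes "r summable_on UNIV" "\<And>p. r p \<ge> 0"
  shows "(\<lambda>S. \<Prod>p\<in>S. r p) summable_on {S. finite S}"
proof (rule nonneg_bdd_above_summable_on)
  show "bdd_above (sum (\<lambda>S. \<Prod>p\<in>S. r p) ` {\<G>. \<G> \<subseteq> {S. finite S} \<and> finite \<G>})"
  proof (rule bdd_aboveI2)
    fix \<G> assume "\<G> \<in> {\<G>. \<G> \<subseteq> {S :: 'i set. finite S} \<and> finite \<G>}"
    then have \<G>: "finite (\<Union>\<G>)" "finite \<G>" by auto
    have "(\<Sum>S\<in>\<G>. \<Prod>p\<in>S. r p) \<le> (\<Sum>S\<in>Pow (\<Union>\<G>). \<Prod>p\<in>S. r p)"
      using \<G> assms(2) by (intro sum_mono2) (auto intro!: prod_nonneg)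
    also have "\<dots> = (\<Prod>p\<in>\<Union>\<G>. r p + 1)"
      by (simp add: prod_add[OF \<G>(1)])
    also have "\<dots> \<le> (\<Prod>p\<in>\<Union>\<G>. exp (r p))"
      using assms(2) by (intro prod_mono) (auto simp: add.commute add_nonneg_nonneg)
    also have "\<dots> = exp (\<Sum>p\<in>\<Union>\<G>. r p)"
      using \<G> by (simp add: exp_sum)
    also have "\<dots> \<le> exp (\<Sum>\<^sub>\<infinity>p. r p)"
      using finite_sum_le_infsum[OF assms(1) \<G>(1)] assms(2) by simp
    finally show "(\<Sum>S\<in>\<G>. \<Prod>p\<in>S. r p) \<le> exp (\<Sum>\<^sub>\<infinity>p. r p)" .
  qed
qed (auto intro!: prod_nonneg assms(2))

definition entry_summable :: "('i \<Rightarrow> 'i \<Rightarrow> complex) \<Rightarrow> bool" where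
  "entry_summable M \<longleftrightarrow> (\<lambda>(p, q). norm (M p q)) summable_on UNIV"

text \<open>This is the determinant of \<open>I + M\<close>: the Fredholm series \<open>\<Sum>\<^sub>m tr (\<Lambda>\<^sup>m M)\<close> with the sums over index sets of
  size \<open>m\<close>, for all \<open>m\<close>, merged into one.\<close>

definition perturbation_det :: "('i \<Rightarrow> 'i \<Rightarrow> complex) \<Rightarrow> complex" where
  "perturbation_det M = (\<Sum>\<^sub>\<infinity>S\<in>{S. finite S}. minor M S)"

lemma summable_rows:
  fixes R :: "'i \<Rightarrow> 'j \<Rightarrow> real"
  assumes "(\<lambda>(p, q). R p q) summable_on UNIV" "\<And>p q. R p q \<ge> 0"
  shows "R p summable_on UNIV" "(\<lambda>p. \<Sum>\<^sub>\<infinity>q. R p q) summable_on UNIV"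
proof -
  have "(\<lambda>z. norm (case z of (p, q) \<Rightarrow> R p q)) summable_on Sigma UNIV (\<lambda>_. UNIV)"
    using assms by (intro summable_on_cong[THEN iffD1, OF _ assms(1)[folded UNIV_Times_UNIV]]) auto
  from this[unfolded Infinite_Sum.abs_summable_on_Sigma_iff]
  show "R p summable_on UNIV" "(\<lambda>p. \<Sum>\<^sub>\<infinity>q. R p q) summable_on UNIV"
    using assms(2) by (auto simp: infsum_nonneg)
qed

lemma minor_norm_le_row_sums:
  assumes "(\<lambda>(p, q). R p q) summable_on UNIV" "\<And>p q. norm (M p q) \<le> R p q" "finite S"
  shows "norm (minor M S) \<le> (\<Prod>p\<in>S. \<Sum>\<^sub>\<infinity>q. R p q)"
proof -
  have nn: "R p q \<ge> 0" for p q using assms(2)[of p q] norm_ge_zero order_trans by blast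
  have "(\<Sum>q\<in>S. norm (M p q)) \<le> (\<Sum>\<^sub>\<infinity>q. R p q)" for p
  proof -
    have "(\<Sum>q\<in>S. norm (M p q)) \<le> (\<Sum>q\<in>S. R p q)" by (intro sum_mono assms(2))
    also have "\<dots> \<le> (\<Sum>\<^sub>\<infinity>q. R p q)"
      using finite_sum_le_infsum[OF summable_rows(1)[OF assms(1) nn] assms(3)] nn by simp
    finally show ?thesis .
  qed
  then have "(\<Prod>p\<in>S. \<Sum>q\<in>S. norm (M p q)) \<le> (\<Prod>p\<in>S. \<Sum>\<^sub>\<infinity>q. R p q)"
    by (intro prod_mono) (auto intro!: sum_nonneg)
  then show ?thesis using minor_norm_le[OF assms(3), of M] by simp
qed

lemma minor_abs_summable:
  assumes "entry_summable M"
  shows "(\<lambda>S. norm (minor M S)) summable_on {S. finite S}"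
proof (rule Infinite_Sum.abs_summable_on_comparison_test')
  show "(\<lambda>S. \<Prod>p\<in>S. \<Sum>\<^sub>\<infinity>q. norm (M p q)) summable_on {S. finite S}"
    using assms summable_rows(2)[of "\<lambda>p q. norm (M p q)"]
    by (intro summable_on_prod_finite_sets) (auto simp: entry_summable_def infsum_nonneg)
qed (use assms in \<open>auto simp: entry_summable_def intro!: minor_norm_le_row_sums\<close>)

text \<open>The products of the row sums of the majorant \<open>R\<close> dominate all minors, so entrywise convergence passes
  through the sum over the index sets.\<close>

lemma perturbation_det_tendsto:
  assumes "(\<lambda>(p, q). R p q) summable_on UNIV"
    and "\<forall>\<^sub>F t in G. \<forall>p q. norm (M t p q) \<le> R p q"
    and "\<And>p q. R p q \<ge> 0"
    and "\<And>p q. ((\<lambda>t. M t p q) \<longlongrightarrow> N p q) G"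
  shows "((\<lambda>t. perturbation_det (M t)) \<longlongrightarrow> perturbation_det N) G"
  unfolding perturbation_det_def
proof (rule tendsto_infsum_dominated)
  show "(\<lambda>S. \<Prod>p\<in>S. \<Sum>\<^sub>\<infinity>q. R p q) summable_on {S. finite S}"
    using assms summable_rows(2)[of R] by (intro summable_on_prod_finite_sets) (auto intro!: infsum_nonneg)
  show "\<forall>\<^sub>F t in G. \<forall>S\<in>{S. finite S}. norm (minor (M t) S) \<le> (\<Prod>p\<in>S. \<Sum>\<^sub>\<infinity>q. R p q)"
    using assms(2) by (rule eventually_mono) (auto intro!: minor_norm_le_row_sums assms(1))
  show "((\<lambda>t. minor (M t) S) \<longlongrightarrow> minor N S) G" for S
    by (intro minor_tendsto assms(4))
qed

text \<open>A minor with a zero row vanishes, which leaves the expansion of a finite determinant.\<close>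

lemma perturbation_det_finite:
  assumes "finite F" "\<And>p q. p \<notin> F \<Longrightarrow> M p q = 0"
  shows "perturbation_det M = minor (\<lambda>p q. kron p q + M p q) F"
proof -
  have "minor M S = 0" if S: "finite S" "\<not> S \<subseteq> F" for S
  proof -
    obtain p where p: "p \<in> S" "p \<notin> F" using S(2) by auto
    have "(\<Prod>p\<in>S. M p (\<pi> p)) = 0" for \<pi>
      using S(1) p assms(2)[OF p(2)] by (intro prod_zero) (auto intro!: bexI[of _ p])
    then show ?thesis by (simp add: minor_def)
  qed
  then have "perturbation_det M = (\<Sum>\<^sub>\<infinity>S\<in>Pow F. minor M S)"
    unfolding perturbation_det_def using assms(1)
    by (intro infsum_cong_neutral) (auto intro: finite_subset)
  also have "\<dots> = minor (\<lambda>p q. kron p q + M p q) F"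
    using minor_add_kron[OF assms(1), of 1 M] assms(1) by simp
  finally show ?thesis .
qed

text \<open>The condition of the Schur test. It is stated with finite partial sums, so that it includes the summability
  of all rows and columns.\<close>

definition schur_bound :: "('i \<Rightarrow> 'i \<Rightarrow> complex) \<Rightarrow> real \<Rightarrow> bool" where
  "schur_bound M C \<longleftrightarrow> (\<forall>p F. finite F \<longrightarrow>
     (\<Sum>q\<in>F. norm (M p q)) \<le> C \<and> (\<Sum>q\<in>F. norm (M q p)) \<le> C)"

definition schur_bounded :: "('i \<Rightarrow> 'i \<Rightarrow> complex) \<Rightarrow> bool" where
  "schur_bounded M \<longleftrightarrow> (\<exists>C. schur_bound M C)"

lemmas schur_bounded_iff = schur_bounded_def[unfolded schur_bound_def]

lemma schur_boundD:
  assumes "schur_bound M C"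
  shows "C \<ge> 0"
    "(\<lambda>q. norm (M p q)) summable_on UNIV" "(\<Sum>\<^sub>\<infinity>q. norm (M p q)) \<le> C"
    "(\<lambda>q. norm (M q p)) summable_on UNIV" "(\<Sum>\<^sub>\<infinity>q. norm (M q p)) \<le> C"
    "norm (M p q) \<le> C"
proof -
  have C: "(\<Sum>q\<in>F. norm (M p q)) \<le> C" "(\<Sum>q\<in>F. norm (M q p)) \<le> C" if "finite F" for p F
    using assms that by (auto simp: schur_bound_def)
  show "C \<ge> 0" using C(1)[of "{}"] by simp
  show 1: "(\<lambda>q. norm (M p q)) summable_on UNIV" "(\<lambda>q. norm (M q p)) summable_on UNIV"
    using C by (auto intro!: nonneg_bdd_above_summable_on bdd_aboveI2)
  show "(\<Sum>\<^sub>\<infinity>q. norm (M p q)) \<le> C" "(\<Sum>\<^sub>\<infinity>q. norm (M q p)) \<le> C"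
    using C 1 by (auto intro!: infsum_le_finite_sums)
  show "norm (M p q) \<le> C" using C(1)[of "{q}" p] by simp
qed

lemma schur_bounded_transpose: "schur_bounded M \<Longrightarrow> schur_bounded (\<lambda>p q. M q p)"
  unfolding schur_bounded_iff by blast

lemma entry_summable_transpose: "entry_summable M \<Longrightarrow> entry_summable (\<lambda>p q. M q p)"
proof -
  assume "entry_summable M"
  then have "((\<lambda>(p, q). norm (M p q)) \<circ> prod.swap) summable_on UNIV"
    unfolding entry_summable_def by (subst summable_on_reindex[symmetric]) (auto simp: inj_on_def surj_swap)
  then show ?thesis by (simp add: entry_summable_def o_def case_prod_unfold)
qed

lemma entry_summable_imp_schur_bounded:
  assumes "entry_summable M"
  shows "schur_bounded M"
  unfolding schur_bounded_iff
proof (intro exI allI impI conjI)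
  fix p and F :: "'a set" assume F: "finite F"
  let ?f = "\<lambda>(p, q). norm (M p q)"
  have "(\<Sum>z\<in>Pair p ` F. ?f z) \<le> infsum ?f UNIV" "(\<Sum>z\<in>(\<lambda>q. (q, p)) ` F. ?f z) \<le> infsum ?f UNIV"
    using assms F by (auto intro!: finite_sum_le_infsum simp: entry_summable_def)
  then show "(\<Sum>q\<in>F. norm (M p q)) \<le> infsum ?f UNIV" "(\<Sum>q\<in>F. norm (M q p)) \<le> infsum ?f UNIV"
    by (simp_all add: sum.reindex inj_on_def)
qed

text \<open>Absolute summability over all three indices contains everything that is used about the product: existence
  of its entries, their summability, and a majorant for the truncated products.\<close>

lemma summable_product_triple:
  assumes "entry_summable X" "schur_bounded Y"
  shows "(\<lambda>((p, q), r). norm (X p r) * norm (Y r q)) summable_on UNIV"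
proof -
  obtain C where "schur_bound Y C" using assms(2) by (auto simp: schur_bounded_def)
  note C = schur_boundD(1-3)[OF this]
  have "(\<lambda>(z, q). norm (X (fst z) (snd z)) * norm (Y (snd z) q)) summable_on UNIV \<times> UNIV"
  proof (rule summable_on_SigmaI)
    show "((\<lambda>q. case (z, q) of (z, q) \<Rightarrow> norm (X (fst z) (snd z)) * norm (Y (snd z) q)) has_sum
        norm (X (fst z) (snd z)) * (\<Sum>\<^sub>\<infinity>q. norm (Y (snd z) q))) UNIV" for z
      using C(2) by (auto intro!: has_sum_cmult_right has_sum_infsum)
    have "(\<lambda>z. norm (X (fst z) (snd z)) * C) summable_on UNIV"
      using assms(1) by (intro summable_on_cmult_left) (simp add: entry_summable_def case_prod_unfold)
    then show "(\<lambda>z. norm (X (fst z) (snd z)) * (\<Sum>\<^sub>\<infinity>q. norm (Y (snd z) q))) summable_on UNIV"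
      by (rule summable_on_comparison_test) (auto intro!: mult_left_mono C mult_nonneg_nonneg infsum_nonneg)
  qed auto
  moreover have "bij_betw (\<lambda>((p, q), r). ((p, r), q)) UNIV UNIV"
    by (rule bij_betwI[where g="\<lambda>((p, q), r). ((p, r), q)"]) auto
  ultimately show ?thesis
    using summable_on_reindex_bij_betw[of "\<lambda>((p, q), r). ((p, r), q)" UNIV UNIV
      "\<lambda>(z, q). norm (X (fst z) (snd z)) * norm (Y (snd z) q)"]
    by (simp add: case_prod_unfold)
qed

lemma summable_product_triple':
  assumes "schur_bounded Y" "entry_summable X"
  shows "(\<lambda>((p, q), r). norm (Y p r) * norm (X r q)) summable_on UNIV"
proof -
  have "bij_betw (\<lambda>((p, q), r). ((q, p), r)) UNIV UNIV"
    by (rule bij_betwI[where g="\<lambda>((p, q), r). ((q, p), r)"]) auto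
  then show ?thesis
    using summable_on_reindex_bij_betw[of "\<lambda>((p, q), r). ((q, p), r)" UNIV UNIV
      "\<lambda>((p, q), r). norm (X r p) * norm (Y q r)"]
     summable_product_triple[OF entry_summable_transpose[OF assms(2)] schur_bounded_transpose[OF assms(1)]]
    by (simp add: case_prod_unfold mult.commute)
qed

lemma summable_product_entries:
  fixes X Y :: "'i \<Rightarrow> 'i \<Rightarrow> complex"
  assumes "(\<lambda>((p, q), r). norm (X p r) * norm (Y r q)) summable_on UNIV"
  shows "(\<lambda>r. norm (X p r * Y r q)) summable_on UNIV"
    and "(\<lambda>(p, q). \<Sum>\<^sub>\<infinity>r. norm (X p r) * norm (Y r q)) summable_on UNIV"
    and "entry_summable (\<lambda>p q. \<Sum>\<^sub>\<infinity>r. X p r * Y r q)"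
proof -
  have *: "(\<lambda>(z, r). norm (X (fst z) r) * norm (Y r (snd z))) summable_on UNIV"
    using assms by (simp add: case_prod_unfold)
  note rows = summable_rows[OF *]
  show 1: "(\<lambda>r. norm (X p r * Y r q)) summable_on UNIV" for p q
    using rows(1)[of "(p, q)"] by (simp add: norm_mult)
  show 2: "(\<lambda>(p, q). \<Sum>\<^sub>\<infinity>r. norm (X p r) * norm (Y r q)) summable_on UNIV"
    using rows(2) by (simp add: case_prod_unfold)
  show "entry_summable (\<lambda>p q. \<Sum>\<^sub>\<infinity>r. X p r * Y r q)"
    unfolding entry_summable_def
    by (rule summable_on_comparison_test[OF 2])
      (use norm_infsum_bound[OF 1] in \<open>auto simp: norm_mult\<close>)
qed

abbreviation (input) truncation :: "'i set \<Rightarrow> ('i \<Rightarrow> 'i \<Rightarrow> complex) \<Rightarrow> 'i \<Rightarrow> 'i \<Rightarrow> complex" where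
  "truncation F M \<equiv> \<lambda>p q. if p \<in> F \<and> q \<in> F then M p q else 0"

lemma perturbation_det_truncation:
  assumes "finite F"
  shows "perturbation_det (truncation F M) = minor (\<lambda>p q. kron p q + M p q) F"
  using assms by (subst perturbation_det_finite[of F]) (auto intro!: minor_cong)

lemma perturbation_det_truncation_tendsto:
  fixes N :: "'a \<Rightarrow> 'a \<Rightarrow> complex"
  assumes "(\<lambda>(p, q). R p q) summable_on UNIV"
    and "\<And>F p q. finite F \<Longrightarrow> norm (M F p q) \<le> R p q"
    and "\<And>p q. ((\<lambda>F. M F p q) \<longlongrightarrow> N p q) (finite_subsets_at_top UNIV)"
  shows "((\<lambda>F. perturbation_det (truncation F (M F))) \<longlongrightarrow> perturbation_det N) (finite_subsets_at_top UNIV)"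
proof (rule perturbation_det_tendsto[OF assms(1)])
  show nn: "R p q \<ge> 0" for p q using assms(2)[of "{}" p q] norm_ge_zero order_trans by blast
  show "\<forall>\<^sub>F F in finite_subsets_at_top UNIV. \<forall>p q. norm (truncation F (M F) p q) \<le> R p q"
    by (rule eventually_finite_subsets_at_top_weakI) (auto simp: assms(2) nn)
  fix p q :: 'a
  have "\<forall>\<^sub>F F in finite_subsets_at_top UNIV. {p, q} \<subseteq> F"
    unfolding eventually_finite_subsets_at_top by (rule exI[of _ "{p, q}"]) auto
  then have "\<forall>\<^sub>F F in finite_subsets_at_top UNIV. M F p q = truncation F (M F) p q"
    by (rule eventually_mono) auto
  with assms(3) show "((\<lambda>F. truncation F (M F) p q) \<longlongrightarrow> N p q) (finite_subsets_at_top UNIV)"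
    by (rule Lim_transform_eventually)
qed

lemma partial_products_dominated:
  fixes X Y :: "'i \<Rightarrow> 'i \<Rightarrow> complex"
  assumes "(\<lambda>((p, q), r). norm (X p r) * norm (Y r q)) summable_on UNIV"
  shows "finite F \<Longrightarrow> norm (\<Sum>r\<in>F. X p r * Y r q) \<le> (\<Sum>\<^sub>\<infinity>r. norm (X p r) * norm (Y r q))"
    and "((\<lambda>F. \<Sum>r\<in>F. X p r * Y r q) \<longlongrightarrow> (\<Sum>\<^sub>\<infinity>r. X p r * Y r q)) (finite_subsets_at_top UNIV)"
proof -
  note s = summable_product_entries(1)[OF assms, of p q]
  show "norm (\<Sum>r\<in>F. X p r * Y r q) \<le> (\<Sum>\<^sub>\<infinity>r. norm (X p r) * norm (Y r q))" if "finite F"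
    using norm_sum[of "\<lambda>r. X p r * Y r q" F] finite_sum_le_infsum[OF s that] by (simp add: norm_mult)
  show "((\<lambda>F. \<Sum>r\<in>F. X p r * Y r q) \<longlongrightarrow> (\<Sum>\<^sub>\<infinity>r. X p r * Y r q)) (finite_subsets_at_top UNIV)"
    by (rule infsum_tendsto[OF abs_summable_summable[OF s]])
qed

text \<open>For factors truncated to a finite index set this is \<open>minor_sylvester\<close>. The truncated products converge
  entrywise and are dominated by the product of the absolute values.\<close>

lemma perturbation_det_swap:
  assumes "entry_summable X" "schur_bounded Y"
  shows "perturbation_det (\<lambda>p q. \<Sum>\<^sub>\<infinity>r. X p r * Y r q) = perturbation_det (\<lambda>p q. \<Sum>\<^sub>\<infinity>r. Y p r * X r q)"
proof -
  note t1 = summable_product_triple[OF assms] and t2 = summable_product_triple'[OF assms(2,1)]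
  have 1: "((\<lambda>F. perturbation_det (truncation F (\<lambda>p q. \<Sum>r\<in>F. X p r * Y r q))) \<longlongrightarrow>
      perturbation_det (\<lambda>p q. \<Sum>\<^sub>\<infinity>r. X p r * Y r q)) (finite_subsets_at_top UNIV)"
    by (rule perturbation_det_truncation_tendsto[OF summable_product_entries(2)[OF t1]])
       (auto intro!: partial_products_dominated[OF t1])
  have 2: "((\<lambda>F. perturbation_det (truncation F (\<lambda>p q. \<Sum>r\<in>F. Y p r * X r q))) \<longlongrightarrow>
      perturbation_det (\<lambda>p q. \<Sum>\<^sub>\<infinity>r. Y p r * X r q)) (finite_subsets_at_top UNIV)"
    by (rule perturbation_det_truncation_tendsto[OF summable_product_entries(2)[OF t2]])
       (auto intro!: partial_products_dominated[OF t2])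
  have "\<forall>\<^sub>F F in finite_subsets_at_top UNIV.
      perturbation_det (truncation F (\<lambda>p q. \<Sum>r\<in>F. Y p r * X r q)) =
      perturbation_det (truncation F (\<lambda>p q. \<Sum>r\<in>F. X p r * Y r q))"
    by (rule eventually_finite_subsets_at_top_weakI)
       (simp only: perturbation_det_truncation minor_sylvester[where X=Y and Y=X])
  then show ?thesis
    by (intro tendsto_unique[OF finite_subsets_at_top_neq_bot 1 Lim_transform_eventually[OF 2]])
qed

text \<open>\<open>(I + X) (I + Y) = I + (X + Y + X Y)\<close>, and for truncated factors the determinant is multiplicative.\<close>

lemma perturbation_det_mult:
  assumes "entry_summable X" "entry_summable Y"
  shows "perturbation_det (\<lambda>p q. X p q + Y p q + (\<Sum>\<^sub>\<infinity>r. X p r * Y r q)) = perturbation_det X * perturbation_det Y"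
proof -
  note t = summable_product_triple[OF assms(1) entry_summable_imp_schur_bounded[OF assms(2)]]
  have lim: "((\<lambda>F. perturbation_det (truncation F X)) \<longlongrightarrow> perturbation_det X) (finite_subsets_at_top UNIV)"
    if "entry_summable X" for X :: "'a \<Rightarrow> 'a \<Rightarrow> complex"
    using that by (intro perturbation_det_truncation_tendsto[where R="\<lambda>p q. norm (X p q)"])
      (auto simp: entry_summable_def)
  have 1: "((\<lambda>F. perturbation_det (truncation F (\<lambda>p q. X p q + Y p q + (\<Sum>r\<in>F. X p r * Y r q)))) \<longlongrightarrow>
      perturbation_det (\<lambda>p q. X p q + Y p q + (\<Sum>\<^sub>\<infinity>r. X p r * Y r q))) (finite_subsets_at_top UNIV)"
  proof (rule perturbation_det_truncation_tendsto[where R="\<lambda>p q. norm (X p q) + norm (Y p q) + (\<Sum>\<^sub>\<infinity>r. norm (X p r) * norm (Y r q))"])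
    show "(\<lambda>(p, q). norm (X p q) + norm (Y p q) + (\<Sum>\<^sub>\<infinity>r. norm (X p r) * norm (Y r q))) summable_on UNIV"
      using assms summable_product_entries(2)[OF t]
      by (auto simp: entry_summable_def case_prod_unfold intro!: summable_on_add)
    show "norm (X p q + Y p q + (\<Sum>r\<in>F. X p r * Y r q)) \<le> norm (X p q) + norm (Y p q) + (\<Sum>\<^sub>\<infinity>r. norm (X p r) * norm (Y r q))"
      if "finite F" for F p q
      using partial_products_dominated(1)[OF t that, of p q] by norm
    show "((\<lambda>F. X p q + Y p q + (\<Sum>r\<in>F. X p r * Y r q)) \<longlongrightarrow> X p q + Y p q + (\<Sum>\<^sub>\<infinity>r. X p r * Y r q)) (finite_subsets_at_top UNIV)" for p q
      by (intro tendsto_intros partial_products_dominated(2)[OF t])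
  qed
  have "\<forall>\<^sub>F F in finite_subsets_at_top UNIV.
      perturbation_det (truncation F X) * perturbation_det (truncation F Y) =
      perturbation_det (truncation F (\<lambda>p q. X p q + Y p q + (\<Sum>r\<in>F. X p r * Y r q)))"
  proof (rule eventually_finite_subsets_at_top_weakI)
    fix F :: "'a set" assume F: "finite F"
    have "minor (\<lambda>p q. kron p q + (X p q + Y p q + (\<Sum>r\<in>F. X p r * Y r q))) F =
        minor (\<lambda>p q. \<Sum>r\<in>F. (kron p r + X p r) * (kron r q + Y r q)) F"
    proof (rule minor_cong)
      fix p q assume pq: "p \<in> F" "q \<in> F"
      have "(\<Sum>r\<in>F. kron p r * kron r q :: complex) = (\<Sum>r\<in>F. if r = p then kron p q else 0)"
        "(\<Sum>r\<in>F. kron p r * Y r q) = (\<Sum>r\<in>F. if r = p then Y p q else 0)"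
        "(\<Sum>r\<in>F. X p r * kron r q) = (\<Sum>r\<in>F. if r = q then X p q else 0)"
        by (intro sum.cong; auto)+
      then have "(\<Sum>r\<in>F. kron p r * kron r q) = (kron p q :: complex)"
        "(\<Sum>r\<in>F. kron p r * Y r q) = Y p q" "(\<Sum>r\<in>F. X p r * kron r q) = X p q"
        using F pq by simp_all
      then show "kron p q + (X p q + Y p q + (\<Sum>r\<in>F. X p r * Y r q)) = (\<Sum>r\<in>F. (kron p r + X p r) * (kron r q + Y r q))"
        by (simp only: distrib_left distrib_right sum.distrib) simp
    qed
    then show "perturbation_det (truncation F X) * perturbation_det (truncation F Y) =
      perturbation_det (truncation F (\<lambda>p q. X p q + Y p q + (\<Sum>r\<in>F. X p r * Y r q)))"
      using F by (simp only: perturbation_det_truncation minor_mult)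
  qed
  then show ?thesis
    using tendsto_unique[OF finite_subsets_at_top_neq_bot 1 Lim_transform_eventually[OF tendsto_mult[OF lim[OF assms(1)] lim[OF assms(2)]]]]
    by blast
qed

section \<open>The ring of matrices with bounded row and column sums\<close>

lemma schur_bounded_rowsE:
  assumes "schur_bounded M"
  obtains C where "C \<ge> 0" "\<And>p. (\<lambda>q. norm (M p q)) summable_on UNIV"
    "\<And>p. (\<Sum>\<^sub>\<infinity>q. norm (M p q)) \<le> C" "\<And>p q. norm (M p q) \<le> C"
proof -
  obtain C where "schur_bound M C" using assms by (auto simp: schur_bounded_def)
  note C = schur_boundD[OF this]
  show ?thesis by (rule that[of C]) (rule C)+
qed

lemma schur_row_norm_summable:
  assumes "schur_bounded M"
  shows "(\<lambda>q. norm (M p q)) summable_on UNIV"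
  by (rule schur_bounded_rowsE[OF assms]) simp

lemma summable_mult_bounded:
  fixes f x :: "'i \<Rightarrow> complex"
  assumes "(\<lambda>r. norm (f r)) summable_on UNIV" "\<And>r. norm (x r) \<le> b"
  shows "(\<lambda>r. norm (f r * x r)) summable_on UNIV"
proof (rule Infinite_Sum.abs_summable_on_comparison_test')
  show "(\<lambda>r. norm (f r) * b) summable_on UNIV" by (rule summable_on_cmult_left[OF assms(1)])
qed (use assms(2) in \<open>auto simp: norm_mult intro!: mult_left_mono\<close>)

lemma schur_row_summable:
  assumes "schur_bounded A" "\<And>r. norm (x r) \<le> b"
  shows "(\<lambda>r. norm (A p r * x r)) summable_on UNIV"
  by (rule summable_mult_bounded[OF schur_row_norm_summable[OF assms(1)] assms(2)])

text \<open>Fubini's theorem. The bounded family \<open>x\<close> will be a column of a third matrix, which gives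
  associativity, or an element of \<open>ell2\<close>, which identifies products of matrices with compositions.\<close>

lemma schur_apply_apply:
  assumes A: "schur_bounded A" and B: "schur_bounded B" and x: "\<And>r. norm (x r) \<le> b"
  shows "(\<Sum>\<^sub>\<infinity>r. (\<Sum>\<^sub>\<infinity>t. A p t * B t r) * x r) = (\<Sum>\<^sub>\<infinity>t. A p t * (\<Sum>\<^sub>\<infinity>r. B t r * x r))"
proof -
  obtain C where C: "C \<ge> 0" "\<And>p. (\<lambda>q. norm (B p q)) summable_on UNIV" "\<And>p. (\<Sum>\<^sub>\<infinity>q. norm (B p q)) \<le> C"
    "\<And>p q. norm (B p q) \<le> C"
    by (rule schur_bounded_rowsE[OF B], rule that)
  have rowA: "(\<lambda>q. norm (A p q)) summable_on UNIV" by (rule schur_row_norm_summable[OF A])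
  have s: "(\<lambda>(t, r). norm (A p t) * norm (B t r)) summable_on UNIV \<times> UNIV"
  proof (rule summable_on_SigmaI)
    show "((\<lambda>r. case (t, r) of (t, r) \<Rightarrow> norm (A p t) * norm (B t r)) has_sum norm (A p t) * (\<Sum>\<^sub>\<infinity>r. norm (B t r))) UNIV" for t
      using C(2) by (auto intro!: has_sum_cmult_right has_sum_infsum)
    have "(\<lambda>t. norm (A p t) * C) summable_on UNIV" by (rule summable_on_cmult_left[OF rowA])
    then show "(\<lambda>t. norm (A p t) * (\<Sum>\<^sub>\<infinity>r. norm (B t r))) summable_on UNIV"
      by (rule summable_on_comparison_test) (auto intro!: mult_left_mono C mult_nonneg_nonneg infsum_nonneg)
  qed auto
  have "(\<lambda>(t, r). norm (A p t * B t r * x r)) summable_on UNIV \<times> UNIV"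
  proof -
    have "(\<lambda>z. (case z of (t, r) \<Rightarrow> norm (A p t) * norm (B t r)) * b) summable_on UNIV \<times> UNIV"
      by (rule summable_on_cmult_left[OF s])
    then show ?thesis
      by (rule summable_on_comparison_test) (auto simp: norm_mult intro!: mult_left_mono x)
  qed
  then have s': "(\<lambda>(t, r). A p t * B t r * x r) summable_on UNIV \<times> UNIV"
    using abs_summable_summable[of "\<lambda>(t, r). A p t * B t r * x r"] by (simp add: case_prod_unfold)
  have "(\<Sum>\<^sub>\<infinity>t. A p t * (\<Sum>\<^sub>\<infinity>r. B t r * x r)) = (\<Sum>\<^sub>\<infinity>t. \<Sum>\<^sub>\<infinity>r. A p t * B t r * x r)"
    by (simp add: infsum_cmult_right' mult.assoc)
  also have "\<dots> = (\<Sum>\<^sub>\<infinity>r. \<Sum>\<^sub>\<infinity>t. A p t * B t r * x r)"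
    by (rule infsum_swap_banach[OF s'])
  also have "\<dots> = (\<Sum>\<^sub>\<infinity>r. (\<Sum>\<^sub>\<infinity>t. A p t * B t r) * x r)"
    by (simp add: infsum_cmult_left')
  finally show ?thesis ..
qed

lemma schur_bounded_kron: "schur_bounded kron"
proof -
  have "(\<Sum>q\<in>F. norm (kron p q)) \<le> 1 \<and> (\<Sum>q\<in>F. norm (kron q p)) \<le> 1" if "finite F" for p :: 'a and F
  proof -
    have "(\<Sum>q\<in>F. norm (kron p q)) = (\<Sum>q\<in>F. if q = p then 1 else 0)"
      "(\<Sum>q\<in>F. norm (kron q p)) = (\<Sum>q\<in>F. if q = p then 1 else 0)"
      by (intro sum.cong; auto)+
    then show ?thesis using that by simp
  qed
  then show ?thesis unfolding schur_bounded_iff by blast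
qed

lemma schur_bounded_add:
  assumes "schur_bounded A" "schur_bounded B"
  shows "schur_bounded (\<lambda>p q. A p q + B p q)"
proof -
  obtain C D where CD: "\<And>p F. finite F \<Longrightarrow> (\<Sum>q\<in>F. norm (A p q)) \<le> C \<and> (\<Sum>q\<in>F. norm (A q p)) \<le> C"
    "\<And>p F. finite F \<Longrightarrow> (\<Sum>q\<in>F. norm (B p q)) \<le> D \<and> (\<Sum>q\<in>F. norm (B q p)) \<le> D"
    using assms unfolding schur_bounded_iff by blast
  have "(\<Sum>q\<in>F. norm (A p q + B p q)) \<le> C + D \<and> (\<Sum>q\<in>F. norm (A q p + B q p)) \<le> C + D"
    if "finite F" for p F
  proof -
    have "(\<Sum>q\<in>F. norm (A p q + B p q)) \<le> (\<Sum>q\<in>F. norm (A p q)) + (\<Sum>q\<in>F. norm (B p q))"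
      "(\<Sum>q\<in>F. norm (A q p + B q p)) \<le> (\<Sum>q\<in>F. norm (A q p)) + (\<Sum>q\<in>F. norm (B q p))"
      unfolding sum.distrib[symmetric] by (intro sum_mono norm_triangle_ineq)+
    then show ?thesis using CD[OF that, of p] by linarith
  qed
  then show ?thesis unfolding schur_bounded_iff by blast
qed

lemma schur_bounded_scale:
  assumes "schur_bounded A"
  shows "schur_bounded (\<lambda>p q. c * A p q)"
proof -
  obtain C where C: "\<And>p F. finite F \<Longrightarrow> (\<Sum>q\<in>F. norm (A p q)) \<le> C \<and> (\<Sum>q\<in>F. norm (A q p)) \<le> C"
    using assms unfolding schur_bounded_iff by blast
  then have "(\<Sum>q\<in>F. norm (c * A p q)) \<le> norm c * C \<and> (\<Sum>q\<in>F. norm (c * A q p)) \<le> norm c * C"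
    if "finite F" for p F
    using that by (auto simp: norm_mult sum_distrib_left[symmetric] intro!: mult_left_mono)
  then show ?thesis unfolding schur_bounded_iff by blast
qed

lemma product_row_sum_le:
  fixes f g :: "'a \<Rightarrow> 'a \<Rightarrow> complex"
  assumes F: "finite F" and f: "\<And>p. (\<lambda>r. norm (f p r)) summable_on UNIV" "\<And>p. (\<Sum>\<^sub>\<infinity>r. norm (f p r)) \<le> c"
    and g: "\<And>r. (\<lambda>q. norm (g r q)) summable_on UNIV" "\<And>r. (\<Sum>\<^sub>\<infinity>q. norm (g r q)) \<le> d" and d: "d \<ge> 0"
  shows "(\<Sum>q\<in>F. norm (\<Sum>\<^sub>\<infinity>r. f p r * g r q)) \<le> c * d"
proof -
  have gb: "norm (g r q) \<le> d" for r q
    using finite_sum_le_infsum[OF g(1)[of r], of "{q}"] g(2)[of r] by simp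
  have s: "(\<lambda>r. norm (f p r * g r q)) summable_on UNIV" for q
    by (rule summable_mult_bounded[OF f(1) gb])
  have "(\<Sum>q\<in>F. norm (\<Sum>\<^sub>\<infinity>r. f p r * g r q)) \<le> (\<Sum>q\<in>F. \<Sum>\<^sub>\<infinity>r. norm (f p r * g r q))"
    by (intro sum_mono norm_infsum_bound s)
  also have "\<dots> = (\<Sum>\<^sub>\<infinity>r. \<Sum>q\<in>F. norm (f p r * g r q))"
    by (rule infsumI[OF has_sum_finite_sum[OF F has_sum_infsum[OF s]], symmetric])
  also have "\<dots> \<le> (\<Sum>\<^sub>\<infinity>r. norm (f p r) * d)"
  proof (rule infsum_mono)
    show "(\<lambda>r. \<Sum>q\<in>F. norm (f p r * g r q)) summable_on UNIV"
      by (rule has_sum_imp_summable[OF has_sum_finite_sum[OF F has_sum_infsum[OF s]]])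
    show "(\<lambda>r. norm (f p r) * d) summable_on UNIV" by (rule summable_on_cmult_left[OF f(1)])
    fix r
    have "(\<Sum>q\<in>F. norm (g r q)) \<le> d"
      using finite_sum_le_infsum[OF g(1) F, of r] g(2)[of r] by simp
    then show "(\<Sum>q\<in>F. norm (f p r * g r q)) \<le> norm (f p r) * d"
      by (simp add: norm_mult sum_distrib_left[symmetric] mult_left_mono)
  qed
  also have "\<dots> = (\<Sum>\<^sub>\<infinity>r. norm (f p r)) * d" by (rule infsum_cmult_left[OF f(1)])
  also have "\<dots> \<le> c * d" using f(2) d by (intro mult_right_mono)
  finally show ?thesis .
qed

lemma schur_bound_mult:
  assumes "schur_bound A C"  "schur_bound B D"
  shows "schur_bound (\<lambda>p q. \<Sum>\<^sub>\<infinity>r. A p r * B r q) (C * D)"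
proof -
  note A = schur_boundD[OF assms(1)] and B = schur_boundD[OF assms(2)]
  show ?thesis
    unfolding schur_bound_def
  proof (intro allI impI conjI)
    fix p and F :: "'a set" assume F: "finite F"
    show "(\<Sum>q\<in>F. norm (\<Sum>\<^sub>\<infinity>r. A p r * B r q)) \<le> C * D"
      by (rule product_row_sum_le[OF F A(2,3) B(2,3,1)])
    have "(\<Sum>q\<in>F. norm (\<Sum>\<^sub>\<infinity>r. B r p * A q r)) \<le> D * C"
      by (rule product_row_sum_le[OF F B(4,5) A(4,5,1)])
    then show "(\<Sum>q\<in>F. norm (\<Sum>\<^sub>\<infinity>r. A q r * B r p)) \<le> C * D"
      by (simp add: mult.commute)
  qed
qed

lemma schur_bounded_mult:
  "schur_bounded A \<Longrightarrow> schur_bounded B \<Longrightarrow> schur_bounded (\<lambda>p q. \<Sum>\<^sub>\<infinity>r. A p r * B r q)"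
  unfolding schur_bounded_def using schur_bound_mult by blast

text \<open>With a type of its own the ring structure becomes an instance of a type class, and identities between
  operators reduce to noncommutative algebra.\<close>

typedef 'i schur_matrix = "{M :: 'i \<Rightarrow> 'i \<Rightarrow> complex. schur_bounded M}"
  morphisms entry Schur_Matrix
  using schur_bounded_kron by blast

lemma schur_bounded_entry: "schur_bounded (entry A)"
  using entry[of A] by simp

lemma schur_matrix_eqI: "(\<And>p q. entry A p q = entry B p q) \<Longrightarrow> A = B"
  by (simp add: entry_inject[symmetric] fun_eq_iff)

lemma entry_Schur_Matrix: "schur_bounded M \<Longrightarrow> entry (Schur_Matrix M) = M"
  by (simp add: Schur_Matrix_inverse)

lemma entry_bounded: "\<exists>C. \<forall>p q. norm (entry A p q) \<le> C"
proof (rule schur_bounded_rowsE[OF schur_bounded_entry[of A]])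
  fix C assume "\<And>p q. norm (entry A p q) \<le> C"
  then show ?thesis by blast
qed

definition smul :: "complex \<Rightarrow> 'i schur_matrix \<Rightarrow> 'i schur_matrix" where
  "smul c A = Schur_Matrix (\<lambda>p q. c * entry A p q)"

lemma entry_smul [simp]: "entry (smul c A) p q = c * entry A p q"
  by (simp add: smul_def entry_Schur_Matrix schur_bounded_scale schur_bounded_entry)

instantiation schur_matrix :: (type) ring_1
begin

definition "0 = Schur_Matrix (\<lambda>p q. 0)"
definition "1 = Schur_Matrix kron"
definition "A + B = Schur_Matrix (\<lambda>p q. entry A p q + entry B p q)"
definition "- A = smul (- 1) A" for A :: "'a schur_matrix"
definition "A - B = A + smul (- 1) B" for A B :: "'a schur_matrix"
definition "A * B = Schur_Matrix (\<lambda>p q. \<Sum>\<^sub>\<infinity>r. entry A p r * entry B r q)"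

lemma entry_simps:
  "entry (0 :: 'a schur_matrix) p q = 0"
  "entry (1 :: 'a schur_matrix) p q = kron p q"
  "entry (A + B) p q = entry A p q + entry B p q"
  "entry (- A) p q = - entry A p q"
  "entry (A - B) p q = entry A p q - entry B p q"
proof -
  have "schur_bounded (\<lambda>p q :: 'a. 0)"
    using schur_bounded_scale[OF schur_bounded_kron, of 0] by simp
  then show "entry (0 :: 'a schur_matrix) p q = 0" "entry (1 :: 'a schur_matrix) p q = kron p q"
    by (simp_all add: zero_schur_matrix_def one_schur_matrix_def entry_Schur_Matrix schur_bounded_kron)
  show *: "entry (A + B) p q = entry A p q + entry B p q" for B
    by (simp add: plus_schur_matrix_def entry_Schur_Matrix schur_bounded_entry schur_bounded_add)
  show "entry (- A) p q = - entry A p q" "entry (A - B) p q = entry A p q - entry B p q"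
    by (simp_all add: uminus_schur_matrix_def minus_schur_matrix_def *)
qed

lemma entry_mult: "entry (A * B) p q = (\<Sum>\<^sub>\<infinity>r. entry A p r * entry B r q)"
  by (simp add: times_schur_matrix_def entry_Schur_Matrix schur_bounded_entry schur_bounded_mult)

instance
proof
  fix A B C :: "'a schur_matrix"
  have sA: "(\<lambda>r. entry A p r * entry B r q) summable_on UNIV" for A B :: "'a schur_matrix" and p q
  proof -
    obtain b where "\<And>r. norm (entry B r q) \<le> b" using entry_bounded[of B] by blast
    from abs_summable_summable[OF schur_row_summable[OF schur_bounded_entry this]]
    show ?thesis .
  qed
  show "A * B * C = A * (B * C)"
  proof (rule schur_matrix_eqI)
    fix p q
    obtain b where "\<And>r. norm (entry C r q) \<le> b" using entry_bounded[of C] by blast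
    from schur_apply_apply[OF schur_bounded_entry schur_bounded_entry this]
    show "entry (A * B * C) p q = entry (A * (B * C)) p q" by (simp add: entry_mult)
  qed
  have k: "(\<Sum>\<^sub>\<infinity>r. kron p r * f r) = f p" "(\<Sum>\<^sub>\<infinity>r. f r * kron r p) = f p" for p :: 'a and f
  proof -
    have "(\<Sum>\<^sub>\<infinity>r. kron p r * f r) = (\<Sum>\<^sub>\<infinity>r\<in>{p}. f r)" "(\<Sum>\<^sub>\<infinity>r. f r * kron r p) = (\<Sum>\<^sub>\<infinity>r\<in>{p}. f r)"
      by (rule infsum_cong_neutral; auto)+
    then show "(\<Sum>\<^sub>\<infinity>r. kron p r * f r) = f p" "(\<Sum>\<^sub>\<infinity>r. f r * kron r p) = f p" by auto
  qed
  show "1 * A = A" "A * 1 = A"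
    by (rule schur_matrix_eqI, simp only: entry_mult entry_simps k)+
  show "(A + B) * C = A * C + B * C" "A * (B + C) = A * B + A * C"
    by (rule schur_matrix_eqI, simp add: entry_mult entry_simps distrib_left distrib_right infsum_add sA)+
  show "(0 :: 'a schur_matrix) \<noteq> 1"
  proof
    assume "(0 :: 'a schur_matrix) = 1"
    then have "entry (0 :: 'a schur_matrix) undefined undefined = entry 1 undefined undefined" by simp
    then show False by (simp add: entry_simps)
  qed
qed (rule schur_matrix_eqI, simp add: entry_simps)+

end

lemma smul_mult_left [simp]: "smul c A * B = smul c (A * B)"
  by (rule schur_matrix_eqI) (simp add: entry_mult mult.assoc infsum_cmult_right')

lemma smul_mult_right [simp]: "A * smul c B = smul c (A * B)"
  by (rule schur_matrix_eqI) (simp add: entry_mult mult.left_commute infsum_cmult_right')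

lemma smul_simps:
  "smul c (A + B) = smul c A + smul c B" "smul (c + d) A = smul c A + smul d A"
  "smul c (A - B) = smul c A - smul c B" "smul (c - d) A = smul c A - smul d A"
  "smul c (smul d A) = smul (c * d) A" "smul 1 A = A" "smul (- c) A = - smul c A"
  by (rule schur_matrix_eqI, simp add: entry_simps algebra_simps)+

lemma smul_minus: "smul c (- A) = - smul c A"
  by (rule schur_matrix_eqI) (simp add: entry_simps)

section \<open>Pairs of idempotents with nuclear difference\<close>

definition nuclear :: "'i schur_matrix \<Rightarrow> bool" where
  "nuclear A \<longleftrightarrow> entry_summable (entry A)"

definition schur_det :: "'i schur_matrix \<Rightarrow> complex" where
  "schur_det A = perturbation_det (entry (A - 1))"

definition schur_trace :: "'i schur_matrix \<Rightarrow> complex" where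
  "schur_trace A = (\<Sum>\<^sub>\<infinity>r. entry A r r)"

lemma nuclear_add:
  assumes "nuclear A" "nuclear B"
  shows "nuclear (A + B)"
proof -
  have "(\<lambda>z. (case z of (p, q) \<Rightarrow> norm (entry A p q)) + (case z of (p, q) \<Rightarrow> norm (entry B p q))) summable_on UNIV"
    using assms unfolding nuclear_def entry_summable_def by (rule summable_on_add)
  then show ?thesis
    unfolding nuclear_def entry_summable_def
    by (rule summable_on_comparison_test) (auto simp: entry_simps norm_triangle_ineq)
qed

lemma nuclear_smul:
  assumes "nuclear A"
  shows "nuclear (smul c A)"
  using summable_on_cmult_right[OF assms[unfolded nuclear_def entry_summable_def], of "norm c"]
  by (simp add: nuclear_def entry_summable_def norm_mult case_prod_unfold)

lemma nuclear_mult_left: "nuclear A \<Longrightarrow> nuclear (A * B)"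
  using summable_product_entries(3)[OF summable_product_triple[OF _ schur_bounded_entry[of B]]]
  by (simp add: nuclear_def entry_mult[abs_def])

lemma nuclear_mult_right: "nuclear B \<Longrightarrow> nuclear (A * B)"
  using summable_product_entries(3)[OF summable_product_triple'[OF schur_bounded_entry[of A]]]
  by (simp add: nuclear_def entry_mult[abs_def])

lemma schur_det_mult:
  assumes "nuclear (A - 1)" "nuclear (B - 1)"
  shows "schur_det (A * B) = schur_det A * schur_det B"
proof -
  have *: "A * B - 1 = (A - 1) + (B - 1) + (A - 1) * (B - 1)"
    by (simp add: algebra_simps)
  have "entry (A * B - 1) = (\<lambda>p q. entry (A - 1) p q + entry (B - 1) p q + (\<Sum>\<^sub>\<infinity>r. entry (A - 1) p r * entry (B - 1) r q))"
    unfolding * by (intro ext) (simp only: entry_simps(3) entry_mult)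
  then show ?thesis
    unfolding schur_det_def
    by (simp only: perturbation_det_mult[OF assms[unfolded nuclear_def]])
qed

lemma schur_det_swap:
  assumes "nuclear X"
  shows "schur_det (1 + X * Y) = schur_det (1 + Y * X)"
  using perturbation_det_swap[OF assms[unfolded nuclear_def] schur_bounded_entry[of Y]]
  by (simp add: schur_det_def entry_mult[abs_def])

text \<open>\<open>U A V = I + U ((A - I) V)\<close>, and moving the factor \<open>U\<close> to the right turns the perturbation into
  \<open>(A - I) V U = A - I\<close>.\<close>

lemma schur_det_conjugate:
  assumes "U * V = 1" "V * U = 1" "nuclear (A - 1)"
  shows "schur_det (U * A * V) = schur_det A"
proof -
  have "schur_det (1 + U * ((A - 1) * V)) = schur_det (1 + (A - 1) * V * U)"
    by (rule schur_det_swap[OF nuclear_mult_left[OF assms(3)], symmetric])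
  moreover have "U * A * V = 1 + U * ((A - 1) * V)"
    using assms(1) by (simp add: algebra_simps)
  ultimately show ?thesis using assms(2) by (simp add: mult.assoc)
qed

lemma minor_scale: "minor (\<lambda>p q. z * M p q) S = z ^ card S * minor M S"
  by (simp add: minor_def prod.distrib sum_distrib_left mult_ac)

text \<open>In the expansion into minors an index set of size \<open>m\<close> carries the factor \<open>z\<^sup>m\<close>. After division by \<open>z\<close> only the
  sets of size one survive in the limit, and their minors are the diagonal entries.\<close>

lemma perturbation_det_derivative:
  assumes R: "(\<lambda>(p, q). R p q) summable_on UNIV"
    and bound: "\<forall>\<^sub>F t in G. \<forall>p q. norm (M t p q) \<le> R p q"
    and nn: "\<And>p q. R p q \<ge> 0"
    and lim: "\<And>p q. ((\<lambda>t. M t p q) \<longlongrightarrow> N p q) G"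
    and z: "(z \<longlongrightarrow> 0) G" "\<forall>\<^sub>F t in G. z t \<noteq> 0"
  shows "((\<lambda>t. (perturbation_det (\<lambda>p q. z t * M t p q) - 1) / z t) \<longlongrightarrow> (\<Sum>\<^sub>\<infinity>r. N r r)) G"
proof -
  let ?X = "{S. finite S} - {{}} :: 'a set set"
  let ?\<rho> = "\<lambda>S. \<Prod>p\<in>S. \<Sum>\<^sub>\<infinity>q. R p q"
  have \<rho>: "?\<rho> summable_on {S. finite S}"
    using R nn summable_rows(2)[of R] by (intro summable_on_prod_finite_sets) (auto intro!: infsum_nonneg)
  have card: "card S = 1 \<or> card S - 1 \<ge> 1" if "S \<in> ?X" for S
  proof -
    have "card S \<noteq> 0" using that by auto
    then show ?thesis by linarith
  qed
  have z1: "\<forall>\<^sub>F t in G. norm (z t) < 1"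
    using order_tendstoD(2)[OF tendsto_norm[OF z(1)], of 1] by simp
  have "((\<lambda>t. \<Sum>\<^sub>\<infinity>S\<in>?X. z t ^ (card S - 1) * minor (M t) S) \<longlongrightarrow>
      (\<Sum>\<^sub>\<infinity>S\<in>?X. if card S = 1 then minor N S else 0)) G"
  proof (rule tendsto_infsum_dominated)
    show "?\<rho> summable_on ?X" using \<rho> by (rule summable_on_subset_banach) auto
    show "\<forall>\<^sub>F t in G. \<forall>S\<in>?X. norm (z t ^ (card S - 1) * minor (M t) S) \<le> ?\<rho> S"
      using bound z1
    proof eventually_elim
      case (elim t)
      show ?case
      proof
        fix S assume S: "S \<in> ?X"
        have "norm (z t ^ (card S - 1)) \<le> 1"
          using elim(2) by (simp add: norm_power power_le_one)
        moreover have "norm (minor (M t) S) \<le> ?\<rho> S"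
          using elim(1) S by (intro minor_norm_le_row_sums R) auto
        ultimately show "norm (z t ^ (card S - 1) * minor (M t) S) \<le> ?\<rho> S"
          unfolding norm_mult by (metis mult_mono mult_1 norm_ge_zero zero_le_one)
      qed
    qed
    fix S assume S: "S \<in> ?X"
    have "((\<lambda>t. z t ^ (card S - 1)) \<longlongrightarrow> (if card S = 1 then 1 else 0)) G"
    proof (cases "card S = 1")
      case False
      then have "card S - 1 \<noteq> 0" using card[OF S] by auto
      then show ?thesis using tendsto_power[OF z(1), of "card S - 1"] False by (simp add: zero_power)
    qed simp
    from tendsto_mult[OF this minor_tendsto[of S M N G]] lim
    show "((\<lambda>t. z t ^ (card S - 1) * minor (M t) S) \<longlongrightarrow> (if card S = 1 then minor N S else 0)) G"
      by (simp split: if_splits)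
  qed
  moreover have "(\<Sum>\<^sub>\<infinity>S\<in>?X. if card S = 1 then minor N S else 0) = (\<Sum>\<^sub>\<infinity>S\<in>range (\<lambda>r. {r}). minor N S)"
    by (rule infsum_cong_neutral) (auto simp: card_1_singleton_iff)
  moreover have "\<dots> = (\<Sum>\<^sub>\<infinity>r. N r r)"
    by (subst infsum_reindex) (auto simp: o_def inj_on_def)
  moreover have "\<forall>\<^sub>F t in G. (\<Sum>\<^sub>\<infinity>S\<in>?X. z t ^ (card S - 1) * minor (M t) S) =
      (perturbation_det (\<lambda>p q. z t * M t p q) - 1) / z t"
    using bound z(2)
  proof eventually_elim
    case (elim t)
    have "(\<lambda>S. norm (minor (\<lambda>p q. z t * M t p q) S)) summable_on {S. finite S}"
    proof (rule minor_abs_summable)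
      have "(\<lambda>z'. norm (z t) * (case z' of (p, q) \<Rightarrow> R p q)) summable_on UNIV"
        by (rule summable_on_cmult_right[OF R])
      then show "entry_summable (\<lambda>p q. z t * M t p q)"
        unfolding entry_summable_def
        by (rule summable_on_comparison_test) (use elim(1) in \<open>auto simp: norm_mult intro!: mult_left_mono\<close>)
    qed
    then have s: "minor (\<lambda>p q. z t * M t p q) summable_on {S. finite S}"
      by (rule abs_summable_summable)
    then have sX: "minor (\<lambda>p q. z t * M t p q) summable_on ?X"
      by (rule summable_on_subset_banach) auto
    have "perturbation_det (\<lambda>p q. z t * M t p q) = infsum (minor (\<lambda>p q. z t * M t p q)) (insert {} ?X)"
      unfolding perturbation_det_def by (rule infsum_cong_neutral) auto
    also have "\<dots> = 1 + infsum (minor (\<lambda>p q. z t * M t p q)) ?X"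
      using sX by (subst infsum_insert) auto
    also have "infsum (minor (\<lambda>p q. z t * M t p q)) ?X = (\<Sum>\<^sub>\<infinity>S\<in>?X. z t * (z t ^ (card S - 1) * minor (M t) S))"
    proof (rule infsum_cong)
      fix S assume "S \<in> ?X"
      then have "card S = Suc (card S - 1)" using card[of S] by auto
      then have "z t ^ card S = z t * z t ^ (card S - 1)" by (metis power_Suc)
      then show "minor (\<lambda>p q. z t * M t p q) S = z t * (z t ^ (card S - 1) * minor (M t) S)"
        by (simp add: minor_scale)
    qed
    also have "\<dots> = z t * (\<Sum>\<^sub>\<infinity>S\<in>?X. z t ^ (card S - 1) * minor (M t) S)"
      by (rule infsum_cmult_right')
    finally show ?case using elim(2) by simp
  qed
  ultimately show ?thesis by (auto intro: Lim_transform_eventually)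
qed

text \<open>For an idempotent \<open>p\<close> this is multiplication by \<open>u\<close> on the range of \<open>p\<close> and the identity on its kernel. Its
  inverse is \<open>dilate p (1 / u)\<close> if \<open>u \<noteq> 0\<close>.\<close>

definition dilate :: "'i schur_matrix \<Rightarrow> complex \<Rightarrow> 'i schur_matrix" where
  "dilate p u = 1 + smul (u - 1) p"

lemma dilate_mult: "p * p = p \<Longrightarrow> dilate p u * dilate p v = dilate p (u * v)"
proof -
  assume "p * p = p"
  then have "dilate p u * dilate p v = 1 + smul ((u - 1) + (v - 1) + (u - 1) * (v - 1)) p"
    by (simp add: dilate_def algebra_simps smul_simps)
  also have "(u - 1) + (v - 1) + (u - 1) * (v - 1) = u * v - 1" by (simp add: algebra_simps)
  finally show ?thesis by (simp add: dilate_def)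
qed

lemma dilate_one [simp]: "dilate p 1 = 1"
proof -
  have "smul 0 p = 0" by (rule schur_matrix_eqI) (simp add: entry_simps)
  then show ?thesis by (simp add: dilate_def)
qed

locale nuclear_pair =
  fixes p q :: "'i schur_matrix"
  assumes idem: "p * p = p" "q * q = q" and nuclear: "nuclear (p - q)"
begin

definition ratio_det :: "complex \<Rightarrow> complex" where
  "ratio_det u = schur_det (dilate p u * dilate q (1 / u))"

text \<open>Since \<open>dilate q u\<close> and \<open>dilate q (1 / u)\<close> are inverse to each other, subtracting 1 amounts to replacing
  \<open>dilate p u\<close> by \<open>dilate p u - dilate q u = (u - 1) (p - q)\<close>. This exhibits both nuclearity and the behaviour
  near \<open>u = 1\<close>.\<close>

lemma ratio_minus_one:
  assumes "u \<noteq> 0"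
  shows "dilate p u * dilate q (1 / u) - 1 = smul (u - 1) ((p - q) * (1 - q) + smul (1 / u) ((p - q) * q))"
proof -
  have 1: "dilate q u * dilate q (1 / u) = 1" using assms by (simp add: dilate_mult idem)
  have 2: "dilate p u - dilate q u = smul (u - 1) (p - q)"
    by (simp add: dilate_def smul_simps)
  have 3: "dilate q (1 / u) = (1 - q) + smul (1 / u) q"
    by (simp add: dilate_def smul_simps algebra_simps)
  have "dilate p u * dilate q (1 / u) - 1 = (dilate p u - dilate q u) * dilate q (1 / u)"
    unfolding left_diff_distrib 1 ..
  also have "\<dots> = smul (u - 1) ((p - q) * ((1 - q) + smul (1 / u) q))"
    unfolding 2 3 by simp
  finally show ?thesis by (simp only: distrib_left smul_mult_right)
qed

lemma nuclear_ratio: "u \<noteq> 0 \<Longrightarrow> nuclear (dilate p u * dilate q (1 / u) - 1)"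
  unfolding ratio_minus_one by (intro nuclear_smul nuclear_add nuclear_mult_left nuclear)

text \<open>The quotient for \<open>u v\<close> is the quotient for \<open>v\<close>, conjugated by \<open>dilate p u\<close>, times the quotient for \<open>u\<close>.\<close>

lemma ratio_det_mult:
  assumes "u \<noteq> 0" "v \<noteq> 0"
  shows "ratio_det (u * v) = ratio_det u * ratio_det v"
proof -
  let ?W = "dilate p v * dilate q (1 / v)"
  have "dilate p (u * v) * dilate q (1 / (u * v)) = dilate p u * ?W * dilate q (1 / u)"
  proof -
    have "dilate p (u * v) = dilate p u * dilate p v" "dilate q (1 / (u * v)) = dilate q (1 / v) * dilate q (1 / u)"
      by (simp_all add: dilate_mult idem mult.commute)
    then show ?thesis by (simp only: mult.assoc)
  qed
  also have "\<dots> = (dilate p u * ?W * dilate p (1 / u)) * (dilate p u * dilate q (1 / u))"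
  proof -
    have "dilate p (1 / u) * dilate p u = 1" using assms by (simp add: dilate_mult idem)
    then have "dilate p (1 / u) * (dilate p u * dilate q (1 / u)) = dilate q (1 / u)"
      by (simp add: mult.assoc[symmetric])
    then show ?thesis by (simp add: mult.assoc)
  qed
  finally have eq: "dilate p (u * v) * dilate q (1 / (u * v)) =
     (dilate p u * ?W * dilate p (1 / u)) * (dilate p u * dilate q (1 / u))" .
  have inv: "dilate p u * dilate p (1 / u) = 1" "dilate p (1 / u) * dilate p u = 1"
    using assms by (simp_all add: dilate_mult idem)
  have "dilate p u * ?W * dilate p (1 / u) - 1 = dilate p u * ((?W - 1) * dilate p (1 / u))"
    using inv by (simp add: algebra_simps)
  then have "nuclear (dilate p u * ?W * dilate p (1 / u) - 1)"
    using assms nuclear_ratio by (simp add: nuclear_mult_left nuclear_mult_right)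
  then have "ratio_det (u * v) = schur_det (dilate p u * ?W * dilate p (1 / u)) * ratio_det u"
    unfolding ratio_det_def eq by (intro schur_det_mult nuclear_ratio assms)
  also have "schur_det (dilate p u * ?W * dilate p (1 / u)) = ratio_det v"
    unfolding ratio_det_def by (intro schur_det_conjugate inv nuclear_ratio assms)
  finally show ?thesis by simp
qed

lemma ratio_det_one [simp]: "ratio_det 1 = 1"
proof -
  have "entry (0 :: 'i schur_matrix) = (\<lambda>p q. 0)" by (intro ext) (simp add: entry_simps)
  then show ?thesis
    by (simp add: ratio_det_def schur_det_def perturbation_det_finite[of "{}"])
qed

lemma ratio_det_derivative_one: "(ratio_det has_field_derivative schur_trace (p - q)) (at 1)"
proof -
  define E G where "E = (p - q) * (1 - q)" and "G = (p - q) * q"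
  have EG: "nuclear E" "nuclear G" unfolding E_def G_def by (intro nuclear_mult_left nuclear)+
  have "((\<lambda>u. (perturbation_det (\<lambda>p q. (u - 1) * (entry E p q + (1 / u) * entry G p q)) - 1) / (u - 1)) \<longlongrightarrow>
      (\<Sum>\<^sub>\<infinity>r. entry E r r + entry G r r)) (at 1)"
  proof (rule perturbation_det_derivative[where R="\<lambda>p q. norm (entry E p q) + 2 * norm (entry G p q)"
        and M="\<lambda>u p q. entry E p q + (1 / u) * entry G p q" and z="\<lambda>u. u - 1"
        and N="\<lambda>p q. entry E p q + entry G p q"])
    show "(\<lambda>(p, q). norm (entry E p q) + 2 * norm (entry G p q)) summable_on UNIV"
      using EG unfolding nuclear_def entry_summable_def
      by (auto simp: case_prod_unfold intro!: summable_on_add summable_on_cmult_right)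
    (* The constant 2 in the majorant is any bound for |1 / u| near u = 1. *)
    have "((\<lambda>u :: complex. norm (1 / u)) \<longlongrightarrow> 1) (at 1)"
      by (auto intro!: tendsto_eq_intros)
    then have "\<forall>\<^sub>F u :: complex in at 1. norm (1 / u) < 2"
      by (rule order_tendstoD) simp
    then show "\<forall>\<^sub>F u in at 1. \<forall>p q. norm (entry E p q + (1 / u) * entry G p q) \<le> norm (entry E p q) + 2 * norm (entry G p q)"
    proof (rule eventually_mono, intro allI)
      fix u :: complex and p q assume u: "norm (1 / u) < 2"
      have "norm (entry E p q + (1 / u) * entry G p q) \<le> norm (entry E p q) + norm (1 / u) * norm (entry G p q)"
        by (metis norm_mult norm_triangle_ineq)
      also have "\<dots> \<le> norm (entry E p q) + 2 * norm (entry G p q)"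
        using u by (intro add_left_mono mult_right_mono) auto
      finally show "norm (entry E p q + (1 / u) * entry G p q) \<le> norm (entry E p q) + 2 * norm (entry G p q)" .
    qed
    show "((\<lambda>u. entry E p q + (1 / u) * entry G p q) \<longlongrightarrow> entry E p q + entry G p q) (at 1)" for p q
      by (auto intro!: tendsto_eq_intros)
    show "((\<lambda>u. u - 1 :: complex) \<longlongrightarrow> 0) (at 1)"
      by (auto intro!: tendsto_eq_intros)
    show "\<forall>\<^sub>F u in at 1. u - 1 \<noteq> (0 :: complex)"
      by (auto simp: eventually_at_filter)
  qed auto
  moreover have "(\<Sum>\<^sub>\<infinity>r. entry E r r + entry G r r) = schur_trace (p - q)"
  proof -
    have "E + G = p - q" unfolding E_def G_def by (simp add: algebra_simps)
    then show ?thesis unfolding schur_trace_def by (metis entry_simps(3))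
  qed
  moreover have "\<forall>\<^sub>F u in at 1. (perturbation_det (\<lambda>p q. (u - 1) * (entry E p q + (1 / u) * entry G p q)) - 1) / (u - 1) =
      (ratio_det u - ratio_det 1) / (u - 1)"
  proof -
    have "\<forall>\<^sub>F u in at 1. u \<noteq> (0 :: complex)" by (rule eventually_neq_at_within)
    then show ?thesis
    proof (rule eventually_mono)
      fix u :: complex assume u: "u \<noteq> 0"
      have "entry (dilate p u * dilate q (1 / u) - 1) = (\<lambda>p q. (u - 1) * (entry E p q + (1 / u) * entry G p q))"
        unfolding ratio_minus_one[OF u] E_def[symmetric] G_def[symmetric]
        by (intro ext) (simp only: entry_smul entry_simps(3))
      then show "(perturbation_det (\<lambda>p q. (u - 1) * (entry E p q + (1 / u) * entry G p q)) - 1) / (u - 1) =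
        (ratio_det u - ratio_det 1) / (u - 1)"
        by (simp add: ratio_det_def[of u] schur_det_def)
    qed
  qed
  ultimately show ?thesis
    unfolding has_field_derivative_iff by (auto intro: Lim_transform_eventually)
qed

text \<open>A homomorphism that is differentiable at 1 satisfies \<open>\<phi>'(u) = k \<phi>(u) / u\<close>, so \<open>\<phi>(u) u\<^sup>-\<^sup>k\<close> is constant on
  the punctured plane, which is connected.\<close>

lemma ratio_det_power:
  assumes "schur_trace (p - q) = of_int k" "u \<noteq> 0"
  shows "ratio_det u = u powi k"
proof -
  let ?g = "\<lambda>u. ratio_det u * u powi (- k)"
  have d: "(ratio_det has_field_derivative ratio_det u * of_int k / u) (at u)" if "u \<noteq> 0" for u
  proof -
    have "(ratio_det has_field_derivative of_int k) (at (u / u))"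
      using ratio_det_derivative_one that assms(1) by simp
    from DERIV_cdivide[OF DERIV_ident, of u u] this
    have "((\<lambda>v. ratio_det (v / u)) has_field_derivative of_int k * (1 / u)) (at u)"
      by (metis DERIV_chain2)
    then have d0: "((\<lambda>v. ratio_det u * ratio_det (v / u)) has_field_derivative ratio_det u * (of_int k * (1 / u))) (at u)"
      by (rule DERIV_cmult)
    have ev: "\<forall>\<^sub>F v in nhds u. ratio_det u * ratio_det (v / u) = ratio_det v"
    proof -
      have "\<forall>\<^sub>F v in nhds u. v \<noteq> 0" using that by (rule t1_space_nhds)
      then show ?thesis
        by (rule eventually_mono) (use that ratio_det_mult in \<open>metis divide_eq_0_iff nonzero_mult_div_cancel_left times_divide_eq_right\<close>)
    qed
    show ?thesis
      using iffD1[OF DERIV_cong_ev[OF refl ev refl] d0] by simp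
  qed
  have g: "(?g has_field_derivative 0) (at u)" if u: "u \<noteq> 0" for u
  proof -
    have "(?g has_field_derivative ratio_det u * of_int k / u * u powi (- k) + (of_int (- k) * u powi (- k - 1)) * ratio_det u) (at u)"
      using u by (auto intro!: derivative_eq_intros d)
    moreover have "ratio_det u * of_int k / u * u powi (- k) + (of_int (- k) * u powi (- k - 1)) * ratio_det u = 0"
      using u by (simp add: power_int_diff field_simps)
    ultimately show ?thesis by simp
  qed
  obtain c where c: "\<And>u. u \<in> - {0} \<Longrightarrow> ?g u = c"
  proof (rule DERIV_zero_connected_constant[of "- {0 :: complex}" "{}" ?g])
    show "connected (- {0 :: complex})"
      by (rule connected_punctured_universe) simp
    show "continuous_on (- {0}) ?g"
      using g DERIV_isCont by (intro continuous_at_imp_continuous_on) blast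
  qed (use g in auto)
  have "?g u = ?g 1" using c[of u] c[of 1] assms(2) by simp
  then show ?thesis using assms(2) by (simp add: power_int_minus field_simps)
qed

text \<open>From \<open>p (1 - p) = 0\<close> one finds
  \<open>(1 + s (p - q)) (1 + s q) = 1 + s p - s\<^sup>2 (1 - p) q = (1 + s p) (1 - s\<^sup>2 (1 - p) q)\<close>. Inserting
  \<open>dilate p (1 / u) * dilate p u\<close> with \<open>u = 1 + s\<close> separates a conjugate of the middle factor from the quotient
  of the two dilations.\<close>

lemma schur_det_difference:
  assumes "schur_trace (p - q) = of_int k" "s \<noteq> - 1"
  shows "schur_det (1 + smul s (p - q)) = (1 + s) powi k * schur_det (1 - smul (s\<^sup>2) ((1 - p) * q))"
proof -
  define u where "u = 1 + s"
  have u: "u \<noteq> 0" "s = u - 1" using assms(2) by (auto simp: u_def add_eq_0_iff)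
  let ?U = "dilate p u" and ?U' = "dilate p (1 / u)" and ?V = "dilate q (1 / u)"
  let ?W = "1 - smul (s\<^sup>2) ((1 - p) * q)"
  have inv: "?U * ?U' = 1" "?U' * ?U = 1" "dilate q u * ?V = 1"
    using u by (simp_all add: dilate_mult idem)
  have pp: "p * (p * x) = p * x" for x by (simp add: mult.assoc[symmetric] idem)
  have p0: "p * ((1 - p) * q) = 0" by (simp add: algebra_simps mult.assoc[symmetric] idem)
  have "(1 + smul s (p - q)) * dilate q u = ?U * ?W"
    unfolding dilate_def u(2)[symmetric]
    by (simp add: algebra_simps smul_simps power2_eq_square idem pp)
  then have "?U * ?W * ?V = (1 + smul s (p - q)) * (dilate q u * ?V)"
    by (simp add: mult.assoc[symmetric])
  then have "1 + smul s (p - q) = ?U * ?W * ?V" using inv(3) by simp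
  also have "\<dots> = ?U * ?W * ?U' * (?U * ?V)"
  proof -
    have "?U' * (?U * ?V) = ?V" using inv(2) by (simp add: mult.assoc[symmetric])
    then show ?thesis by (simp add: mult.assoc)
  qed
  finally have eq: "1 + smul s (p - q) = ?U * ?W * ?U' * (?U * ?V)" .
  have "(1 - p) * q = (q - p) * q" by (simp add: algebra_simps idem)
  also have "\<dots> = smul (- 1) ((p - q) * q)" by (simp add: smul_simps algebra_simps)
  finally have "?W - 1 = smul (s\<^sup>2) ((p - q) * q)" by (simp add: smul_simps smul_minus)
  then have W: "nuclear (?W - 1)" by (simp add: nuclear nuclear_mult_left nuclear_smul)
  have conj: "?U * ?W * ?U' - 1 = ?U * ((?W - 1) * ?U')" using inv by (simp add: algebra_simps)
  have "nuclear (?U * ?W * ?U' - 1)"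
    unfolding conj by (intro nuclear_mult_right nuclear_mult_left W)
  then have "schur_det (1 + smul s (p - q)) = schur_det (?U * ?W * ?U') * ratio_det u"
    unfolding eq ratio_det_def by (intro schur_det_mult nuclear_ratio u)
  also have "schur_det (?U * ?W * ?U') = schur_det ?W"
    by (intro schur_det_conjugate inv W)
  also have "ratio_det u = u powi k" by (rule ratio_det_power[OF assms(1) u(1)])
  finally show ?thesis by (simp add: u_def mult.commute)
qed

end

section \<open>Matrices as operators on square-summable sequences\<close>

abbreviation coord :: "'n::finite seq \<Rightarrow> int \<times> 'n \<Rightarrow> complex" where
  "coord x r \<equiv> x (fst r) $ snd r"

lemma norm_sq_coord:
  fixes x :: "'n::finite seq"
  shows "(norm (x k))\<^sup>2 = (\<Sum>i\<in>UNIV. (norm (coord x (k, i)))\<^sup>2)"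
  by (simp add: norm_vec_def L2_set_def sum_nonneg)

lemma ell2_iff_coord: "x \<in> ell2 \<longleftrightarrow> (\<lambda>r. (norm (coord x r))\<^sup>2) summable_on UNIV"
proof
  assume "x \<in> ell2"
  then have x: "(\<lambda>k. (norm (x k))\<^sup>2) summable_on UNIV" by (simp add: ell2_def)
  have "(\<lambda>r. (norm (coord x r))\<^sup>2) summable_on UNIV \<times> UNIV"
  proof (rule summable_on_SigmaI)
    show "((\<lambda>i. (norm (coord x (k, i)))\<^sup>2) has_sum (norm (x k))\<^sup>2) UNIV" for k
      unfolding norm_sq_coord by (rule has_sum_finite) simp
  qed (use x in auto)
  then show "(\<lambda>r. (norm (coord x r))\<^sup>2) summable_on UNIV" by simp
next
  assume "(\<lambda>r. (norm (coord x r))\<^sup>2) summable_on UNIV"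
  then have "(\<lambda>(k, i). (norm (coord x (k, i)))\<^sup>2) summable_on UNIV" by (simp add: case_prod_unfold)
  from summable_rows(2)[OF this] show "x \<in> ell2"
    unfolding ell2_def norm_sq_coord by simp
qed

lemma ell2_norm_coord:
  assumes "x \<in> ell2"
  shows "(ell2_norm x)\<^sup>2 = (\<Sum>\<^sub>\<infinity>r. (norm (coord x r))\<^sup>2)"
proof -
  have "(\<lambda>(k, i). (norm (coord x (k, i)))\<^sup>2) summable_on UNIV \<times> UNIV"
    using assms by (simp add: ell2_iff_coord case_prod_unfold)
  from infsum_Sigma'_banach[OF this]
  have "(\<Sum>\<^sub>\<infinity>k. (norm (x k))\<^sup>2) = (\<Sum>\<^sub>\<infinity>r. (norm (coord x r))\<^sup>2)"
    unfolding norm_sq_coord by (simp add: case_prod_unfold)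
  then show ?thesis by (simp add: ell2_norm_def infsum_nonneg)
qed

lemma ell2_norm_nonneg [simp]: "ell2_norm x \<ge> 0"
  by (simp add: ell2_norm_def infsum_nonneg)

lemma norm_coord_le:
  assumes "x \<in> ell2"
  shows "norm (coord x r) \<le> ell2_norm x"
proof -
  have "(norm (coord x r))\<^sup>2 \<le> (ell2_norm x)\<^sup>2"
    unfolding ell2_norm_coord[OF assms]
    using finite_sum_le_infsum[of "\<lambda>r. (norm (coord x r))\<^sup>2" UNIV "{r}"] assms by (simp add: ell2_iff_coord)
  then show ?thesis by (rule power2_le_imp_le) simp
qed

text \<open>A crude substitute for the triangle inequality in \<open>ell2\<close>: any bound suffices for the finiteness of operator
  norms.\<close>

lemma norm_diff_sq_le: "(norm (u - v))\<^sup>2 \<le> 2 * (norm u)\<^sup>2 + 2 * (norm v)\<^sup>2"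
  for u v :: "'a :: real_normed_vector"
proof -
  have "(norm (u - v))\<^sup>2 \<le> (norm u + norm v)\<^sup>2"
    by (intro power_mono norm_triangle_ineq4) auto
  also have "\<dots> \<le> 2 * (norm u)\<^sup>2 + 2 * (norm v)\<^sup>2"
    using sum_squares_bound[of "norm u" "norm v"] by (simp add: power2_sum)
  finally show ?thesis .
qed

lemma
  assumes "x \<in> ell2" "y \<in> ell2"
  shows ell2_diff: "x - y \<in> ell2"
    and ell2_norm_diff: "(ell2_norm (x - y))\<^sup>2 \<le> 2 * (ell2_norm x)\<^sup>2 + 2 * (ell2_norm y)\<^sup>2"
proof -
  have xy: "(\<lambda>k. (norm (x k))\<^sup>2) summable_on UNIV" "(\<lambda>k. (norm (y k))\<^sup>2) summable_on UNIV"
    using assms by (auto simp: ell2_def)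
  then have s: "(\<lambda>k. 2 * (norm (x k))\<^sup>2 + 2 * (norm (y k))\<^sup>2) summable_on UNIV"
    by (intro summable_on_add summable_on_cmult_right)
  then have d: "(\<lambda>k. (norm ((x - y) k))\<^sup>2) summable_on UNIV"
    by (rule summable_on_comparison_test) (auto simp: norm_diff_sq_le)
  then show "x - y \<in> ell2" by (simp add: ell2_def)
  have "(\<Sum>\<^sub>\<infinity>k. (norm ((x - y) k))\<^sup>2) \<le> (\<Sum>\<^sub>\<infinity>k. 2 * (norm (x k))\<^sup>2 + 2 * (norm (y k))\<^sup>2)"
    by (rule infsum_mono[OF d s]) (simp add: norm_diff_sq_le)
  also have "\<dots> = 2 * (\<Sum>\<^sub>\<infinity>k. (norm (x k))\<^sup>2) + 2 * (\<Sum>\<^sub>\<infinity>k. (norm (y k))\<^sup>2)"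
    using xy by (simp add: infsum_add summable_on_cmult_right infsum_cmult_right)
  finally show "(ell2_norm (x - y))\<^sup>2 \<le> 2 * (ell2_norm x)\<^sup>2 + 2 * (ell2_norm y)\<^sup>2"
    by (simp add: ell2_norm_def infsum_nonneg)
qed

lemma ell2_zero: "0 \<in> ell2" and ell2_norm_zero [simp]: "ell2_norm 0 = 0"
  by (simp_all add: ell2_def ell2_norm_def)

lemma schur_bound_exists: "\<exists>C. schur_bound (entry M) C"
  using schur_bounded_entry[of M] by (simp add: schur_bounded_def)

lemma schur_bound_add:
  assumes "schur_bound (entry A) C" "schur_bound (entry B) D"
  shows "schur_bound (entry (A + B)) (C + D)"
  unfolding schur_bound_def
proof (intro allI impI conjI)
  fix p and F :: "'a set" assume F: "finite F"
  have "(\<Sum>q\<in>F. norm (entry (A + B) p q)) \<le> (\<Sum>q\<in>F. norm (entry A p q)) + (\<Sum>q\<in>F. norm (entry B p q))"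
    "(\<Sum>q\<in>F. norm (entry (A + B) q p)) \<le> (\<Sum>q\<in>F. norm (entry A q p)) + (\<Sum>q\<in>F. norm (entry B q p))"
    unfolding sum.distrib[symmetric] entry_simps by (intro sum_mono norm_triangle_ineq)+
  moreover have "(\<Sum>q\<in>F. norm (entry A p q)) \<le> C" "(\<Sum>q\<in>F. norm (entry A q p)) \<le> C"
    "(\<Sum>q\<in>F. norm (entry B p q)) \<le> D" "(\<Sum>q\<in>F. norm (entry B q p)) \<le> D"
    using assms F by (auto simp: schur_bound_def)
  ultimately show "(\<Sum>q\<in>F. norm (entry (A + B) p q)) \<le> C + D" "(\<Sum>q\<in>F. norm (entry (A + B) q p)) \<le> C + D"
    by linarith+
qed

text \<open>The Cauchy-Schwarz inequality for the square roots of the weights \<open>m\<close>.\<close>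

lemma weighted_cauchy_schwarz:
  fixes m x :: "'a \<Rightarrow> real"
  assumes m: "m summable_on UNIV" "\<And>r. m r \<ge> 0" and mx: "(\<lambda>r. m r * (x r)\<^sup>2) summable_on UNIV"
    and s: "(\<lambda>r. m r * \<bar>x r\<bar>) summable_on UNIV"
  shows "(\<Sum>\<^sub>\<infinity>r. m r * \<bar>x r\<bar>)\<^sup>2 \<le> (\<Sum>\<^sub>\<infinity>r. m r) * (\<Sum>\<^sub>\<infinity>r. m r * (x r)\<^sup>2)"
proof -
  let ?K = "(\<Sum>\<^sub>\<infinity>r. m r) * (\<Sum>\<^sub>\<infinity>r. m r * (x r)\<^sup>2)"
  have nn: "(\<Sum>\<^sub>\<infinity>r. m r) \<ge> 0" "(\<Sum>\<^sub>\<infinity>r. m r * (x r)\<^sup>2) \<ge> 0"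
    using m(2) by (auto intro!: infsum_nonneg)
  have "(\<Sum>\<^sub>\<infinity>r. m r * \<bar>x r\<bar>) \<le> sqrt ?K"
  proof (rule infsum_le_finite_sums[OF s])
    fix F :: "'a set" assume F: "finite F"
    have "(\<Sum>r\<in>F. m r * \<bar>x r\<bar>)\<^sup>2 = (\<Sum>r\<in>F. sqrt (m r) * (sqrt (m r) * \<bar>x r\<bar>))\<^sup>2"
      using m(2) by (simp add: mult.assoc[symmetric])
    also have "\<dots> \<le> (\<Sum>r\<in>F. (sqrt (m r))\<^sup>2) * (\<Sum>r\<in>F. (sqrt (m r) * \<bar>x r\<bar>)\<^sup>2)"
      by (rule Cauchy_Schwarz_ineq_sum)
    also have "\<dots> = (\<Sum>r\<in>F. m r) * (\<Sum>r\<in>F. m r * (x r)\<^sup>2)"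
      using m(2) by (simp add: power_mult_distrib)
    also have "\<dots> \<le> ?K"
      using m(2) F nn by (intro mult_mono finite_sum_le_infsum m mx) (auto intro!: sum_nonneg)
    finally show "(\<Sum>r\<in>F. m r * \<bar>x r\<bar>) \<le> sqrt ?K" by (rule real_le_rsqrt)
  qed
  then have "(\<Sum>\<^sub>\<infinity>r. m r * \<bar>x r\<bar>)\<^sup>2 \<le> (sqrt ?K)\<^sup>2"
    using m(2) by (intro power_mono infsum_nonneg) auto
  then show ?thesis using nn by simp
qed

text \<open>The operator of matrix-vector multiplication, with vectors indexed by block number and position in the
  block.\<close>

definition operator_of :: "(int \<times> 'n::finite) schur_matrix \<Rightarrow> 'n operator" where
  "operator_of M x = (\<lambda>k. \<chi> i. \<Sum>\<^sub>\<infinity>r. entry M (k, i) r * coord x r)"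

lemma coord_op: "coord (operator_of M x) p = (\<Sum>\<^sub>\<infinity>r. entry M p r * coord x r)"
  by (simp add: operator_of_def)

lemma seq_eqI:
  fixes x y :: "'n::finite seq"
  assumes "\<And>p. coord x p = coord y p"
  shows "x = y"
proof
  fix k show "x k = y k" using assms[of "(k, _)"] by (simp add: vec_eq_iff)
qed

lemma op_summable:
  assumes "x \<in> ell2"
  shows "(\<lambda>r. norm (entry M p r * coord x r)) summable_on UNIV"
  by (rule schur_row_summable[OF schur_bounded_entry norm_coord_le[OF assms]])

text \<open>Cauchy-Schwarz with the weights \<open>|M p r|\<close> and the bound for the rows give
  \<open>|(M x)\<^sub>p|\<^sup>2 \<le> C \<Sum>\<^sub>r |M p r| |x\<^sub>r|\<^sup>2\<close>; the sum over \<open>p\<close> is estimated with the bound for the columns.\<close>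

lemma schur_test:
  assumes M: "schur_bound (entry M) C" and x: "x \<in> ell2"
  shows "operator_of M x \<in> ell2" "ell2_norm (operator_of M x) \<le> C * ell2_norm x"
proof -
  note b = schur_boundD[OF M]
  let ?f = "\<lambda>r p. norm (entry M p r) * (norm (coord x r))\<^sup>2"
  have x2: "(\<lambda>r. (norm (coord x r))\<^sup>2) summable_on UNIV" using x by (simp add: ell2_iff_coord)
  have f: "(\<lambda>(r, p). ?f r p) summable_on UNIV \<times> UNIV"
  proof (rule summable_on_SigmaI)
    show "((\<lambda>p. case (r, p) of (r, p) \<Rightarrow> ?f r p) has_sum (\<Sum>\<^sub>\<infinity>p. norm (entry M p r)) * (norm (coord x r))\<^sup>2) UNIV" for r
      unfolding case_prod_conv by (intro has_sum_cmult_left has_sum_infsum b(4))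
    have "(\<lambda>r. C * (norm (coord x r))\<^sup>2) summable_on UNIV" by (rule summable_on_cmult_right[OF x2])
    then show "(\<lambda>r. (\<Sum>\<^sub>\<infinity>p. norm (entry M p r)) * (norm (coord x r))\<^sup>2) summable_on UNIV"
      by (rule summable_on_comparison_test) (auto intro!: mult_right_mono b mult_nonneg_nonneg infsum_nonneg)
  qed auto
  have f': "(\<lambda>(p, r). ?f r p) summable_on UNIV"
  proof -
    have "((\<lambda>(r, p). ?f r p) \<circ> prod.swap) summable_on UNIV"
      using f by (subst summable_on_reindex[symmetric]) (auto simp: inj_on_def surj_swap)
    then show ?thesis by (simp add: o_def case_prod_unfold)
  qed
  have row: "(\<lambda>r. ?f r p) summable_on UNIV" for p
    by (rule summable_rows(1)[OF f']) simp
  have rows: "(\<lambda>p. \<Sum>\<^sub>\<infinity>r. ?f r p) summable_on UNIV"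
    by (rule summable_rows(2)[OF f']) simp
  have le: "(norm (coord (operator_of M x) p))\<^sup>2 \<le> C * (\<Sum>\<^sub>\<infinity>r. ?f r p)" for p
  proof -
    have s: "(\<lambda>r. norm (entry M p r * coord x r)) summable_on UNIV" by (rule op_summable[OF x])
    have "norm (coord (operator_of M x) p) \<le> (\<Sum>\<^sub>\<infinity>r. norm (entry M p r) * \<bar>norm (coord x r)\<bar>)"
      unfolding coord_op using norm_infsum_bound[OF s] by (simp add: norm_mult)
    then have "(norm (coord (operator_of M x) p))\<^sup>2 \<le> (\<Sum>\<^sub>\<infinity>r. norm (entry M p r) * \<bar>norm (coord x r)\<bar>)\<^sup>2"
      by (rule power_mono) simp
    also have "\<dots> \<le> (\<Sum>\<^sub>\<infinity>r. norm (entry M p r)) * (\<Sum>\<^sub>\<infinity>r. ?f r p)"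
      by (rule weighted_cauchy_schwarz[OF b(2) _ row]) (use s in \<open>auto simp: norm_mult\<close>)
    also have "\<dots> \<le> C * (\<Sum>\<^sub>\<infinity>r. ?f r p)"
      by (intro mult_right_mono b infsum_nonneg) simp
    finally show ?thesis .
  qed
  have y: "(\<lambda>p. (norm (coord (operator_of M x) p))\<^sup>2) summable_on UNIV"
    by (rule summable_on_comparison_test[OF summable_on_cmult_right[OF rows, of C]]) (use le in auto)
  then show 1: "operator_of M x \<in> ell2" by (simp add: ell2_iff_coord)
  have "(ell2_norm (operator_of M x))\<^sup>2 \<le> (\<Sum>\<^sub>\<infinity>p. C * (\<Sum>\<^sub>\<infinity>r. ?f r p))"
    unfolding ell2_norm_coord[OF 1] by (rule infsum_mono[OF y summable_on_cmult_right[OF rows] le])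
  also have "\<dots> = C * (\<Sum>\<^sub>\<infinity>p. \<Sum>\<^sub>\<infinity>r. ?f r p)" by (rule infsum_cmult_right[OF rows])
  also have "(\<Sum>\<^sub>\<infinity>p. \<Sum>\<^sub>\<infinity>r. ?f r p) = (\<Sum>\<^sub>\<infinity>r. \<Sum>\<^sub>\<infinity>p. ?f r p)"
    by (rule infsum_swap_banach[OF f, symmetric])
  also have "\<dots> = (\<Sum>\<^sub>\<infinity>r. (\<Sum>\<^sub>\<infinity>p. norm (entry M p r)) * (norm (coord x r))\<^sup>2)"
    by (simp add: infsum_cmult_left')
  also have "C * \<dots> \<le> C * (\<Sum>\<^sub>\<infinity>r. C * (norm (coord x r))\<^sup>2)"
  proof (rule mult_left_mono[OF infsum_mono b(1)])
    show *: "(\<lambda>r. C * (norm (coord x r))\<^sup>2) summable_on UNIV" by (rule summable_on_cmult_right[OF x2])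
    show "(\<lambda>r. (\<Sum>\<^sub>\<infinity>p. norm (entry M p r)) * (norm (coord x r))\<^sup>2) summable_on UNIV"
      by (rule summable_on_comparison_test[OF *]) (auto intro!: mult_right_mono b mult_nonneg_nonneg infsum_nonneg)
  qed (intro mult_right_mono b, simp)
  also have "(\<Sum>\<^sub>\<infinity>r. C * (norm (coord x r))\<^sup>2) = C * (ell2_norm x)\<^sup>2"
    unfolding ell2_norm_coord[OF x] by (rule infsum_cmult_right[OF x2])
  finally have "(ell2_norm (operator_of M x))\<^sup>2 \<le> (C * ell2_norm x)\<^sup>2"
    using b(1) by (simp add: power_mult_distrib power2_eq_square mult_ac)
  then show "ell2_norm (operator_of M x) \<le> C * ell2_norm x"
    by (rule power2_le_imp_le) (simp add: b(1))
qed

lemma op_ell2: "x \<in> ell2 \<Longrightarrow> operator_of M x \<in> ell2"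
  using schur_bound_exists schur_test(1) by blast

lemma op_add: "x \<in> ell2 \<Longrightarrow> y \<in> ell2 \<Longrightarrow> operator_of M (x + y) = operator_of M x + operator_of M y"
proof (rule seq_eqI)
  fix p assume xy: "x \<in> ell2" "y \<in> ell2"
  have "(\<lambda>r. entry M p r * coord x r) summable_on UNIV" "(\<lambda>r. entry M p r * coord y r) summable_on UNIV"
    by (rule abs_summable_summable[OF op_summable[OF xy(1)]], rule abs_summable_summable[OF op_summable[OF xy(2)]])
  from infsum_add[OF this] show "coord (operator_of M (x + y)) p = coord (operator_of M x + operator_of M y) p"
    unfolding plus_fun_apply vector_add_component coord_op by (simp add: distrib_left)
qed

lemma op_scale: "operator_of M (scale_seq s x) = scale_seq s (operator_of M x)"
proof (rule seq_eqI)
  fix p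
  have "coord (operator_of M (scale_seq s x)) p = (\<Sum>\<^sub>\<infinity>r. s * (entry M p r * coord x r))"
    unfolding coord_op by (simp add: scale_seq_def mult.left_commute)
  then show "coord (operator_of M (scale_seq s x)) p = coord (scale_seq s (operator_of M x)) p"
    by (simp add: infsum_cmult_right' coord_op scale_seq_def)
qed

lemma bounded_operator_op: "bounded_operator (operator_of M)"
proof -
  obtain C where "schur_bound (entry M) C" using schur_bound_exists by blast
  then show ?thesis
    unfolding bounded_operator_def using schur_test op_add op_scale by blast
qed

lemma op_mult: "x \<in> ell2 \<Longrightarrow> operator_of (M * N) x = operator_of M (operator_of N x)"
proof (rule seq_eqI)
  fix p assume "x \<in> ell2"
  from schur_apply_apply[OF schur_bounded_entry schur_bounded_entry norm_coord_le[OF this]]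
  show "coord (operator_of (M * N) x) p = coord (operator_of M (operator_of N x)) p"
    unfolding coord_op entry_mult .
qed

lemma op_one: "operator_of 1 x = x"
proof (rule seq_eqI)
  fix p
  have "(\<Sum>\<^sub>\<infinity>r. kron p r * coord x r) = (\<Sum>\<^sub>\<infinity>r\<in>{p}. coord x r)"
    by (rule infsum_cong_neutral) auto
  then show "coord (operator_of 1 x) p = coord x p" unfolding coord_op entry_simps by simp
qed

lemma op_plus: "x \<in> ell2 \<Longrightarrow> operator_of (M + N) x = operator_of M x + operator_of N x"
proof (rule seq_eqI)
  fix p assume x: "x \<in> ell2"
  have "(\<lambda>r. entry M p r * coord x r) summable_on UNIV" "(\<lambda>r. entry N p r * coord x r) summable_on UNIV"
    by (rule abs_summable_summable[OF op_summable[OF x]])+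
  from infsum_add[OF this] show "coord (operator_of (M + N) x) p = coord (operator_of M x + operator_of N x) p"
    unfolding plus_fun_apply vector_add_component coord_op by (simp add: distrib_right entry_simps)
qed

lemma op_smul: "operator_of (smul c M) x = scale_seq c (operator_of M x)"
proof (rule seq_eqI)
  fix p
  have "coord (operator_of (smul c M) x) p = (\<Sum>\<^sub>\<infinity>r. c * (entry M p r * coord x r))"
    unfolding coord_op by (simp add: mult.assoc)
  then show "coord (operator_of (smul c M) x) p = coord (scale_seq c (operator_of M x)) p"
    by (simp add: infsum_cmult_right' coord_op scale_seq_def)
qed

lemma op_minus: "x \<in> ell2 \<Longrightarrow> operator_of (M - N) x = operator_of M x - operator_of N x"
proof -
  assume x: "x \<in> ell2"
  have "M - N = M + smul (- 1) N" by (rule schur_matrix_eqI) (simp add: entry_simps)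
  then have "operator_of (M - N) x = operator_of M x + scale_seq (- 1) (operator_of N x)" using x by (simp only: op_plus op_smul)
  moreover have "scale_seq (- 1) y = - y" for y :: "'a seq" by (simp add: scale_seq_def fun_eq_iff)
  ultimately show ?thesis by simp
qed

lemma basis_seq_ell2: "basis_seq q \<in> ell2"
proof -
  have "(\<lambda>r. (norm (coord (basis_seq q) r))\<^sup>2) summable_on UNIV"
    by (rule finite_nonzero_values_imp_summable_on, rule finite_subset[of _ "{q}"])
      (auto simp: basis_seq_def axis_def prod_eq_iff split: if_splits)
  then show ?thesis by (simp add: ell2_iff_coord)
qed

lemma matrix_entry_op: "matrix_entry (operator_of M) = entry M"
proof (intro ext)
  fix p q
  have "matrix_entry (operator_of M) p q = (\<Sum>\<^sub>\<infinity>r. entry M p r * coord (basis_seq q) r)"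
    unfolding matrix_entry_def coord_op ..
  also have "\<dots> = (\<Sum>\<^sub>\<infinity>r\<in>{q}. entry M p r)"
    by (rule infsum_cong_neutral) (auto simp: basis_seq_def axis_def prod_eq_iff split: if_splits)
  finally show "matrix_entry (operator_of M) p q = entry M p q" by simp
qed

section \<open>Approximation by finite rank and the trace class\<close>

lemma bounded_operator_diff_norm:
  assumes "bounded_operator A" "bounded_operator B"
  shows "\<exists>C. \<forall>x\<in>ell2. ell2_norm (A x - B x) \<le> C * ell2_norm x"
proof -
  have AB: "\<And>x. x \<in> ell2 \<Longrightarrow> A x \<in> ell2" "\<And>x. x \<in> ell2 \<Longrightarrow> B x \<in> ell2"
    and "\<exists>C. \<forall>x\<in>ell2. ell2_norm (A x) \<le> C * ell2_norm x" "\<exists>D. \<forall>x\<in>ell2. ell2_norm (B x) \<le> D * ell2_norm x"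
    using assms by (simp_all add: bounded_operator_def)
  then obtain C D where CD: "\<And>x. x \<in> ell2 \<Longrightarrow> ell2_norm (A x) \<le> C * ell2_norm x"
    "\<And>x. x \<in> ell2 \<Longrightarrow> ell2_norm (B x) \<le> D * ell2_norm x"
    by blast
  have "ell2_norm (A x - B x) \<le> sqrt (2 * C\<^sup>2 + 2 * D\<^sup>2) * ell2_norm x" if x: "x \<in> ell2" for x
  proof -
    have "(ell2_norm (A x - B x))\<^sup>2 \<le> 2 * (ell2_norm (A x))\<^sup>2 + 2 * (ell2_norm (B x))\<^sup>2"
      by (rule ell2_norm_diff[OF AB(1)[OF x] AB(2)[OF x]])
    also have "\<dots> \<le> 2 * (C * ell2_norm x)\<^sup>2 + 2 * (D * ell2_norm x)\<^sup>2"
      by (intro add_mono mult_left_mono power_mono CD x) auto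
    also have "\<dots> = (sqrt (2 * C\<^sup>2 + 2 * D\<^sup>2) * ell2_norm x)\<^sup>2"
      by (simp add: power_mult_distrib distrib_right)
    finally show ?thesis by (rule power2_le_imp_le) simp
  qed
  then show ?thesis by blast
qed

lemma
  fixes A F :: "'n::finite operator"
  assumes "bounded_operator A" "bounded_operator F"
  shows operator_norm_diff_nonneg: "operator_norm (A - F) \<ge> 0"
    and operator_norm_diff_le:
      "(\<And>x. x \<in> ell2 \<Longrightarrow> ell2_norm (A x - F x) \<le> e * ell2_norm x) \<Longrightarrow> e \<ge> 0 \<Longrightarrow> operator_norm (A - F) \<le> e"
proof -
  let ?X = "{x \<in> ell2 :: 'n seq set. ell2_norm x \<le> 1}"
  obtain C where C: "\<And>x. x \<in> ell2 \<Longrightarrow> ell2_norm (A x - F x) \<le> C * ell2_norm x"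
    using bounded_operator_diff_norm[OF assms] by blast
  have "ell2_norm ((A - F) x) \<le> \<bar>C\<bar>" if "x \<in> ?X" for x
  proof -
    have "C * ell2_norm x \<le> \<bar>C\<bar> * 1" using that by (intro mult_mono) auto
    then show ?thesis using C[of x] that by simp
  qed
  then have bdd: "bdd_above ((\<lambda>x. ell2_norm ((A - F) x)) ` ?X)" by (rule bdd_aboveI2)
  have zero: "0 \<in> ?X" using ell2_zero by simp
  have "ell2_norm ((A - F) 0) \<le> operator_norm (A - F)"
    unfolding operator_norm_def by (rule cSUP_upper[OF zero bdd])
  then show "operator_norm (A - F) \<ge> 0" using ell2_norm_nonneg order_trans by blast
  assume e: "\<And>x. x \<in> ell2 \<Longrightarrow> ell2_norm (A x - F x) \<le> e * ell2_norm x" "e \<ge> 0"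
  show "operator_norm (A - F) \<le> e"
    unfolding operator_norm_def
  proof (rule cSUP_least)
    fix x assume "x \<in> ?X"
    then have x: "x \<in> ell2" "ell2_norm x \<le> 1" by auto
    have "e * ell2_norm x \<le> e * 1" using x e(2) by (intro mult_left_mono)
    then show "ell2_norm ((A - F) x) \<le> e" using e(1)[OF x(1)] by simp
  qed (use zero in blast)
qed

lemma rank_le_mono:
  assumes "rank_le F m" "m \<le> k"
  shows "rank_le F k"
proof -
  obtain u where u: "\<And>i. i < m \<Longrightarrow> u i \<in> ell2" "\<And>x. x \<in> ell2 \<Longrightarrow> \<exists>c. F x = (\<Sum>i<m. scale_seq (c i) (u i))"
    using assms(1) unfolding rank_le_def by blast
  let ?u = "\<lambda>i. if i < m then u i else 0"
  have "(\<Sum>i<k. scale_seq (c i) (?u i)) = (\<Sum>i<m. scale_seq (c i) (u i))" for c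
    using assms(2) by (intro sum.mono_neutral_cong_right) (auto simp: scale_seq_def fun_eq_iff)
  then have "\<forall>x\<in>ell2. \<exists>c. F x = (\<Sum>i<k. scale_seq (c i) (?u i))" using u(2) by simp
  moreover have "\<forall>i<k. ?u i \<in> ell2" using u(1) ell2_zero by auto
  ultimately show ?thesis unfolding rank_le_def by (intro exI[of _ ?u]) simp
qed

lemma rank_le_op_add:
  assumes "rank_le (operator_of X) k" "rank_le (operator_of Y) l"
  shows "rank_le (operator_of (X + Y)) (k + l)"
proof -
  obtain u v where u: "\<And>i. i < k \<Longrightarrow> u i \<in> ell2" "\<And>x. x \<in> ell2 \<Longrightarrow> \<exists>c. operator_of X x = (\<Sum>i<k. scale_seq (c i) (u i))"
    and v: "\<And>i. i < l \<Longrightarrow> v i \<in> ell2" "\<And>x. x \<in> ell2 \<Longrightarrow> \<exists>c. operator_of Y x = (\<Sum>i<l. scale_seq (c i) (v i))"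
    using assms unfolding rank_le_def by blast
  let ?w = "\<lambda>i. if i < k then u i else v (i - k)"
  have "\<exists>e. operator_of (X + Y) x = (\<Sum>i<k+l. scale_seq (e i) (?w i))" if x: "x \<in> ell2" for x
  proof -
    obtain c d where "operator_of X x = (\<Sum>i<k. scale_seq (c i) (u i))" "operator_of Y x = (\<Sum>i<l. scale_seq (d i) (v i))"
      using u(2)[OF x] v(2)[OF x] by blast
    moreover have "(\<Sum>i<k+l. scale_seq (if i < k then c i else d (i - k)) (?w i)) =
       (\<Sum>i<k. scale_seq (c i) (u i)) + (\<Sum>i<l. scale_seq (d i) (v i))"
    proof -
      have "(\<Sum>i<k+l. scale_seq (if i < k then c i else d (i - k)) (?w i)) =
         (\<Sum>i\<in>{0..<k}. scale_seq (if i < k then c i else d (i - k)) (?w i)) + (\<Sum>i\<in>{k..<k+l}. scale_seq (if i < k then c i else d (i - k)) (?w i))"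
        by (subst sum.atLeastLessThan_concat) (auto simp: lessThan_atLeast0)
      also have "(\<Sum>i\<in>{k..<k+l}. scale_seq (if i < k then c i else d (i - k)) (?w i)) = (\<Sum>i<l. scale_seq (d i) (v i))"
        by (rule sum.reindex_bij_witness[where i="\<lambda>i. i + k" and j="\<lambda>i. i - k"]) auto
      also have "(\<Sum>i\<in>{0..<k}. scale_seq (if i < k then c i else d (i - k)) (?w i)) = (\<Sum>i<k. scale_seq (c i) (u i))"
        by (intro sum.cong) auto
      finally show ?thesis .
    qed
    ultimately show ?thesis
      using op_plus[OF x, of X Y] by (intro exI[of _ "\<lambda>i. if i < k then c i else d (i - k)"]) simp
  qed
  moreover have "\<forall>i<k+l. ?w i \<in> ell2" using u(1) v(1) by auto
  ultimately show ?thesis unfolding rank_le_def by (intro exI[of _ ?w]) simp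
qed

lemma ell2_sum_scale:
  fixes u :: "nat \<Rightarrow> 'n::finite seq"
  assumes "\<And>i. i < k \<Longrightarrow> u i \<in> ell2"
  shows "(\<Sum>i<k. scale_seq (c i) (u i)) \<in> ell2 \<and> operator_of A (\<Sum>i<k. scale_seq (c i) (u i)) = (\<Sum>i<k. scale_seq (c i) (operator_of A (u i)))"
  using assms
proof (induction k)
  case 0
  have "scale_seq 0 y = 0" for y :: "'n seq" by (simp add: scale_seq_def fun_eq_iff)
  then have "operator_of A 0 = 0" using op_scale[of A 0 0] by (simp only:)
  then show ?case using ell2_zero by (simp only: lessThan_0 sum.empty)
next
  case (Suc k)
  have sc: "scale_seq (c k) (u k) \<in> ell2"
    using op_ell2[of "u k" "smul (c k) 1"] Suc.prems by (simp add: op_smul op_one)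
  have "scale_seq (- 1) y = - y" for y :: "'n seq" by (simp add: scale_seq_def fun_eq_iff)
  then have "- y \<in> ell2" if "y \<in> ell2" for y :: "'n seq"
    using op_ell2[of y "smul (- 1) 1"] that by (simp add: op_smul op_one)
  then have add: "x + y \<in> ell2" if "x \<in> ell2" "y \<in> ell2" for x y :: "'n seq"
    using ell2_diff[of x "- y"] that by simp
  have IH: "(\<Sum>i<k. scale_seq (c i) (u i)) \<in> ell2"
      "operator_of A (\<Sum>i<k. scale_seq (c i) (u i)) = (\<Sum>i<k. scale_seq (c i) (operator_of A (u i)))"
    using Suc.IH Suc.prems by simp_all
  show ?case
    unfolding sum.lessThan_Suc op_add[OF IH(1) sc] IH(2) op_scale by (rule conjI[OF add[OF IH(1) sc] refl])
qed

lemma rank_le_op_mult_left: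
  assumes "rank_le (operator_of X) k"
  shows "rank_le (operator_of (A * X)) k"
proof -
  obtain u where u: "\<And>i. i < k \<Longrightarrow> u i \<in> ell2" "\<And>x. x \<in> ell2 \<Longrightarrow> \<exists>c. operator_of X x = (\<Sum>i<k. scale_seq (c i) (u i))"
    using assms unfolding rank_le_def by blast
  have "\<exists>c. operator_of (A * X) x = (\<Sum>i<k. scale_seq (c i) (operator_of A (u i)))" if x: "x \<in> ell2" for x
  proof -
    obtain c where "operator_of X x = (\<Sum>i<k. scale_seq (c i) (u i))" using u(2)[OF x] by blast
    then show ?thesis using op_mult[OF x, of A X] ell2_sum_scale[of k u c A] u(1) by auto
  qed
  then show ?thesis unfolding rank_le_def
    by (intro exI[of _ "\<lambda>i. operator_of A (u i)"]) (simp add: op_ell2 u(1))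
qed

lemma rank_le_op_mult_right: "rank_le (operator_of X) k \<Longrightarrow> rank_le (operator_of (X * A)) k"
  unfolding rank_le_def using op_mult op_ell2 by metis

lemma rank_le_finite_rows:
  assumes "finite I" "\<And>p q. p \<notin> I \<Longrightarrow> entry X p q = 0"
  shows "rank_le (operator_of X) (card I)"
proof -
  obtain h where h: "bij_betw h {..<card I} I"
    using assms(1) by (metis atLeast0LessThan bij_betw_from_nat_into_finite ex_bij_betw_nat_finite)
  have "operator_of X x = (\<Sum>i<card I. scale_seq (coord (operator_of X x) (h i)) (basis_seq (h i)))" for x
  proof (rule seq_eqI)
    fix p
    have 0: "coord (operator_of X x) p = 0" if "p \<notin> I" for p
      unfolding coord_op using assms(2)[OF that] by simp
    have sum: "coord (\<Sum>i\<in>J. f i) p = (\<Sum>i\<in>J. coord (f i) p)" if "finite J" for f :: "nat \<Rightarrow> 'a seq" and J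
      using that by (induction J rule: finite_induct) auto
    have "coord (\<Sum>i<card I. scale_seq (coord (operator_of X x) (h i)) (basis_seq (h i))) p =
       (\<Sum>i<card I. coord (operator_of X x) (h i) * coord (basis_seq (h i)) p)"
      by (subst sum) (auto simp: scale_seq_def)
    also have "\<dots> = (\<Sum>r\<in>I. coord (operator_of X x) r * coord (basis_seq r) p)"
      by (rule sum.reindex_bij_betw[OF h])
    also have "\<dots> = (\<Sum>r\<in>I. if r = p then coord (operator_of X x) p else 0)"
      by (intro sum.cong) (auto simp: basis_seq_def axis_def prod_eq_iff)
    also have "\<dots> = coord (operator_of X x) p" using assms(1) 0 by simp
    finally show "coord (operator_of X x) p = coord (\<Sum>i<card I. scale_seq (coord (operator_of X x) (h i)) (basis_seq (h i))) p" ..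
  qed
  then have "\<exists>c. operator_of X x = (\<Sum>i<card I. scale_seq (c i) (basis_seq (h i)))" for x
    by (rule exI[of _ "\<lambda>i. coord (operator_of X x) (h i)"])
  then show ?thesis unfolding rank_le_def
    by (intro exI[of _ "\<lambda>i. basis_seq (h i)"] conjI allI impI ballI basis_seq_ell2)
qed

text \<open>Summability of the singular values in a form that is stable under sums and under products with bounded
  matrices: the rank may grow linearly in \<open>m\<close> while the errors stay summable.\<close>

definition rank_approximable :: "(int \<times> 'n::finite) schur_matrix \<Rightarrow> bool" where
  "rank_approximable X \<longleftrightarrow> (\<exists>c \<epsilon>. summable \<epsilon> \<and>
     (\<forall>m. \<exists>Y. rank_le (operator_of Y) (c * Suc m) \<and> schur_bound (entry (X - Y)) (\<epsilon> m)))"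

lemma schur_bound_entry_mult:
  "schur_bound (entry A) C \<Longrightarrow> schur_bound (entry B) D \<Longrightarrow> schur_bound (entry (A * B)) (C * D)"
  using schur_bound_mult[of "entry A" C "entry B" D] by (simp add: entry_mult[abs_def])

lemma rank_approximable_add:
  assumes "rank_approximable X" "rank_approximable X'"
  shows "rank_approximable (X + X')"
proof -
  obtain c \<epsilon> c' \<epsilon>' where 1: "summable \<epsilon>" "\<And>m. \<exists>Y. rank_le (operator_of Y) (c * Suc m) \<and> schur_bound (entry (X - Y)) (\<epsilon> m)"
    and 2: "summable \<epsilon>'" "\<And>m. \<exists>Y. rank_le (operator_of Y) (c' * Suc m) \<and> schur_bound (entry (X' - Y)) (\<epsilon>' m)"
    using assms unfolding rank_approximable_def by blast
  have "\<exists>Y. rank_le (operator_of Y) ((c + c') * Suc m) \<and> schur_bound (entry (X + X' - Y)) (\<epsilon> m + \<epsilon>' m)" for m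
  proof -
    obtain Y Y' where "rank_le (operator_of Y) (c * Suc m)" "schur_bound (entry (X - Y)) (\<epsilon> m)"
      "rank_le (operator_of Y') (c' * Suc m)" "schur_bound (entry (X' - Y')) (\<epsilon>' m)"
      using 1(2) 2(2) by blast
    then have "rank_le (operator_of (Y + Y')) (c * Suc m + c' * Suc m)" "schur_bound (entry ((X - Y) + (X' - Y'))) (\<epsilon> m + \<epsilon>' m)"
      by (auto intro: rank_le_op_add schur_bound_add)
    moreover have "X + X' - (Y + Y') = (X - Y) + (X' - Y')" by simp
    ultimately show ?thesis unfolding distrib_right by metis
  qed
  then show ?thesis unfolding rank_approximable_def using summable_add[OF 1(1) 2(1)] by blast
qed

lemma rank_approximable_mult_left:
  assumes "rank_approximable X"
  shows "rank_approximable (A * X)"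
proof -
  obtain c \<epsilon> where 1: "summable \<epsilon>" "\<And>m. \<exists>Y. rank_le (operator_of Y) (c * Suc m) \<and> schur_bound (entry (X - Y)) (\<epsilon> m)"
    using assms unfolding rank_approximable_def by blast
  obtain C where C: "schur_bound (entry A) C" using schur_bound_exists by blast
  have "\<exists>Y. rank_le (operator_of Y) (c * Suc m) \<and> schur_bound (entry (A * X - Y)) (C * \<epsilon> m)" for m
    using 1(2)[of m] rank_le_op_mult_left schur_bound_entry_mult[OF C] by (metis right_diff_distrib)
  then show ?thesis unfolding rank_approximable_def using summable_mult[OF 1(1), of C] by blast
qed

lemma rank_approximable_mult_right:
  assumes "rank_approximable X"
  shows "rank_approximable (X * A)"
proof -
  obtain c \<epsilon> where 1: "summable \<epsilon>" "\<And>m. \<exists>Y. rank_le (operator_of Y) (c * Suc m) \<and> schur_bound (entry (X - Y)) (\<epsilon> m)"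
    using assms unfolding rank_approximable_def by blast
  obtain C where C: "schur_bound (entry A) C" using schur_bound_exists by blast
  have "\<exists>Y. rank_le (operator_of Y) (c * Suc m) \<and> schur_bound (entry (X * A - Y)) (\<epsilon> m * C)" for m
    using 1(2)[of m] rank_le_op_mult_right schur_bound_entry_mult[OF _ C] by (metis left_diff_distrib)
  then show ?thesis unfolding rank_approximable_def using summable_mult2[OF 1(1), of C] by blast
qed

lemma rank_approximable_smul: "rank_approximable X \<Longrightarrow> rank_approximable (smul c X)"
  using rank_approximable_mult_left[of X "smul c 1"] by simp

text \<open>Every value \<open>\<epsilon> m\<close> is taken exactly \<open>c\<close> times.\<close>

lemma summable_div:
  fixes \<epsilon> :: "nat \<Rightarrow> real"
  assumes "summable \<epsilon>" "\<And>m. \<epsilon> m \<ge> 0" "c > 0"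
  shows "summable (\<lambda>k. \<epsilon> (k div c))"
proof (rule bounded_imp_summable)
  fix n
  have "(\<Sum>k\<le>n. \<epsilon> (k div c)) \<le> (\<Sum>k<Suc n * c. \<epsilon> (k div c))"
  proof (rule sum_mono2)
    show "{..n} \<subseteq> {..<Suc n * c}"
    proof
      fix x assume "x \<in> {..n}"
      moreover have "n * 1 \<le> n * c" using assms(3) by (intro mult_le_mono2) simp
      ultimately have "x \<le> n * c" by (simp only: atMost_iff mult_1_right)
      then show "x \<in> {..<Suc n * c}" using assms(3) by simp
    qed
  qed (use assms(2) in auto)
  also have "\<dots> = (\<Sum>m<Suc n. \<Sum>k\<in>{m * c..<m * c + c}. \<epsilon> (k div c))"
    by (rule sum.nat_group[symmetric])
  also have "\<dots> = (\<Sum>m<Suc n. \<Sum>k\<in>{m * c..<m * c + c}. \<epsilon> m)"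
  proof (intro sum.cong refl arg_cong[of _ _ \<epsilon>])
    fix m k assume "k \<in> {m * c..<m * c + c}"
    then show "k div c = m" using assms(3) by (intro div_nat_eqI) (auto simp: mult.commute)
  qed
  also have "\<dots> = c * (\<Sum>m<Suc n. \<epsilon> m)" by (simp only: sum_constant card_atLeastLessThan sum_distrib_left) simp
  also have "\<dots> \<le> c * suminf \<epsilon>" using assms(1,2) by (intro mult_left_mono sum_le_suminf) auto
  finally show "(\<Sum>k\<le>n. \<epsilon> (k div c)) \<le> c * suminf \<epsilon>" .
qed (use assms(2) in auto)

text \<open>The singular value with index \<open>k + c\<close> is at most the error of the approximation numbered \<open>k div c\<close>, whose rank
  does not exceed \<open>k + c\<close>.\<close>

lemma trace_class_rank_approximable:
  assumes X: "rank_approximable X" and A: "\<And>x. x \<in> ell2 \<Longrightarrow> A x = operator_of X x"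
  shows "trace_class A"
proof -
  obtain c' \<epsilon> where 1: "summable \<epsilon>" "\<And>m. \<exists>Y. rank_le (operator_of Y) (c' * Suc m) \<and> schur_bound (entry (X - Y)) (\<epsilon> m)"
    using X unfolding rank_approximable_def by blast
  (* One more than the given constant, so that the division by it below is by a positive number. *)
  define c where "c = Suc c'"
  have \<epsilon>: "\<epsilon> m \<ge> 0" for m using 1(2)[of m] schur_boundD(1) by blast
  have bA: "bounded_operator A"
  proof -
    have "x + y \<in> ell2" "scale_seq s x \<in> ell2" if "x \<in> ell2" "y \<in> ell2" for x y :: "'a seq" and s
      using ell2_sum_scale[of 2 "\<lambda>i. if i = 0 then x else y" "\<lambda>_. 1"]
        ell2_sum_scale[of 1 "\<lambda>i. x" "\<lambda>_. s"] that
      by (auto simp: numeral_2_eq_2 scale_seq_def)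
    then show ?thesis
      using bounded_operator_op[of X] unfolding bounded_operator_def using A by simp
  qed
  define S where "S = singular_value A"
  have bdd: "bdd_below ((\<lambda>F. operator_norm (A - F)) ` {F. bounded_operator F \<and> rank_le F k})" for k
    by (rule bdd_belowI2[of _ 0]) (auto intro: operator_norm_diff_nonneg[OF bA])
  have Sle: "S k \<le> e" if "bounded_operator F" "rank_le F k" "\<And>x. x \<in> ell2 \<Longrightarrow> ell2_norm (A x - F x) \<le> e * ell2_norm x" "e \<ge> 0" for k F e
  proof -
    have "S k \<le> operator_norm (A - F)"
      unfolding S_def singular_value_def using that by (intro cINF_lower bdd) auto
    also have "\<dots> \<le> e" by (rule operator_norm_diff_le[OF bA that(1,3,4)])
    finally show ?thesis .
  qed
  have S0: "S k \<ge> 0" for k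
  proof -
    have "bounded_operator (operator_of (0 :: (int \<times> 'a) schur_matrix))" by (rule bounded_operator_op)
    moreover have "rank_le (operator_of (0 :: (int \<times> 'a) schur_matrix)) k"
      using rank_le_mono[OF rank_le_finite_rows[of "{}" 0], of k] by (simp add: entry_simps)
    ultimately show ?thesis
      unfolding S_def singular_value_def
      by (intro cINF_greatest) (auto intro: operator_norm_diff_nonneg[OF bA])
  qed
  have S\<epsilon>: "S (k + c) \<le> \<epsilon> (k div c)" for k
  proof -
    obtain Y where Y: "rank_le (operator_of Y) (c' * Suc (k div c))" "schur_bound (entry (X - Y)) (\<epsilon> (k div c))"
      using 1(2) by blast
    have "c' * Suc (k div c) \<le> c * Suc (k div c)" by (simp add: c_def)
    also have "\<dots> = c * (k div c) + c" by simp
    also have "\<dots> \<le> k + c" by simp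
    finally have "rank_le (operator_of Y) (k + c)" by (rule rank_le_mono[OF Y(1)])
    then show ?thesis
    proof (rule Sle[OF bounded_operator_op _ _ \<epsilon>])
      show "ell2_norm (A x - operator_of Y x) \<le> \<epsilon> (k div c) * ell2_norm x" if "x \<in> ell2" for x
        using schur_test(2)[OF Y(2) that] A[OF that] op_minus[OF that, of X Y] by simp
    qed
  qed
  have "summable (\<lambda>k. S (k + c))"
  proof (rule summable_comparison_test'[OF summable_div[OF 1(1) \<epsilon>]])
    show "c > 0" by (simp add: c_def)
    show "norm (S (k + c)) \<le> \<epsilon> (k div c)" if "k \<ge> 0" for k
      using S\<epsilon>[of k] S0[of "k + c"] by simp
  qed
  then have "summable S" by (simp only: summable_iff_shift)
  then show ?thesis unfolding trace_class_def S_def using bA by blast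
qed

section \<open>Corners of block matrices\<close>

lemma row_proj_bounded: "schur_bounded (\<lambda>p q :: int \<times> 'n. if p = q \<and> fst p \<in> S then 1 else 0)"
proof -
  have "(\<Sum>q\<in>F. norm (if p = q \<and> fst p \<in> S then 1 else 0 :: complex)) \<le> 1 \<and>
      (\<Sum>q\<in>F. norm (if q = p \<and> fst q \<in> S then 1 else 0 :: complex)) \<le> 1" if "finite F" for p :: "int \<times> 'n" and F
  proof -
    have "(\<Sum>q\<in>F. norm (if p = q \<and> fst p \<in> S then 1 else 0 :: complex)) \<le> (\<Sum>q\<in>F. if q = p then 1 else 0)"
      "(\<Sum>q\<in>F. norm (if q = p \<and> fst q \<in> S then 1 else 0 :: complex)) \<le> (\<Sum>q\<in>F. if q = p then 1 else 0)"
      by (intro sum_mono; auto)+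
    moreover have "(\<Sum>q\<in>F. if q = p then 1 else 0 :: real) \<le> 1" using that by simp
    ultimately show ?thesis by linarith
  qed
  then show ?thesis unfolding schur_bounded_iff by blast
qed

definition row_proj :: "int set \<Rightarrow> (int \<times> 'n) schur_matrix" where
  "row_proj S = Schur_Matrix (\<lambda>p q. if p = q \<and> fst p \<in> S then 1 else 0)"

lemma entry_row_proj: "entry (row_proj S) p q = (if p = q \<and> fst p \<in> S then 1 else 0)"
  by (simp add: row_proj_def entry_Schur_Matrix row_proj_bounded)

lemma entry_row_proj_mult: "entry (row_proj S * X) p q = (if fst p \<in> S then entry X p q else 0)"
proof -
  have "entry (row_proj S * X) p q = (\<Sum>\<^sub>\<infinity>r\<in>{p}. if fst p \<in> S then entry X p q else 0)"
    unfolding entry_mult entry_row_proj by (rule infsum_cong_neutral) auto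
  then show ?thesis by simp
qed

lemma entry_mult_row_proj: "entry (X * row_proj S) p q = (if fst q \<in> S then entry X p q else 0)"
proof -
  have "entry (X * row_proj S) p q = (\<Sum>\<^sub>\<infinity>r\<in>{q}. if fst q \<in> S then entry X p q else 0)"
    unfolding entry_mult entry_row_proj by (rule infsum_cong_neutral) auto
  then show ?thesis by simp
qed

lemma row_proj_idem: "row_proj S * row_proj S = row_proj S"
  by (rule schur_matrix_eqI) (simp add: entry_row_proj_mult entry_row_proj)

lemma coord_op_row_proj: "coord (operator_of (row_proj S) x) p = (if fst p \<in> S then coord x p else 0)"
proof -
  have "coord (operator_of (row_proj S) x) p = (\<Sum>\<^sub>\<infinity>r\<in>{p}. if fst p \<in> S then coord x p else 0)"
    unfolding coord_op entry_row_proj by (rule infsum_cong_neutral) auto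
  then show ?thesis by simp
qed

lemma op_row_proj: "operator_of (row_proj S) x = (\<lambda>k. if k \<in> S then x k else 0)"
  by (rule seq_eqI) (simp add: coord_op_row_proj)

lemma sum_blocks_le:
  fixes \<tau> :: "int \<Rightarrow> real" and F :: "(int \<times> 'n::finite) set"
  assumes \<tau>: "\<tau> summable_on UNIV" "\<And>j. \<tau> j \<ge> 0" and F: "finite F" and \<phi>: "inj \<phi>"
  shows "(\<Sum>q\<in>F. \<tau> (\<phi> (fst q))) \<le> CARD('n) * (\<Sum>\<^sub>\<infinity>j. \<tau> j)"
proof -
  have "(\<Sum>q\<in>F. \<tau> (\<phi> (fst q))) \<le> (\<Sum>q\<in>fst ` F \<times> (UNIV :: 'n set). \<tau> (\<phi> (fst q)))"
    using F \<tau>(2) by (intro sum_mono2) (auto intro: rev_image_eqI)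
  also have "\<dots> = (\<Sum>l\<in>fst ` F. \<Sum>i\<in>(UNIV :: 'n set). \<tau> (\<phi> l))"
    unfolding sum.cartesian_product by (simp add: case_prod_unfold)
  also have "\<dots> = CARD('n) * (\<Sum>l\<in>fst ` F. \<tau> (\<phi> l))"
    by (simp add: sum_distrib_left)
  also have "(\<Sum>l\<in>fst ` F. \<tau> (\<phi> l)) = (\<Sum>j\<in>\<phi> ` fst ` F. \<tau> j)"
    using \<phi> by (subst sum.reindex) (auto intro: inj_on_subset)
  also have "CARD('n) * \<dots> \<le> CARD('n) * (\<Sum>\<^sub>\<infinity>j. \<tau> j)"
    using F \<tau> by (intro mult_left_mono finite_sum_le_infsum) auto
  finally show ?thesis .
qed

lemma toeplitz_dominated:
  fixes \<tau> :: "int \<Rightarrow> real"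
  fixes M :: "int \<times> 'n::finite \<Rightarrow> int \<times> 'n \<Rightarrow> complex"
  assumes \<tau>: "\<tau> summable_on UNIV" "\<And>j. \<tau> j \<ge> 0" and M: "\<And>p q. norm (M p q) \<le> \<tau> (fst p - fst q)"
    and F: "finite F"
  shows "(\<Sum>q\<in>F. norm (M p q)) \<le> CARD('n) * (\<Sum>\<^sub>\<infinity>j. \<tau> j)" "(\<Sum>q\<in>F. norm (M q p)) \<le> CARD('n) * (\<Sum>\<^sub>\<infinity>j. \<tau> j)"
proof -
  have "(\<Sum>q\<in>F. norm (M p q)) \<le> (\<Sum>q\<in>F. \<tau> (fst p - fst q))" by (intro sum_mono M)
  also have "\<dots> \<le> CARD('n) * (\<Sum>\<^sub>\<infinity>j. \<tau> j)"
    by (rule sum_blocks_le[OF \<tau> F, of "\<lambda>l. fst p - l"]) (simp add: inj_on_def)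
  finally show "(\<Sum>q\<in>F. norm (M p q)) \<le> CARD('n) * (\<Sum>\<^sub>\<infinity>j. \<tau> j)" .
  have "(\<Sum>q\<in>F. norm (M q p)) \<le> (\<Sum>q\<in>F. \<tau> (fst q - fst p))" by (intro sum_mono M)
  also have "\<dots> \<le> CARD('n) * (\<Sum>\<^sub>\<infinity>j. \<tau> j)"
    by (rule sum_blocks_le[OF \<tau> F, of "\<lambda>l. l - fst p"]) (simp add: inj_on_def)
  finally show "(\<Sum>q\<in>F. norm (M q p)) \<le> CARD('n) * (\<Sum>\<^sub>\<infinity>j. \<tau> j)" .
qed

text \<open>A set of block positions of which the band \<open>|k - l| \<le> m\<close> touches at most \<open>m + d\<close> rows. In particular the
  diagonal \<open>k - l = j\<close> contains at most \<open>|j| + d\<close> positions of it.\<close>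

definition corner :: "(int \<times> int) set \<Rightarrow> nat \<Rightarrow> bool" where
  "corner Z d \<longleftrightarrow> (\<forall>m::nat. \<exists>K. finite K \<and> card K \<le> m + d \<and> (\<forall>(k, l)\<in>Z. \<bar>k - l\<bar> \<le> int m \<longrightarrow> k \<in> K))"

lemma cornerE:
  assumes "corner Z d"
  obtains K where "finite K" "card K \<le> m + d" "\<And>k l. (k, l) \<in> Z \<Longrightarrow> \<bar>k - l\<bar> \<le> int m \<Longrightarrow> k \<in> K"
proof -
  obtain K where "finite K" "card K \<le> m + d" and K: "\<forall>(k, l)\<in>Z. \<bar>k - l\<bar> \<le> int m \<longrightarrow> k \<in> K"
    using assms unfolding corner_def by blast
  moreover have "k \<in> K" if "(k, l) \<in> Z" "\<bar>k - l\<bar> \<le> int m" for k l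
    using bspec[OF K that(1)] that(2) by simp
  ultimately show ?thesis using that by blast
qed

lemma corner_upper: "corner {(k, l). k \<ge> c \<and> l < e} (nat \<bar>e - c\<bar>)"
  unfolding corner_def
proof
  fix m :: nat
  show "\<exists>K. finite K \<and> card K \<le> m + nat \<bar>e - c\<bar> \<and> (\<forall>(k, l)\<in>{(k, l). k \<ge> c \<and> l < e}. \<bar>k - l\<bar> \<le> int m \<longrightarrow> k \<in> K)"
    by (rule exI[of _ "{c..<e + int m}"]) auto
qed

lemma corner_lower: "corner {(k, l). k < c \<and> l \<ge> e} (nat \<bar>e - c\<bar>)"
  unfolding corner_def
proof
  fix m :: nat
  show "\<exists>K. finite K \<and> card K \<le> m + nat \<bar>e - c\<bar> \<and> (\<forall>(k, l)\<in>{(k, l). k < c \<and> l \<ge> e}. \<bar>k - l\<bar> \<le> int m \<longrightarrow> k \<in> K)"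
    by (rule exI[of _ "{e - int m..<c}"]) auto
qed

lemma corner_finite:
  assumes "finite K"
  shows "corner (K \<times> UNIV) (card K)"
  unfolding corner_def
proof
  fix m :: nat
  show "\<exists>K'. finite K' \<and> card K' \<le> m + card K \<and> (\<forall>(k, l)\<in>K \<times> UNIV. \<bar>k - l\<bar> \<le> int m \<longrightarrow> k \<in> K')"
    by (rule exI[of _ K]) (use assms in auto)
qed

text \<open>A matrix that is supported in a corner and whose blocks are dominated by a function \<open>\<tau>\<close> of the number of the
  diagonal.\<close>

locale corner_matrix =
  fixes \<tau> :: "int \<Rightarrow> real" and Z :: "(int \<times> int) set" and d :: nat and X :: "(int \<times> 'n::finite) schur_matrix"
  assumes nonneg: "\<And>j. \<tau> j \<ge> 0"
    and weighted: "(\<lambda>j. (real_of_int \<bar>j\<bar> + 1) * \<tau> j) summable_on UNIV"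
    and corner: "corner Z d"
    and dominated: "\<And>p q. norm (entry X p q) \<le> \<tau> (fst p - fst q)"
    and support: "\<And>p q. (fst p, fst q) \<notin> Z \<Longrightarrow> entry X p q = 0"
begin

lemma summable_\<tau>: "\<tau> summable_on UNIV"
  by (rule summable_on_comparison_test[OF weighted]) (auto simp: nonneg distrib_right)

text \<open>The value \<open>\<tau> j\<close> occurs in at most \<open>|j| + d\<close> blocks.\<close>

lemma nuclear_corner: "nuclear X"
proof -
  define g where "g j k = (if (k, k - j) \<in> Z then \<tau> j else 0)" for j k
  have "(\<lambda>(j, k). g j k) summable_on UNIV \<times> UNIV"
  proof (rule summable_on_SigmaI)
    fix j
    obtain K where K: "finite K" "card K \<le> nat \<bar>j\<bar> + d" "\<And>k l. (k, l) \<in> Z \<Longrightarrow> \<bar>k - l\<bar> \<le> int (nat \<bar>j\<bar>) \<Longrightarrow> k \<in> K"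
      by (rule cornerE[OF corner, of "nat \<bar>j\<bar>"], rule that)
    have sub: "{k. (k, k - j) \<in> Z} \<subseteq> K" using K(3) by force
    then have fin: "finite {k. (k, k - j) \<in> Z}" using K(1) finite_subset by blast
    show "((\<lambda>k. case (j, k) of (j, k) \<Rightarrow> g j k) has_sum card {k. (k, k - j) \<in> Z} * \<tau> j) UNIV"
      unfolding case_prod_conv
    proof (rule has_sum_finite_neutralI[OF fin])
      show "card {k. (k, k - j) \<in> Z} * \<tau> j = sum (g j) {k. (k, k - j) \<in> Z}" by (simp add: g_def)
    qed (auto simp: g_def)
  next
    have "(\<lambda>j. (real d + 1) * ((real_of_int \<bar>j\<bar> + 1) * \<tau> j)) summable_on UNIV"
      by (rule summable_on_cmult_right[OF weighted])
    then show "(\<lambda>j. card {k. (k, k - j) \<in> Z} * \<tau> j) summable_on UNIV"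
    proof (rule summable_on_comparison_test)
      fix j
      obtain K where K: "finite K" "card K \<le> nat \<bar>j\<bar> + d" "\<And>k l. (k, l) \<in> Z \<Longrightarrow> \<bar>k - l\<bar> \<le> int (nat \<bar>j\<bar>) \<Longrightarrow> k \<in> K"
        by (rule cornerE[OF corner, of "nat \<bar>j\<bar>"], rule that)
      have "{k. (k, k - j) \<in> Z} \<subseteq> K" using K(3) by force
      then have "card {k. (k, k - j) \<in> Z} \<le> nat \<bar>j\<bar> + d" using K card_mono order_trans by blast
      then have "real (card {k. (k, k - j) \<in> Z}) \<le> real_of_int \<bar>j\<bar> + d" by linarith
      also have "\<dots> \<le> (real d + 1) * (real_of_int \<bar>j\<bar> + 1)" by (simp add: algebra_simps)
      finally have "real (card {k. (k, k - j) \<in> Z}) \<le> (real d + 1) * (real_of_int \<bar>j\<bar> + 1)" .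
      from mult_right_mono[OF this nonneg[of j]]
      show "card {k. (k, k - j) \<in> Z} * \<tau> j \<le> (real d + 1) * ((real_of_int \<bar>j\<bar> + 1) * \<tau> j)"
        by (simp add: mult.assoc)
    qed (auto simp: nonneg)
  qed (auto simp: g_def nonneg)
  then have g: "(\<lambda>z. g (fst z) (snd z)) summable_on UNIV" by (simp add: case_prod_unfold)
  have G: "(\<lambda>(z, t :: 'n \<times> 'n). g (fst z) (snd z)) summable_on UNIV \<times> UNIV"
  proof (rule summable_on_SigmaI)
    show "((\<lambda>t. case (z, t) of (z, t :: 'n \<times> 'n) \<Rightarrow> g (fst z) (snd z)) has_sum CARD('n \<times> 'n) * g (fst z) (snd z)) UNIV" for z
      by (rule has_sum_finiteI) auto
    show "(\<lambda>z. CARD('n \<times> 'n) * g (fst z) (snd z)) summable_on UNIV"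
      by (rule summable_on_cmult_right[OF g])
  qed (auto simp: g_def nonneg)
  let ?h = "\<lambda>(p :: int \<times> 'n, q :: int \<times> 'n). ((fst p - fst q, fst p), (snd p, snd q))"
  have "bij_betw ?h UNIV UNIV"
    by (rule bij_betwI[where g="\<lambda>((j, k), (i, i')). ((k, i), (k - j, i'))"]) auto
  from summable_on_reindex_bij_betw[OF this, of "\<lambda>(z, t). g (fst z) (snd z)"] G
  have "(\<lambda>(p :: int \<times> 'n, q :: int \<times> 'n). g (fst p - fst q) (fst p)) summable_on UNIV"
    by (simp add: case_prod_unfold)
  then show ?thesis
    unfolding nuclear_def entry_summable_def
    by (rule summable_on_comparison_test) (use dominated support in \<open>auto simp: g_def\<close>)
qed

text \<open>The rows of the corner that meet the band \<open>|k - l| \<le> m\<close> form a matrix of rank at most \<open>N (m + d)\<close>. In the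
  rest only diagonals with \<open>|j| > m\<close> occur, and \<open>\<Sum>\<^sub>m \<Sum>\<^sub>|\<^sub>j\<^sub>|\<^sub>>\<^sub>m \<tau> j = \<Sum>\<^sub>j |j| \<tau> j\<close> is finite.\<close>

lemma rank_approximable_corner: "rank_approximable X"
proof -
  define \<tau>' where "\<tau>' m j = (if \<bar>j\<bar> > int m then \<tau> j else 0)" for m j
  have \<tau>'_nonneg: "\<tau>' m j \<ge> 0" for m j by (simp add: \<tau>'_def nonneg)
  have \<tau>'_summable: "\<tau>' m summable_on UNIV" for m
    by (rule summable_on_comparison_test[OF summable_\<tau>]) (auto simp: \<tau>'_def nonneg)
  define \<epsilon> where "\<epsilon> m = CARD('n) * (\<Sum>\<^sub>\<infinity>j. \<tau>' m j)" for m
  have "summable (\<lambda>m. \<Sum>\<^sub>\<infinity>j. \<tau>' m j)"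
  proof (rule bounded_imp_summable)
    show "(\<Sum>\<^sub>\<infinity>j. \<tau>' m j) \<ge> 0" for m by (simp add: infsum_nonneg \<tau>'_nonneg)
    fix M
    have "(\<Sum>m\<le>M. \<Sum>\<^sub>\<infinity>j. \<tau>' m j) = (\<Sum>\<^sub>\<infinity>j. \<Sum>m\<le>M. \<tau>' m j)"
      by (rule infsumI[OF has_sum_finite_sum[OF _ has_sum_infsum[OF \<tau>'_summable]], symmetric]) simp
    also have "\<dots> \<le> (\<Sum>\<^sub>\<infinity>j. (real_of_int \<bar>j\<bar> + 1) * \<tau> j)"
    proof (rule infsum_mono[OF _ weighted])
      show "(\<lambda>j. \<Sum>m\<le>M. \<tau>' m j) summable_on UNIV"
        by (rule has_sum_imp_summable[OF has_sum_finite_sum[OF _ has_sum_infsum[OF \<tau>'_summable]]]) simp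
      fix j
      have "(\<Sum>m\<le>M. \<tau>' m j) = (\<Sum>m\<in>{m. m \<le> M \<and> int m < \<bar>j\<bar>}. \<tau> j)"
        by (rule sum.mono_neutral_cong_right) (auto simp: \<tau>'_def)
      also have "\<dots> = card {m. m \<le> M \<and> int m < \<bar>j\<bar>} * \<tau> j" by simp
      also have "\<dots> \<le> (real_of_int \<bar>j\<bar> + 1) * \<tau> j"
      proof (rule mult_right_mono[OF _ nonneg])
        have "card {m. m \<le> M \<and> int m < \<bar>j\<bar>} \<le> card {..<nat \<bar>j\<bar>}"
          by (rule card_mono) auto
        then show "real (card {m. m \<le> M \<and> int m < \<bar>j\<bar>}) \<le> real_of_int \<bar>j\<bar> + 1" by simp
      qed
      finally show "(\<Sum>m\<le>M. \<tau>' m j) \<le> (real_of_int \<bar>j\<bar> + 1) * \<tau> j" .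
    qed
    finally show "(\<Sum>m\<le>M. \<Sum>\<^sub>\<infinity>j. \<tau>' m j) \<le> (\<Sum>\<^sub>\<infinity>j. (real_of_int \<bar>j\<bar> + 1) * \<tau> j)" .
  qed
  then have "summable \<epsilon>" unfolding \<epsilon>_def by (rule summable_mult)
  moreover have "\<exists>Y. rank_le (operator_of Y) ((d + 1) * CARD('n) * Suc m) \<and> schur_bound (entry (X - Y)) (\<epsilon> m)" for m
  proof -
    obtain K where K: "finite K" "card K \<le> m + d" "\<And>k l. (k, l) \<in> Z \<Longrightarrow> \<bar>k - l\<bar> \<le> int m \<Longrightarrow> k \<in> K"
      by (rule cornerE[OF corner, of m], rule that)
    let ?Y = "row_proj K * X"
    have "rank_le (operator_of ?Y) (card (K \<times> (UNIV :: 'n set)))"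
      using K(1) by (intro rank_le_finite_rows) (auto simp: entry_row_proj_mult)
    moreover have "card (K \<times> (UNIV :: 'n set)) \<le> (d + 1) * CARD('n) * Suc m"
    proof -
      have "card K * CARD('n) \<le> ((d + 1) * Suc m) * CARD('n)"
        using K(2) by (intro mult_right_mono order_trans[OF K(2)]) auto
      then show ?thesis by (simp add: card_cartesian_product algebra_simps)
    qed
    ultimately have "rank_le (operator_of ?Y) ((d + 1) * CARD('n) * Suc m)" by (rule rank_le_mono)
    moreover have "schur_bound (entry (X - ?Y)) (\<epsilon> m)"
    proof -
      have "norm (entry (X - ?Y) p q) \<le> \<tau>' m (fst p - fst q)" for p q
        using K(3)[of "fst p" "fst q"] support[of p q] dominated[of p q]
        by (cases "(fst p, fst q) \<in> Z") (auto simp: entry_simps entry_row_proj_mult \<tau>'_def nonneg)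
      from toeplitz_dominated[OF \<tau>'_summable \<tau>'_nonneg this]
      show ?thesis unfolding schur_bound_def \<epsilon>_def by blast
    qed
    ultimately show ?thesis by blast
  qed
  ultimately show ?thesis unfolding rank_approximable_def by blast
qed

end

lemma infsum_blocks:
  fixes f :: "int \<times> 'n::finite \<Rightarrow> complex"
  assumes "f summable_on UNIV"
  shows "infsum f UNIV = (\<Sum>\<^sub>\<infinity>k. \<Sum>i\<in>UNIV. f (k, i))"
    and "(\<lambda>k. \<Sum>i\<in>UNIV. f (k, i)) summable_on UNIV"
proof -
  have "(\<lambda>(k, i). f (k, i)) summable_on UNIV \<times> UNIV" using assms by simp
  from infsum_Sigma'_banach[OF this] summable_on_Sigma_banach[OF this]
  show "infsum f UNIV = (\<Sum>\<^sub>\<infinity>k. \<Sum>i\<in>UNIV. f (k, i))" "(\<lambda>k. \<Sum>i\<in>UNIV. f (k, i)) summable_on UNIV"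
    by simp_all
qed

text \<open>Sorting the finite index sets by their size recovers the Fredholm series.\<close>

lemma perturbation_det_by_size:
  assumes "entry_summable M"
  shows "(\<lambda>m. \<Sum>\<^sub>\<infinity>S\<in>{S. finite S \<and> card S = m}. minor M S) sums perturbation_det M"
proof -
  let ?A = "\<lambda>m. {S :: 'a set. finite S \<and> card S = m}"
  have s: "minor M summable_on {S. finite S}"
    by (rule abs_summable_summable[OF minor_abs_summable[OF assms]])
  have bij: "bij_betw snd (Sigma UNIV ?A) {S. finite S}"
    by (rule bij_betwI[where g="\<lambda>S. (card S, S)"]) auto
  have s2: "(\<lambda>(m, S). minor M S) summable_on Sigma UNIV ?A"
    using s summable_on_reindex_bij_betw[OF bij, of "minor M"] by (simp add: case_prod_unfold)
  have "perturbation_det M = (\<Sum>\<^sub>\<infinity>(m, S)\<in>Sigma UNIV ?A. minor M S)"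
    unfolding perturbation_det_def
    using infsum_reindex_bij_betw[OF bij, of "minor M"] by (simp add: case_prod_unfold)
  also have "\<dots> = (\<Sum>\<^sub>\<infinity>m. \<Sum>\<^sub>\<infinity>S\<in>?A m. minor M S)"
    by (rule infsum_Sigma'_banach[OF s2, symmetric])
  finally show ?thesis
    using has_sum_imp_sums[OF has_sum_infsum[OF summable_on_Sigma_banach[OF s2]]] by simp
qed

text \<open>Membership in the trace class and the determinant are both determined by the values on \<open>ell2\<close>, which
  contains the basis sequences.\<close>

lemma fredholm_det_eq_schur_det:
  assumes X: "\<And>x. x \<in> ell2 \<Longrightarrow> T x = x + operator_of X x" and "nuclear X" "rank_approximable X"
  shows "determinant_class T" "fredholm_det T = schur_det (1 + X)"
proof -
  have T: "(T - id) x = operator_of X x" if "x \<in> ell2" for x using X[OF that] by simp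
  show "determinant_class T"
    unfolding determinant_class_def by (rule trace_class_rank_approximable[OF assms(3) T])
  have "matrix_entry (T - id) p q = matrix_entry (operator_of X) p q" for p q
    unfolding matrix_entry_def using T[OF basis_seq_ell2] by simp
  then have "matrix_entry (T - id) = entry X" by (simp add: fun_eq_iff matrix_entry_op)
  then have "exterior_trace (T - id) = (\<lambda>m. \<Sum>\<^sub>\<infinity>S\<in>{S. finite S \<and> card S = m}. minor (entry X) S)"
    unfolding exterior_trace_def principal_minor_def minor_def by simp
  then show "fredholm_det T = schur_det (1 + X)"
    using perturbation_det_by_size[of "entry X"] assms(2)
    by (simp add: fredholm_det_def schur_det_def nuclear_def sums_iff)
qed

section \<open>Laurent matrices\<close>

lemma has_sum_vec:
  fixes f :: "'a \<Rightarrow> complex^'n"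
  assumes "\<And>i. ((\<lambda>k. f k $ i) has_sum s $ i) A"
  shows "(f has_sum s) A"
  unfolding has_sum_def
proof (rule vec_tendstoI)
  show "((\<lambda>F. sum f F $ i) \<longlongrightarrow> s $ i) (finite_subsets_at_top A)" for i
    using assms[of i] unfolding has_sum_def by simp
qed

definition laurent_matrix :: "(int \<Rightarrow> 'n::finite \<Rightarrow> 'n \<Rightarrow> complex) \<Rightarrow> (int \<times> 'n) schur_matrix" where
  "laurent_matrix c = Schur_Matrix (\<lambda>p q. c (fst p - fst q) (snd p) (snd q))"

definition block_norm :: "(int \<Rightarrow> 'n::finite \<Rightarrow> 'n \<Rightarrow> complex) \<Rightarrow> int \<Rightarrow> real" where
  "block_norm c j = (\<Sum>i\<in>UNIV. \<Sum>i'\<in>UNIV. norm (c j i i'))"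

lemma block_norm_nonneg: "block_norm c j \<ge> 0"
  by (simp add: block_norm_def sum_nonneg)

lemma norm_le_block_norm: "norm (c j i i') \<le> block_norm c j"
proof -
  have "norm (c j i i') \<le> (\<Sum>i'\<in>UNIV. norm (c j i i'))" by (rule member_le_sum) auto
  also have "\<dots> \<le> block_norm c j" unfolding block_norm_def
    by (rule member_le_sum[of i UNIV "\<lambda>i. \<Sum>i'\<in>UNIV. norm (c j i i')"]) (auto simp: sum_nonneg)
  finally show ?thesis .
qed

lemma summable_block_norm:
  assumes "\<And>i i'. (\<lambda>j. g j * norm (c j i i')) summable_on UNIV"
  shows "(\<lambda>j. g j * block_norm c j) summable_on UNIV"
  unfolding block_norm_def sum_distrib_left
  by (rule has_sum_imp_summable[OF has_sum_finite_sum[OF finite_class.finite_UNIV has_sum_finite_sum[OF finite_class.finite_UNIV has_sum_infsum[OF assms]]]])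

lemma entry_laurent_matrix:
  fixes c :: "int \<Rightarrow> 'n::finite \<Rightarrow> 'n \<Rightarrow> complex"
  assumes "\<And>i i'. (\<lambda>j. norm (c j i i')) summable_on UNIV"
  shows "entry (laurent_matrix c) p q = c (fst p - fst q) (snd p) (snd q)"
proof -
  have "block_norm c summable_on UNIV" using summable_block_norm[of "\<lambda>_. 1" c] assms by simp
  from toeplitz_dominated[OF this block_norm_nonneg, of "\<lambda>p q. c (fst p - fst q) (snd p) (snd q)"]
  have "schur_bounded (\<lambda>p q. c (fst p - fst q) (snd p) (snd q))"
    unfolding schur_bounded_iff using norm_le_block_norm by blast
  then show ?thesis by (simp add: laurent_matrix_def entry_Schur_Matrix)
qed

lemma op_laurent_matrix:
  fixes c :: "int \<Rightarrow> 'n::finite \<Rightarrow> 'n \<Rightarrow> complex"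
  assumes s: "\<And>i i'. (\<lambda>j. norm (c j i i')) summable_on UNIV"
    and c: "\<And>j i i'. c j i i' = fourier_coeff f j $ i $ i'" and x: "x \<in> ell2"
  shows "laurent f x = operator_of (laurent_matrix c) x"
proof
  fix j
  have "((\<lambda>k. fourier_coeff f (j - k) *v x k) has_sum operator_of (laurent_matrix c) x j) UNIV"
  proof (rule has_sum_vec)
    fix i
    let ?g = "\<lambda>r. entry (laurent_matrix c) (j, i) r * coord x r"
    have g: "?g summable_on UNIV" by (rule abs_summable_summable[OF op_summable[OF x]])
    have "(\<lambda>k. \<Sum>i'\<in>UNIV. ?g (k, i')) = (\<lambda>k. (fourier_coeff f (j - k) *v x k) $ i)"
      by (simp add: entry_laurent_matrix[OF s] c matrix_vector_mult_def)
    moreover have "((\<lambda>k. \<Sum>i'\<in>UNIV. ?g (k, i')) has_sum infsum ?g UNIV) UNIV"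
      using infsum_blocks[OF g] by (simp add: has_sum_iff)
    ultimately show "((\<lambda>k. (fourier_coeff f (j - k) *v x k) $ i) has_sum operator_of (laurent_matrix c) x j $ i) UNIV"
      by (simp add: operator_of_def)
  qed
  then show "laurent f x j = operator_of (laurent_matrix c) x j"
    unfolding laurent_def by (rule infsumI)
qed

text \<open>An entry of the product is a convolution of the two coefficient families.\<close>

lemma laurent_matrix_inverse:
  fixes c d :: "int \<Rightarrow> 'n::finite \<Rightarrow> 'n \<Rightarrow> complex"
  assumes c: "\<And>i i'. (\<lambda>j. norm (c j i i')) summable_on UNIV" and d: "\<And>i i'. (\<lambda>j. norm (d j i i')) summable_on UNIV"
    and conv: "\<And>k i j. ((\<lambda>m. \<Sum>l\<in>UNIV. c m i l * d (k - m) l j) has_sum (if k = 0 \<and> i = j then 1 else 0)) UNIV"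
  shows "laurent_matrix c * laurent_matrix d = 1"
proof (rule schur_matrix_eqI)
  fix p q :: "int \<times> 'n"
  obtain k i where p: "p = (k, i)" by (cases p)
  obtain l j where q: "q = (l, j)" by (cases q)
  let ?g = "\<lambda>r. entry (laurent_matrix c) p r * entry (laurent_matrix d) r q"
  obtain b where "\<And>r. norm (entry (laurent_matrix d) r q) \<le> b" using entry_bounded by metis
  then have g: "?g summable_on UNIV"
    by (rule abs_summable_summable[OF schur_row_summable[OF schur_bounded_entry]])
  have bij: "bij_betw (\<lambda>m. k - m) UNIV UNIV" by (rule bij_betwI[where g="\<lambda>m. k - m"]) auto
  have "entry (laurent_matrix c * laurent_matrix d) p q = (\<Sum>\<^sub>\<infinity>m. \<Sum>i'\<in>UNIV. ?g (m, i'))"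
    unfolding entry_mult by (rule infsum_blocks[OF g])
  also have "\<dots> = (\<Sum>\<^sub>\<infinity>m. \<Sum>i'\<in>UNIV. c (k - m) i i' * d (m - l) i' j)"
    by (simp add: entry_laurent_matrix[OF c] entry_laurent_matrix[OF d] p q)
  also have "\<dots> = (\<Sum>\<^sub>\<infinity>m. \<Sum>i'\<in>UNIV. c m i i' * d (k - l - m) i' j)"
    using infsum_reindex_bij_betw[OF bij, of "\<lambda>m. \<Sum>i'\<in>UNIV. c m i i' * d (k - l - m) i' j"]
    by (simp add: algebra_simps)
  also have "\<dots> = (if k - l = 0 \<and> i = j then 1 else 0)"
    by (rule infsumI[OF conv])
  finally show "entry (laurent_matrix c * laurent_matrix d) p q = entry 1 p q"
    by (simp add: entry_simps p q)
qed

lemma schur_trace_blocks: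
  fixes X :: "(int \<times> 'n::finite) schur_matrix"
  assumes "nuclear X"
  shows "schur_trace X = (\<Sum>\<^sub>\<infinity>k. \<Sum>i\<in>UNIV. entry X (k, i) (k, i))"
proof -
  have "(\<lambda>z. norm (entry X (fst z) (snd z))) summable_on range (\<lambda>r. (r, r))"
    using assms unfolding nuclear_def entry_summable_def case_prod_unfold
    by (rule summable_on_subset_banach) simp
  then have "(\<lambda>r. norm (entry X r r)) summable_on UNIV"
    by (subst (asm) summable_on_reindex) (auto simp: inj_on_def o_def)
  then have "(\<lambda>r. entry X r r) summable_on UNIV" by (rule abs_summable_summable)
  from infsum_blocks(1)[OF this] show ?thesis by (simp add: schur_trace_def)
qed

text \<open>Summation by parts over the integers. For \<open>x \<ge> 0\<close> the summand is the sum of \<open>c m\<close> over \<open>m > x\<close>, for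
  \<open>x < 0\<close> the negative of the sum over \<open>m \<le> x\<close>; so \<open>c m\<close> is counted \<open>m\<close> times in total, with the sign of \<open>m\<close>.\<close>

lemma infsum_partial_sums:
  fixes c :: "int \<Rightarrow> complex"
  assumes c: "(\<lambda>m. (real_of_int \<bar>m\<bar> + 1) * norm (c m)) summable_on UNIV"
  shows "((\<lambda>x. (if x \<ge> 0 then \<Sum>\<^sub>\<infinity>m. c m else 0) - (\<Sum>\<^sub>\<infinity>m\<in>{..x}. c m)) has_sum (\<Sum>\<^sub>\<infinity>m. of_int m * c m)) UNIV"
proof -
  have norm: "(\<lambda>m. norm (c m)) summable_on UNIV"
    by (rule summable_on_comparison_test[OF c]) (auto simp: distrib_right)
  then have cs: "c summable_on A" for A
    using abs_summable_summable summable_on_subset_banach by blast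
  define h where "h m x = (if 0 \<le> x \<and> x < m then c m else if m \<le> x \<and> x < 0 then - c m else 0)" for m x
  have col: "(h m has_sum of_int m * c m) UNIV" for m
  proof (cases "m \<ge> 0")
    case True
    show ?thesis
    proof (rule has_sum_finite_neutralI[of "{0..<m}"])
      have "sum (h m) {0..<m} = (\<Sum>x\<in>{0..<m}. c m)" by (rule sum.cong) (auto simp: h_def)
      then show "of_int m * c m = sum (h m) {0..<m}" using True by simp
    qed (use True in \<open>auto simp: h_def\<close>)
  next
    case False
    show ?thesis
    proof (rule has_sum_finite_neutralI[of "{m..<0}"])
      have "sum (h m) {m..<0} = (\<Sum>x\<in>{m..<0}. - c m)" by (rule sum.cong) (auto simp: h_def)
      then show "of_int m * c m = sum (h m) {m..<0}" using False by simp
    qed (use False in \<open>auto simp: h_def\<close>)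
  qed
  have norm_col: "((\<lambda>x. norm (h m x)) has_sum real_of_int \<bar>m\<bar> * norm (c m)) UNIV" for m
  proof (cases "m \<ge> 0")
    case True
    show ?thesis
    proof (rule has_sum_finite_neutralI[of "{0..<m}"])
      have "(\<Sum>x\<in>{0..<m}. norm (h m x)) = (\<Sum>x\<in>{0..<m}. norm (c m))" by (rule sum.cong) (auto simp: h_def)
      then show "real_of_int \<bar>m\<bar> * norm (c m) = (\<Sum>x\<in>{0..<m}. norm (h m x))" using True by simp
    qed (use True in \<open>auto simp: h_def\<close>)
  next
    case False
    show ?thesis
    proof (rule has_sum_finite_neutralI[of "{m..<0}"])
      have "(\<Sum>x\<in>{m..<0}. norm (h m x)) = (\<Sum>x\<in>{m..<0}. norm (c m))" by (rule sum.cong) (auto simp: h_def)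
      then show "real_of_int \<bar>m\<bar> * norm (c m) = (\<Sum>x\<in>{m..<0}. norm (h m x))" using False by simp
    qed (use False in \<open>auto simp: h_def\<close>)
  qed
  have "(\<lambda>(m, x). norm (h m x)) summable_on UNIV \<times> UNIV"
  proof (rule summable_on_SigmaI)
    show "((\<lambda>x. case (m, x) of (m, x) \<Rightarrow> norm (h m x)) has_sum real_of_int \<bar>m\<bar> * norm (c m)) UNIV" for m
      using norm_col by simp
    show "(\<lambda>m. real_of_int \<bar>m\<bar> * norm (c m)) summable_on UNIV"
      by (rule summable_on_comparison_test[OF c]) (auto simp: distrib_right)
  qed auto
  then have s: "(\<lambda>(m, x). h m x) summable_on UNIV \<times> UNIV"
    using abs_summable_summable[of "\<lambda>(m, x). h m x"] by (simp add: case_prod_unfold)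
  then have s': "(\<lambda>(x, m). h m x) summable_on UNIV \<times> UNIV"
    by (subst summable_on_swap) simp
  have row: "((\<lambda>m. h m x) has_sum (if x \<ge> 0 then \<Sum>\<^sub>\<infinity>m. c m else 0) - (\<Sum>\<^sub>\<infinity>m\<in>{..x}. c m)) UNIV" for x
  proof (cases "x \<ge> 0")
    case True
    have "infsum c UNIV = infsum c {..x} + infsum c {x<..}"
    proof -
      have "{..x} \<union> {x<..} = UNIV" "{..x} \<inter> {x<..} = {}" by auto
      then show ?thesis using infsum_Un_disjoint[OF cs cs, of "{..x}" "{x<..}"] by simp
    qed
    then have "infsum c {x<..} = infsum c UNIV - infsum c {..x}" by simp
    then have "(c has_sum (infsum c UNIV - infsum c {..x})) {x<..}" using cs by (simp add: has_sum_iff)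
    moreover have "(c has_sum v) {x<..} \<longleftrightarrow> ((\<lambda>m. h m x) has_sum v) UNIV" for v
      by (rule has_sum_cong_neutral) (use True in \<open>auto simp: h_def\<close>)
    ultimately show ?thesis using True by simp
  next
    case False
    have "((\<lambda>m. - c m) has_sum - infsum c {..x}) {..x}" using cs by (intro has_sum_uminusI has_sum_infsum)
    moreover have "((\<lambda>m. - c m) has_sum v) {..x} \<longleftrightarrow> ((\<lambda>m. h m x) has_sum v) UNIV" for v
      by (rule has_sum_cong_neutral) (use False in \<open>auto simp: h_def\<close>)
    ultimately show ?thesis using False by simp
  qed
  have "((\<lambda>(x, m). h m x) has_sum (\<Sum>\<^sub>\<infinity>x. \<Sum>\<^sub>\<infinity>m. h m x)) (UNIV \<times> UNIV)"
    using s' infsum_Sigma'_banach[OF s'] by (simp add: has_sum_iff)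
  moreover have "(\<Sum>\<^sub>\<infinity>x. \<Sum>\<^sub>\<infinity>m. h m x) = (\<Sum>\<^sub>\<infinity>m. of_int m * c m)"
    using infsum_swap_banach[OF s] infsumI[OF col] by simp
  ultimately have "((\<lambda>(x, m). h m x) has_sum (\<Sum>\<^sub>\<infinity>m. of_int m * c m)) (UNIV \<times> UNIV)" by simp
  then show ?thesis by (rule has_sum_SigmaD) (use row in simp)
qed

section \<open>The determinant identities\<close>

lemma scale_seq_diff: "scale_seq s (x - y) = scale_seq s x - scale_seq s y"
  by (simp add: scale_seq_def fun_eq_iff vec_eq_iff right_diff_distrib)

lemma scale_seq_minus: "scale_seq (- s) x = - scale_seq s x"
  by (simp add: scale_seq_def fun_eq_iff vec_eq_iff)

abbreviation half_proj :: "int \<Rightarrow> (int \<times> 'n::finite) schur_matrix" where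
  "half_proj n \<equiv> row_proj {n..}"

lemma proj_Qn_eq_op: "proj_Qn n x = operator_of (half_proj n) x"
  by (simp add: proj_Qn_def op_row_proj)

lemma proj_P_eq_op: "proj_P x = operator_of (half_proj 0) x"
  by (simp add: proj_P_def op_row_proj)

lemma op_one_minus: "x \<in> ell2 \<Longrightarrow> x - operator_of X x = operator_of (1 - X) x"
  by (simp only: op_minus op_one)

context invertible_symbol
begin

definition A :: "(int \<times> 'n) schur_matrix" where "A = laurent_matrix a_coeff"

definition B :: "(int \<times> 'n) schur_matrix" where "B = laurent_matrix b_coeff"

lemma entry_A: "entry A p q = a_coeff (fst p - fst q) (snd p) (snd q)"
  unfolding A_def by (rule entry_laurent_matrix[OF summable_a_coeff])

lemma entry_B: "entry B p q = b_coeff (fst p - fst q) (snd p) (snd q)"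
  unfolding B_def by (rule entry_laurent_matrix[OF summable_b_coeff])

lemma laurent_a: "x \<in> ell2 \<Longrightarrow> laurent a x = operator_of A x"
  unfolding A_def by (rule op_laurent_matrix[OF summable_a_coeff a_coeff_def])

lemma laurent_b: "x \<in> ell2 \<Longrightarrow> laurent b x = operator_of B x"
  unfolding B_def by (rule op_laurent_matrix[OF summable_b_coeff b_coeff_def])

lemma AB: "A * B = 1"
  unfolding A_def B_def by (rule laurent_matrix_inverse[OF summable_a_coeff summable_b_coeff ab_coeff])

lemma BA: "B * A = 1"
  unfolding A_def B_def by (rule laurent_matrix_inverse[OF summable_b_coeff summable_a_coeff ba_coeff])

lemma norm_entry_A: "norm (entry A p q) \<le> block_norm a_coeff (fst p - fst q)"
  unfolding entry_A by (rule norm_le_block_norm)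

lemma corner_matrix_upper:
  "corner_matrix (block_norm a_coeff) {(k, l). k \<ge> c \<and> l < e} (nat \<bar>e - c\<bar>) (half_proj c * A * (1 - half_proj e))"
proof
  have e: "entry (half_proj c * A * (1 - half_proj e)) p q = (if fst p \<ge> c \<and> fst q < e then entry A p q else 0)" for p q
    by (auto simp: right_diff_distrib entry_simps entry_mult_row_proj entry_row_proj_mult)
  show "norm (entry (half_proj c * A * (1 - half_proj e)) p q) \<le> block_norm a_coeff (fst p - fst q)" for p q
    unfolding e using norm_entry_A[of p q] by (auto simp: block_norm_nonneg)
  show "entry (half_proj c * A * (1 - half_proj e)) p q = 0" if "(fst p, fst q) \<notin> {(k, l). k \<ge> c \<and> l < e}" for p q
    unfolding e using that by auto
qed (rule block_norm_nonneg corner_upper summable_block_norm[OF summable_weighted_a_coeff])+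

lemma corner_matrix_lower:
  "corner_matrix (block_norm a_coeff) {(k, l). k < c \<and> l \<ge> e} (nat \<bar>e - c\<bar>) ((1 - half_proj c) * A * half_proj e)"
proof
  have e: "entry ((1 - half_proj c) * A * half_proj e) p q = (if fst p < c \<and> fst q \<ge> e then entry A p q else 0)" for p q
    by (auto simp: left_diff_distrib entry_simps entry_mult_row_proj entry_row_proj_mult)
  show "norm (entry ((1 - half_proj c) * A * half_proj e) p q) \<le> block_norm a_coeff (fst p - fst q)" for p q
    unfolding e using norm_entry_A[of p q] by (auto simp: block_norm_nonneg)
  show "entry ((1 - half_proj c) * A * half_proj e) p q = 0" if "(fst p, fst q) \<notin> {(k, l). k < c \<and> l \<ge> e}" for p q
    unfolding e using that by auto
qed (rule block_norm_nonneg corner_lower summable_block_norm[OF summable_weighted_a_coeff])+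

text \<open>The difference of the two projections is diagonal and has finitely many nonzero rows, so it is a corner
  with the coefficients of the constant function 1.\<close>

lemma corner_matrix_difference:
  fixes n :: int
  defines "K \<equiv> {min 0 n..<max 0 n}"
  shows "corner_matrix (\<lambda>j. if j = 0 then 1 else 0) (K \<times> UNIV) (card K) (half_proj 0 - half_proj n :: (int \<times> 'n) schur_matrix)"
proof
  show "corner (K \<times> UNIV) (card K)" by (rule corner_finite) (simp add: K_def)
  show "(\<lambda>j. (real_of_int \<bar>j\<bar> + 1) * (if j = 0 then 1 else 0)) summable_on UNIV"
    by (rule finite_nonzero_values_imp_summable_on, rule finite_subset[of _ "{0}"]) auto
  show "norm (entry (half_proj 0 - half_proj n :: (int \<times> 'n) schur_matrix) p q) \<le> (if fst p - fst q = 0 then 1 else 0)" for p q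
    by (auto simp: entry_simps entry_row_proj)
  show "entry (half_proj 0 - half_proj n :: (int \<times> 'n) schur_matrix) p q = 0" if "(fst p, fst q) \<notin> K \<times> UNIV" for p q
    using that by (auto simp: entry_simps entry_row_proj K_def)
qed simp

definition q :: "int \<Rightarrow> (int \<times> 'n) schur_matrix" where
  "q n = A * half_proj n * B"

lemma q_idem: "q n * q n = q n"
proof -
  have "q n * q n = A * half_proj n * (B * A) * half_proj n * B" by (simp add: q_def mult.assoc)
  also have "\<dots> = A * (half_proj n * half_proj n) * B" unfolding BA by (simp add: mult.assoc)
  finally show ?thesis unfolding row_proj_idem q_def .
qed

text \<open>\<open>L(a) Q\<^sub>n L(b) = Q\<^sub>n - [Q\<^sub>n, L(a)] L(b)\<close>, and the commutator of \<open>L(a)\<close> with a projection is the difference of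
  two Hankel corners.\<close>

lemma difference_decomposition:
  "half_proj 0 - q n = (half_proj 0 - half_proj n) + (half_proj n * A * (1 - half_proj n)) * B
     + smul (- 1) (((1 - half_proj n) * A * half_proj n) * B)"
proof -
  have "half_proj n * A * (1 - half_proj n) - (1 - half_proj n) * A * half_proj n = half_proj n * A - A * half_proj n"
    by (simp add: algebra_simps)
  then have "(half_proj n * A * (1 - half_proj n)) * B - ((1 - half_proj n) * A * half_proj n) * B = half_proj n * (A * B) - q n"
    by (simp only: left_diff_distrib[symmetric]) (simp add: left_diff_distrib q_def mult.assoc)
  then show ?thesis unfolding AB by (simp add: smul_simps algebra_simps)
qed

lemma nuclear_difference: "nuclear (half_proj 0 - q n)"
  unfolding difference_decomposition
  by (intro nuclear_add nuclear_smul nuclear_mult_left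
      corner_matrix.nuclear_corner[OF corner_matrix_difference]
      corner_matrix.nuclear_corner[OF corner_matrix_upper] corner_matrix.nuclear_corner[OF corner_matrix_lower])

lemma rank_approximable_difference: "rank_approximable (half_proj 0 - q n)"
  unfolding difference_decomposition
  by (intro rank_approximable_add rank_approximable_smul rank_approximable_mult_right
      corner_matrix.rank_approximable_corner[OF corner_matrix_difference]
      corner_matrix.rank_approximable_corner[OF corner_matrix_upper]
      corner_matrix.rank_approximable_corner[OF corner_matrix_lower])

definition c :: "int \<Rightarrow> complex" where
  "c m = (\<Sum>i\<in>UNIV. \<Sum>l\<in>UNIV. a_coeff m i l * b_coeff (- m) l i)"

lemma summable_weighted_c: "(\<lambda>m. (real_of_int \<bar>m\<bar> + 1) * norm (c m)) summable_on UNIV"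
proof -
  define \<beta> where "\<beta> l i = (\<Sum>\<^sub>\<infinity>m. norm (b_coeff m l i))" for l i
  have \<beta>: "norm (b_coeff m l i) \<le> \<beta> l i" for m l i
    unfolding \<beta>_def using finite_sum_le_infsum[OF summable_b_coeff[of l i], of "{m}"] by simp
  have "(\<lambda>m. \<Sum>i\<in>UNIV. \<Sum>l\<in>UNIV. (real_of_int \<bar>m\<bar> + 1) * norm (a_coeff m i l) * \<beta> l i) summable_on UNIV"
    by (rule has_sum_imp_summable[OF has_sum_finite_sum[OF finite_class.finite_UNIV
      has_sum_finite_sum[OF finite_class.finite_UNIV has_sum_infsum[OF summable_on_cmult_left[OF summable_weighted_a_coeff]]]]])
  then show ?thesis
  proof (rule summable_on_comparison_test)
    fix m :: int
    have "norm (c m) \<le> (\<Sum>i\<in>UNIV. \<Sum>l\<in>UNIV. norm (a_coeff m i l) * \<beta> l i)"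
      unfolding c_def
      by (intro order_trans[OF norm_sum] sum_mono) (auto simp: norm_mult intro!: sum_mono order_trans[OF norm_sum] mult_left_mono \<beta>)
    then have "(real_of_int \<bar>m\<bar> + 1) * norm (c m) \<le> (real_of_int \<bar>m\<bar> + 1) * (\<Sum>i\<in>UNIV. \<Sum>l\<in>UNIV. norm (a_coeff m i l) * \<beta> l i)"
      by (rule mult_left_mono) simp
    then show "(real_of_int \<bar>m\<bar> + 1) * norm (c m) \<le> (\<Sum>i\<in>UNIV. \<Sum>l\<in>UNIV. (real_of_int \<bar>m\<bar> + 1) * norm (a_coeff m i l) * \<beta> l i)"
      by (simp add: sum_distrib_left mult.assoc)
  qed auto
qed

lemma infsum_c: "(\<Sum>\<^sub>\<infinity>m. c m) = of_nat CARD('n)"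
proof -
  have "((\<lambda>m. \<Sum>l\<in>UNIV. a_coeff m i l * b_coeff (- m) l i) has_sum 1) UNIV" for i
    using ab_coeff[of i 0 i] by simp
  from has_sum_finite_sum[OF finite_class.finite_UNIV this]
  show ?thesis unfolding c_def by (intro infsumI) simp
qed

text \<open>The diagonal entries of \<open>L(a) Q\<^sub>n L(b)\<close> are incomplete convolutions at zero; the complete one is the
  identity matrix, whose trace appears in \<open>infsum_c\<close>.\<close>

lemma diagonal_q: "(\<Sum>i\<in>UNIV. entry (q n) (k, i) (k, i)) = (\<Sum>\<^sub>\<infinity>m\<in>{..k - n}. c m)"
proof -
  let ?g = "\<lambda>i r. entry (A * half_proj n) (k, i) r * entry B r (k, i)"
  have g: "?g i summable_on UNIV" for i
  proof -
    obtain b where "\<And>r. norm (entry B r (k, i)) \<le> b" using entry_bounded[of B] by blast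
    then show ?thesis
      by (rule abs_summable_summable[OF schur_row_summable[OF schur_bounded_entry]])
  qed
  have "((\<lambda>m. \<Sum>l\<in>UNIV. ?g i (m, l)) has_sum entry (q n) (k, i) (k, i)) UNIV" for i
    using infsum_blocks[OF g[of i]] by (simp add: q_def entry_mult[of "A * half_proj n"] has_sum_iff)
  from has_sum_finite_sum[OF finite_class.finite_UNIV this]
  have "((\<lambda>m. \<Sum>i\<in>UNIV. \<Sum>l\<in>UNIV. ?g i (m, l)) has_sum (\<Sum>i\<in>UNIV. entry (q n) (k, i) (k, i))) UNIV" .
  moreover have "(\<Sum>i\<in>UNIV. \<Sum>l\<in>UNIV. ?g i (m, l)) = (if k - m \<in> {..k - n} then c (k - m) else 0)" for m
    by (auto simp: entry_mult_row_proj entry_A entry_B c_def)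
  ultimately have 1: "((\<lambda>m. if k - m \<in> {..k - n} then c (k - m) else 0) has_sum (\<Sum>i\<in>UNIV. entry (q n) (k, i) (k, i))) UNIV"
    by simp
  have bij: "bij_betw (\<lambda>m. k - m) UNIV UNIV" by (rule bij_betwI[where g="\<lambda>m. k - m"]) auto
  have "((\<lambda>m. if m \<in> {..k - n} then c m else 0) has_sum (\<Sum>i\<in>UNIV. entry (q n) (k, i) (k, i))) UNIV"
    using 1 has_sum_reindex_bij_betw[OF bij, of "\<lambda>m. if m \<in> {..k - n} then c m else 0"] by simp
  then have "(\<Sum>i\<in>UNIV. entry (q n) (k, i) (k, i)) = (\<Sum>\<^sub>\<infinity>m. if m \<in> {..k - n} then c m else 0)"
    by (simp add: infsumI)
  also have "\<dots> = (\<Sum>\<^sub>\<infinity>m\<in>{..k - n}. c m)"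
    by (rule infsum_cong_neutral) auto
  finally show ?thesis .
qed

text \<open>The trace over block \<open>k\<close> is split into that of \<open>P - Q\<^sub>n\<close>, which sums to \<open>n N\<close>, and a partial sum of the
  kind treated in \<open>infsum_partial_sums\<close> at \<open>k - n\<close>.\<close>

lemma trace_difference: "schur_trace (half_proj 0 - q n) = of_int (n * int CARD('n) + w)"
proof -
  let ?N = "of_nat CARD('n) :: complex"
  let ?f = "\<lambda>x. (if x \<ge> 0 then ?N else 0) - (\<Sum>\<^sub>\<infinity>m\<in>{..x}. c m)"
  let ?h = "\<lambda>k. (if k \<ge> 0 then ?N else 0) - (if k \<ge> n then ?N else 0)"
  have f': "(?f has_sum of_int w) UNIV"
    using infsum_partial_sums[OF summable_weighted_c] infsumI[OF winding_coeff[folded c_def]]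
    unfolding infsum_c by simp
  have bij: "bij_betw (\<lambda>k. k - n) UNIV UNIV" by (rule bij_betwI[where g="\<lambda>k. k + n"]) auto
  have f: "((\<lambda>k. ?f (k - n)) has_sum of_int w) UNIV"
    using has_sum_reindex_bij_betw[OF bij, of ?f] f' by blast
  have h: "(?h has_sum ?N * of_int n) UNIV"
  proof (cases "n \<ge> 0")
    case True
    have "sum ?h {0..<n} = (\<Sum>k\<in>{0..<n}. ?N)" by (rule sum.cong) auto
    then have "?N * of_int n = sum ?h {0..<n}" using True by simp
    then show ?thesis using True by (intro has_sum_finite_neutralI[of "{0..<n}"]) auto
  next
    case False
    have "sum ?h {n..<0} = (\<Sum>k\<in>{n..<0}. - ?N)" by (rule sum.cong) auto
    then have "?N * of_int n = sum ?h {n..<0}" using False by simp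
    then show ?thesis using False by (intro has_sum_finite_neutralI[of "{n..<0}"]) auto
  qed
  have "(\<Sum>i\<in>UNIV. entry (half_proj 0 - q n) (k, i) (k, i)) = ?h k + ?f (k - n)" for k
    by (simp add: entry_simps sum_subtractf diagonal_q entry_row_proj)
  then have "((\<lambda>k. \<Sum>i\<in>UNIV. entry (half_proj 0 - q n) (k, i) (k, i)) has_sum ?N * of_int n + of_int w) UNIV"
    using has_sum_add[OF h f] by simp
  then show ?thesis
    unfolding schur_trace_blocks[OF nuclear_difference] by (simp add: infsumI mult.commute)
qed

lemma nuclear_pair: "nuclear_pair (half_proj 0) (q n)"
  by unfold_locales (rule row_proj_idem q_idem nuclear_difference)+

lemma nuclear_pair_swap: "nuclear_pair (q n) (half_proj 0)"
proof
  have "q n - half_proj 0 = smul (- 1) (half_proj 0 - q n)" by (simp add: smul_simps)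
  then show "nuclear (q n - half_proj 0)" using nuclear_smul[OF nuclear_difference] by metis
qed (rule row_proj_idem q_idem)+

lemma trace_difference_swap: "schur_trace (q n - half_proj 0) = of_int (- n * int CARD('n) - w)"
proof -
  have "schur_trace (q n - half_proj 0) = (\<Sum>\<^sub>\<infinity>r. - entry (half_proj 0 - q n) r r)"
    unfolding schur_trace_def by (simp add: entry_simps)
  also have "\<dots> = - schur_trace (half_proj 0 - q n)"
    unfolding schur_trace_def by (rule infsum_uminus)
  finally show ?thesis by (simp add: trace_difference)
qed

definition T1_matrix :: "int \<Rightarrow> (int \<times> 'n) schur_matrix" where
  "T1_matrix n = half_proj n * B * ((1 - half_proj 0) * A * half_proj n)"

definition T2_matrix :: "int \<Rightarrow> (int \<times> 'n) schur_matrix" where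
  "T2_matrix n = (1 - half_proj n) * B * (half_proj 0 * A * (1 - half_proj n))"

lemma nuclear_T_matrix: "nuclear (T1_matrix n)" "nuclear (T2_matrix n)"
  unfolding T1_matrix_def T2_matrix_def
  by (intro nuclear_mult_right corner_matrix.nuclear_corner[OF corner_matrix_lower] corner_matrix.nuclear_corner[OF corner_matrix_upper])+

lemma rank_approximable_T_matrix: "rank_approximable (T1_matrix n)" "rank_approximable (T2_matrix n)"
  unfolding T1_matrix_def T2_matrix_def
  by (intro rank_approximable_mult_left corner_matrix.rank_approximable_corner[OF corner_matrix_lower]
      corner_matrix.rank_approximable_corner[OF corner_matrix_upper])+

text \<open>\<open>(1 - P) q = X Y\<close> and \<open>T1_matrix = Y X\<close>, where \<open>X\<close> is a corner of \<open>L(a)\<close> and \<open>Y = Q\<^sub>n L(b)\<close>.\<close>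

lemma schur_det_T1_matrix: "schur_det (1 - smul t ((1 - half_proj 0) * q n)) = schur_det (1 + smul (- t) (T1_matrix n))"
proof -
  let ?X = "(1 - half_proj 0) * A * half_proj n" and ?Y = "half_proj n * B"
  have "?X * ?Y = (1 - half_proj 0) * A * (half_proj n * half_proj n) * B" by (simp only: mult.assoc)
  also have "\<dots> = (1 - half_proj 0) * q n" unfolding row_proj_idem q_def by (simp only: mult.assoc)
  finally have XY: "?X * ?Y = (1 - half_proj 0) * q n" .
  have "nuclear (smul (- t) ?X)"
    by (intro nuclear_smul corner_matrix.nuclear_corner[OF corner_matrix_lower])
  from schur_det_swap[OF this, of ?Y]
  have "schur_det (1 + smul (- t) (?X * ?Y)) = schur_det (1 + smul (- t) (?Y * ?X))"
    by (simp only: smul_mult_left smul_mult_right)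
  then show ?thesis unfolding XY T1_matrix_def by (simp add: smul_simps)
qed

text \<open>Two exchanges of factors. The matrix \<open>(1 - q) P\<close> is nuclear as \<open>(P - q) P\<close>, although its factor
  \<open>(1 - Q\<^sub>n) L(b) P\<close> is a corner of \<open>L(b)\<close>. Moving \<open>P\<close> to the left brings out the corner
  \<open>P L(a) (1 - Q\<^sub>n)\<close>, which is nuclear by itself, and that corner is then moved to the right.\<close>

lemma schur_det_T2_matrix: "schur_det (1 - smul t ((1 - q n) * half_proj 0)) = schur_det (1 + smul (- t) (T2_matrix n))"
proof -
  let ?R = "1 - half_proj n :: (int \<times> 'n) schur_matrix" and ?P = "half_proj 0 :: (int \<times> 'n) schur_matrix"
  let ?X = "(1 - q n) * ?P" and ?C = "?P * A * ?R" and ?Y = "?R * B * ?P"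
  have R: "?R * ?R = ?R" by (simp add: algebra_simps row_proj_idem)
  have P: "?P * (?P * x) = ?P * x" for x by (simp add: mult.assoc[symmetric] row_proj_idem)
  have XP: "?X * ?P = ?X" by (simp add: mult.assoc row_proj_idem)
  have "1 - q n = A * ?R * B"
    unfolding q_def using AB by (simp add: algebra_simps mult.assoc)
  then have PX: "?P * ?X = ?C * ?Y"
    using R by (metis (no_types, lifting) mult.assoc)
  have "?X = (half_proj 0 - q n) * ?P" by (simp add: left_diff_distrib row_proj_idem)
  then have X: "nuclear ?X" using nuclear_mult_left[OF nuclear_difference] by simp
  have C: "nuclear ?C" by (rule corner_matrix.nuclear_corner[OF corner_matrix_upper])
  have "schur_det (1 + smul (- t) ?X) = schur_det (1 + smul (- t) (?P * ?X))"
    using schur_det_swap[OF nuclear_smul[OF X, of "- t"], of ?P]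
    by (simp only: smul_mult_left smul_mult_right XP)
  also have "\<dots> = schur_det (1 + smul (- t) (?Y * ?C))"
    unfolding PX using schur_det_swap[OF nuclear_smul[OF C, of "- t"], of ?Y]
    by (simp only: smul_mult_left smul_mult_right)
  also have "?Y * ?C = T2_matrix n" unfolding T2_matrix_def by (simp only: mult.assoc P)
  finally show ?thesis by (simp add: smul_simps)
qed

lemma determinants:
  fixes s :: complex and n :: int
  defines "T \<equiv> id + s *\<^sub>o proj_P - s *\<^sub>o (laurent a \<circ> proj_Qn n \<circ> laurent b)"
    and "T1 \<equiv> id - s\<^sup>2 *\<^sub>o (proj_Qn n \<circ> laurent b \<circ> proj_Q \<circ> laurent a \<circ> proj_Qn n)"
    and "T2 \<equiv> id - s\<^sup>2 *\<^sub>o ((id - proj_Qn n) \<circ> laurent b \<circ> proj_P \<circ> laurent a \<circ> (id - proj_Qn n))"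
  shows "determinant_class T" "fredholm_det T = schur_det (1 + smul s (half_proj 0 - q n))"
    "determinant_class T1" "fredholm_det T1 = schur_det (1 + smul (- s\<^sup>2) (T1_matrix n))"
    "determinant_class T2" "fredholm_det T2 = schur_det (1 + smul (- s\<^sup>2) (T2_matrix n))"
proof -
  have T: "T x = x + operator_of (smul s (half_proj 0 - q n)) x" if x: "x \<in> ell2" for x
  proof -
    have "laurent a (proj_Qn n (laurent b x)) = operator_of (q n) x"
      by (simp only: q_def proj_Qn_eq_op laurent_a laurent_b op_mult op_ell2 x)
    then have "T x = x + scale_seq s (proj_P x) - scale_seq s (operator_of (q n) x)"
      by (simp add: T_def scale_op_def)
    then show ?thesis
      by (simp add: op_smul op_minus[OF x] scale_seq_diff proj_P_eq_op)
  qed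
  have T1: "T1 x = x + operator_of (smul (- s\<^sup>2) (T1_matrix n)) x" if x: "x \<in> ell2" for x
  proof -
    have Q: "proj_Q y = operator_of (1 - half_proj 0) y" if "y \<in> ell2" for y :: "'n seq"
      using op_one_minus[OF that, of "half_proj 0"] by (simp add: proj_Q_def proj_P_eq_op)
    have "proj_Qn n (laurent b (proj_Q (laurent a (proj_Qn n x)))) = operator_of (T1_matrix n) x"
      by (simp only: T1_matrix_def proj_Qn_eq_op laurent_a laurent_b Q op_mult op_ell2 x)
    then have "T1 x = x - scale_seq (s\<^sup>2) (operator_of (T1_matrix n) x)"
      by (simp add: T1_def scale_op_def)
    then show ?thesis by (simp add: op_smul scale_seq_minus)
  qed
  have T2: "T2 x = x + operator_of (smul (- s\<^sup>2) (T2_matrix n)) x" if x: "x \<in> ell2" for x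
  proof -
    have Q: "(id - proj_Qn n) y = operator_of (1 - half_proj n) y" if "y \<in> ell2" for y :: "'n seq"
      using op_one_minus[OF that, of "half_proj n"] by (simp add: proj_Qn_eq_op)
    have "(id - proj_Qn n) (laurent b (proj_P (laurent a ((id - proj_Qn n) x)))) = operator_of (T2_matrix n) x"
      by (simp only: T2_matrix_def proj_P_eq_op laurent_a laurent_b Q op_mult op_ell2 x)
    then have "T2 x = x - scale_seq (s\<^sup>2) (operator_of (T2_matrix n) x)"
      by (simp add: T2_def scale_op_def)
    then show ?thesis by (simp add: op_smul scale_seq_minus)
  qed
  show "determinant_class T" "fredholm_det T = schur_det (1 + smul s (half_proj 0 - q n))"
    using fredholm_det_eq_schur_det[OF T nuclear_smul[OF nuclear_difference] rank_approximable_smul[OF rank_approximable_difference]] by blast+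
  show "determinant_class T1" "fredholm_det T1 = schur_det (1 + smul (- s\<^sup>2) (T1_matrix n))"
    using fredholm_det_eq_schur_det[OF T1 nuclear_smul[OF nuclear_T_matrix(1)] rank_approximable_smul[OF rank_approximable_T_matrix(1)]] by blast+
  show "determinant_class T2" "fredholm_det T2 = schur_det (1 + smul (- s\<^sup>2) (T2_matrix n))"
    using fredholm_det_eq_schur_det[OF T2 nuclear_smul[OF nuclear_T_matrix(2)] rank_approximable_smul[OF rank_approximable_T_matrix(2)]] by blast+
qed

text \<open>The second identity is the first one for the exchanged pair \<open>(q, P)\<close> and \<open>- s\<close> in place of \<open>s\<close>.\<close>

lemma schur_det_identities:
  shows "s \<noteq> - 1 \<Longrightarrow> schur_det (1 + smul s (half_proj 0 - q n)) =
      (1 + s) powi (n * int CARD('n) + w) * schur_det (1 + smul (- s\<^sup>2) (T1_matrix n))"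
    and "s \<noteq> 1 \<Longrightarrow> schur_det (1 + smul s (half_proj 0 - q n)) =
      (1 - s) powi (- n * int CARD('n) - w) * schur_det (1 + smul (- s\<^sup>2) (T2_matrix n))"
proof -
  show "schur_det (1 + smul s (half_proj 0 - q n)) =
      (1 + s) powi (n * int CARD('n) + w) * schur_det (1 + smul (- s\<^sup>2) (T1_matrix n))" if "s \<noteq> - 1"
    using nuclear_pair.schur_det_difference[OF nuclear_pair trace_difference that] by (simp only: schur_det_T1_matrix)
  assume "s \<noteq> 1"
  then have s: "- s \<noteq> - 1" by simp
  have eq: "smul (- s) (q n - half_proj 0) = smul s (half_proj 0 - q n)" by (simp add: smul_simps)
  from nuclear_pair.schur_det_difference[OF nuclear_pair_swap trace_difference_swap s, of n]
  show "schur_det (1 + smul s (half_proj 0 - q n)) =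
      (1 - s) powi (- n * int CARD('n) - w) * schur_det (1 + smul (- s\<^sup>2) (T2_matrix n))"
    unfolding eq schur_det_T2_matrix power2_minus by simp
qed

end

theorem theorem4p3:
  fixes a :: "complex \<Rightarrow> complex^'n^'n"
    and w n :: int
    and s :: complex
  assumes "a \<in> K11"
    and "continuous_on (sphere 0 1) a"
    and "\<forall>t\<in>sphere 0 1. det (a t) \<noteq> 0"
    and "winding_number ((\<lambda>t. det (a t)) \<circ> circlepath 0 1) 0 = of_int w"
  shows
    "let La = laurent a;
         Lb = laurent (\<lambda>t. matrix_inv (a t));
         T = id + s *\<^sub>o proj_P - s *\<^sub>o (La \<circ> proj_Qn n \<circ> Lb);
         T1 = id - s\<^sup>2 *\<^sub>o (proj_Qn n \<circ> Lb \<circ> proj_Q \<circ> La \<circ> proj_Qn n);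
         T2 = id - s\<^sup>2 *\<^sub>o ((id - proj_Qn n) \<circ> Lb \<circ> proj_P \<circ> La \<circ> (id - proj_Qn n))
     in determinant_class T \<and> determinant_class T1 \<and> determinant_class T2 \<and>
        (s \<noteq> -1 \<longrightarrow>
           fredholm_det T = (1 + s) powi (n * int CARD('n) + w) * fredholm_det T1) \<and>
        (s \<noteq> 1 \<longrightarrow>
           fredholm_det T = (1 - s) powi (- n * int CARD('n) - w) * fredholm_det T2)"
proof -
  interpret invertible_symbol a w by unfold_locales (rule assms)+
  have "b = (\<lambda>t. matrix_inv (a t))" by (rule ext) (rule b_def)
  note d = determinants[of s n, unfolded this]
  show ?thesis
    unfolding Let_def d using d(1,3,5) schur_det_identities[of s n] by blast
qed

end
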